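(* Let $s\ge 0$, $\alpha>0$, $\lambda>0$ and $u_0\in H^s_p(\mathbb{T})$ be given. There exists a bounded linear operator $K_\lambda$ from $H^s_p(\mathbb{T})$ to $H^s_p(\mathbb{T})$, taking values in the set of admissible controls $\{G(h):h\in H^s_p(\mathbb{T})\}$, such that the unique solution $u\in C([0,+\infty),H^s_p(\mathbb{T}))$ of the closed-loop system $$\partial_t u-\alpha\mathcal{H}\partial_x^2u-\partial_x^3u=K_\lambda u,\quad t>0,\ x\in\mathbb{T},\qquad u(x,0)=u_0(x),\ x\in\mathbb{T},$$ satisfies $$\|u(\cdot,t)-[u_0]\|_{H^s_p(\mathbb{T})}\le M e^{-\lambda t}\|u_0-[u_0]\|_{H^s_p(\mathbb{T})}$$ for all $t\ge 0$ and some positive constant $M=M(g,\lambda,\alpha,s)$.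
   Context: $\mathbb{T}=\mathbb{R}/(2\pi\mathbb{Z})$. For a periodic distribution $f$ on $\mathbb{T}$, $\widehat f(k)=\frac1{2\pi}\int_0^{2\pi}f(x)e^{-ikx}dx$ ($k\in\mathbb{Z}$), and $H^s_p(\mathbb{T})$ is the Hilbert space of periodic distributions with $\|f\|^2_{H^s_p(\mathbb{T})}=2\pi\sum_{k\in\mathbb{Z}}(1+|k|^2)^s|\widehat f(k)|^2<\infty$. $[f]=\frac1{2\pi}\int_0^{2\pi}f(x)\,dx$ is the mean value of $f$. $\mathcal{H}$ is the periodic Hilbert transform: $\widehat{\mathcal{H}f}(k)=-i\,\mathrm{sgn}(k)\widehat f(k)$, with $\mathrm{sgn}(0)=0$. Throughout, $g$ is a fixed real non-negative smooth function on $\mathbb{T}$ with $\int_0^{2\pi}g(x)\,dx=1$, supported in $\omega$, where $\omega=\{x\in\mathbb{T}:g(x)>0\}$ is an open interval. The operator $G$ is $G(h)(x)=g(x)\bigl[h(x)-\int_0^{2\pi}g(y)h(y)\,dy\bigr]$; only controls of the form $G(h)$ are allowed. Solutions are mild solutions: $u(t)=U(t)u_0+\int_0^tU(t-t')K_\lambda u(t')\,dt'$, where $\widehat{U(t)\varphi}(k)=e^{ik^2[\alpha\,\mathrm{sgn}(k)-k]t}\,\widehat\varphi(k)$. The arguments displayed in $M(g,\lambda,\alpha,s)$ are the quantities on which the constant depends. *)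

theory Defs
  imports "HOL-Analysis.Analysis"
begin

section \<open>Smooth periodic functions\<close>

text \<open>Functions on the torus are \<open>2\<pi>\<close>-periodic functions on the real line.\<close>

definition vderivs :: "nat \<Rightarrow> (real \<Rightarrow> 'a::real_normed_vector) \<Rightarrow> real \<Rightarrow> 'a" where
  "vderivs n \<phi> = ((\<lambda>\<psi> x. vector_derivative \<psi> (at x)) ^^ n) \<phi>"

definition smooth_periodic :: "(real \<Rightarrow> 'a::real_normed_vector) \<Rightarrow> bool" where
  "smooth_periodic \<phi> \<longleftrightarrow>
     (\<forall>n x. vderivs n \<phi> differentiable (at x)) \<and> (\<forall>x. \<phi> (x + 2 * pi) = \<phi> x)"

lemma vderivs_0 [simp]: "vderivs 0 \<phi> = \<phi>"
  by (simp add: vderivs_def)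

lemma vderivs_Suc: "vderivs (Suc n) \<phi> = (\<lambda>x. vector_derivative (vderivs n \<phi>) (at x))"
  by (simp add: vderivs_def)

lemma smooth_periodic_has_vector_derivative:
  "smooth_periodic \<phi> \<Longrightarrow> (vderivs n \<phi> has_vector_derivative vderivs (Suc n) \<phi> x) (at x)"
  by (simp add: smooth_periodic_def vderivs_Suc vector_derivative_works)

lemma smooth_periodic_period: "smooth_periodic \<phi> \<Longrightarrow> \<phi> (x + 2 * pi) = \<phi> x"
  by (simp add: smooth_periodic_def)

lemma vderivs_unique:
  assumes "F 0 = \<phi>" and "\<And>n x. (F n has_vector_derivative F (Suc n) x) (at x)"
  shows "vderivs n \<phi> = F n"
proof (induction n)
  case 0
  then show ?case using assms(1) by simp
next
  case (Suc n)
  show ?case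
    unfolding vderivs_Suc Suc using assms(2) by (auto simp: vector_derivative_at)
qed

lemma smooth_periodicI:
  assumes "F 0 = \<phi>" and "\<And>n x. (F n has_vector_derivative F (Suc n) x) (at x)"
    and "\<And>x. \<phi> (x + 2 * pi) = \<phi> x"
  shows "smooth_periodic \<phi>"
  unfolding smooth_periodic_def
  using assms vderivs_unique[of F, OF assms(1,2)]
  by (auto intro: differentiableI_vector)

lemma vderivs_add:
  assumes "smooth_periodic \<phi>" "smooth_periodic \<psi>"
  shows "vderivs n (\<lambda>x. \<phi> x + \<psi> x) = (\<lambda>x. vderivs n \<phi> x + vderivs n \<psi> x)"
  by (rule vderivs_unique[where F = "\<lambda>n x. vderivs n \<phi> x + vderivs n \<psi> x"])
    (auto intro!: has_vector_derivative_add smooth_periodic_has_vector_derivative assms)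

lemma smooth_periodic_add:
  assumes "smooth_periodic \<phi>" "smooth_periodic \<psi>"
  shows "smooth_periodic (\<lambda>x. \<phi> x + \<psi> x)"
  by (rule smooth_periodicI[where F = "\<lambda>n x. vderivs n \<phi> x + vderivs n \<psi> x"])
    (auto intro!: has_vector_derivative_add smooth_periodic_has_vector_derivative assms
      simp: smooth_periodic_period assms)

lemma smooth_periodic_of_real:
  assumes "smooth_periodic g"
  shows "smooth_periodic (\<lambda>x. complex_of_real (g x))"
  by (rule smooth_periodicI[where F = "\<lambda>n x. complex_of_real (vderivs n g x)"])
    (auto intro!: has_vector_derivative_of_real smooth_periodic_has_vector_derivative assms
      simp: smooth_periodic_period assms has_real_derivative_iff_has_vector_derivative)

lemma leibniz_shift:
  fixes a b :: "nat \<Rightarrow> 'a::comm_ring_1"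
  shows "(\<Sum>j\<le>n. of_nat (n choose j) * (a j * b (Suc (n - j)) + a (Suc j) * b (n - j)))
       = (\<Sum>j\<le>Suc n. of_nat (Suc n choose j) * (a j * b (Suc n - j)))"
proof -
  have "(\<Sum>j\<le>Suc n. of_nat (Suc n choose j) * (a j * b (Suc n - j)))
      = a 0 * b (Suc n)
        + (\<Sum>j\<le>n. of_nat (n choose Suc j) * (a (Suc j) * b (n - j)))
        + (\<Sum>j\<le>n. of_nat (n choose j) * (a (Suc j) * b (n - j)))"
    by (simp add: sum.atMost_Suc_shift algebra_simps sum.distrib del: sum.atMost_Suc)
  also have "a 0 * b (Suc n) + (\<Sum>j\<le>n. of_nat (n choose Suc j) * (a (Suc j) * b (n - j)))
      = (\<Sum>j\<le>Suc n. of_nat (n choose j) * (a j * b (Suc n - j)))"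
    by (simp add: sum.atMost_Suc_shift binomial_eq_0 del: sum.atMost_Suc)
  also have "\<dots> = (\<Sum>j\<le>n. of_nat (n choose j) * (a j * b (Suc (n - j))))"
    by (simp add: Suc_diff_le binomial_eq_0)
  finally show ?thesis
    by (simp add: sum.distrib algebra_simps)
qed

lemma
  fixes \<phi> \<psi> :: "real \<Rightarrow> complex"
  assumes "smooth_periodic \<phi>" "smooth_periodic \<psi>"
  shows smooth_periodic_mult: "smooth_periodic (\<lambda>x. \<phi> x * \<psi> x)"
    and vderivs_mult: "vderivs n (\<lambda>x. \<phi> x * \<psi> x)
      = (\<lambda>x. \<Sum>j\<le>n. of_nat (n choose j) * (vderivs j \<phi> x * vderivs (n - j) \<psi> x))"
proof -
  define F where "F = (\<lambda>n x. \<Sum>j\<le>n. of_nat (n choose j) * (vderivs j \<phi> x * vderivs (n - j) \<psi> x))"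
  have F0: "F 0 = (\<lambda>x. \<phi> x * \<psi> x)" by (simp add: F_def)
  have F_Suc: "(F n has_vector_derivative F (Suc n) x) (at x)" for n x
  proof -
    have "F (Suc n) x = (\<Sum>j\<le>n. of_nat (n choose j) *
        (vderivs j \<phi> x * vderivs (Suc (n - j)) \<psi> x + vderivs (Suc j) \<phi> x * vderivs (n - j) \<psi> x))"
      unfolding F_def
      by (rule leibniz_shift[of n "\<lambda>j. vderivs j \<phi> x" "\<lambda>j. vderivs j \<psi> x", symmetric])
    then show ?thesis
      unfolding F_def
      by (auto intro!: has_vector_derivative_sum has_vector_derivative_mult_right
          has_vector_derivative_mult smooth_periodic_has_vector_derivative assms simp del: sum.atMost_Suc)
  qed
  show "smooth_periodic (\<lambda>x. \<phi> x * \<psi> x)"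
    by (rule smooth_periodicI[OF F0 F_Suc]) (simp add: smooth_periodic_period assms)
  show "vderivs n (\<lambda>x. \<phi> x * \<psi> x)
      = (\<lambda>x. \<Sum>j\<le>n. of_nat (n choose j) * (vderivs j \<phi> x * vderivs (n - j) \<psi> x))"
    using vderivs_unique[OF F0 F_Suc] by (simp add: F_def)
qed

lemma smooth_periodic_const: "smooth_periodic (\<lambda>_. c)"
  by (rule smooth_periodicI[where F = "\<lambda>n _. if n = 0 then c else 0"])
    (auto intro: has_vector_derivative_const)

lemma smooth_periodic_scale:
  fixes \<phi> :: "real \<Rightarrow> complex"
  assumes "smooth_periodic \<phi>"
  shows "smooth_periodic (\<lambda>x. c * \<phi> x)"
  by (intro smooth_periodic_mult smooth_periodic_const assms)

lemma smooth_periodic_exp: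
  "smooth_periodic (\<lambda>x. exp (- (\<i> * of_int k * complex_of_real x)))"
proof (rule smooth_periodicI[where
      F = "\<lambda>n x. (- (\<i> * of_int k)) ^ n * exp (- (\<i> * of_int k * complex_of_real x))"])
  fix n x
  have "((\<lambda>z. (- (\<i> * of_int k)) ^ n * exp (- (\<i> * of_int k * z))) has_field_derivative
      (- (\<i> * of_int k)) ^ Suc n * exp (- (\<i> * of_int k * complex_of_real x)))
      (at (complex_of_real x))"
    by (auto intro!: derivative_eq_intros)
  then show "((\<lambda>x. (- (\<i> * of_int k)) ^ n * exp (- (\<i> * of_int k * complex_of_real x)))
      has_vector_derivative
      (- (\<i> * of_int k)) ^ Suc n * exp (- (\<i> * of_int k * complex_of_real x))) (at x)"
    by (rule has_vector_derivative_real_field)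
next
  fix x
  have "exp (- (\<i> * of_int k * complex_of_real (x + 2 * pi)))
      = exp (- (\<i> * of_int k * complex_of_real x)) * exp (2 * of_int (- k) * of_real pi * \<i>)"
    by (simp add: exp_add[symmetric] algebra_simps)
  also have "exp (2 * of_int (- k) * complex_of_real pi * \<i>) = (1::complex)"
    by (subst exp_eq_1) (auto intro!: exI[of _ "- k"])
  finally show "exp (- (\<i> * of_int k * complex_of_real (x + 2 * pi)))
      = exp (- (\<i> * of_int k * complex_of_real x))" by simp
qed simp

lemma smooth_periodic_continuous_on:
  assumes "smooth_periodic \<phi>"
  shows "continuous_on S (vderivs n \<phi>)"
  using assms
  by (meson continuous_at_imp_continuous_on has_vector_derivative_continuous
      smooth_periodic_has_vector_derivative)

lemma vderivs_periodic:
  assumes "smooth_periodic \<phi>"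
  shows "vderivs n \<phi> (x + 2 * pi) = vderivs n \<phi> x"
proof -
  define F where "F = (\<lambda>n x. vderivs n \<phi> (x + 2 * pi))"
  have F_Suc: "(F n has_vector_derivative F (Suc n) x) (at x)" for n x
  proof -
    have "((vderivs n \<phi> \<circ> (\<lambda>x. x + 2 * pi)) has_vector_derivative 1 *\<^sub>R vderivs (Suc n) \<phi> (x + 2 * pi)) (at x)"
      by (rule vector_diff_chain_at)
        (auto intro!: derivative_eq_intros smooth_periodic_has_vector_derivative assms)
    then show ?thesis by (simp add: F_def o_def)
  qed
  have F0: "F 0 = \<phi>" using assms by (simp add: F_def smooth_periodic_period)
  show ?thesis using vderivs_unique[OF F0 F_Suc, of n] by (simp add: F_def fun_eq_iff)
qed

lemma vderivs_bounded:
  assumes "smooth_periodic \<phi>"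
  shows "\<exists>B\<ge>0. \<forall>x. norm (vderivs n \<phi> x) \<le> B"
proof -
  have "bounded (vderivs n \<phi> ` {0..2 * pi})"
    by (intro compact_imp_bounded compact_continuous_image smooth_periodic_continuous_on assms) auto
  then obtain B where B: "\<And>x. x \<in> {0..2 * pi} \<Longrightarrow> norm (vderivs n \<phi> x) \<le> B"
    by (metis bounded_iff imageI)
  have nat_shift: "vderivs n \<phi> (x + 2 * pi * real m) = vderivs n \<phi> x" for x m
  proof (induction m)
    case (Suc m)
    have "x + 2 * pi * real (Suc m) = (x + 2 * pi * real m) + 2 * pi" by (simp add: algebra_simps)
    then show ?case using Suc vderivs_periodic[OF assms, of n] by metis
  qed simp
  have int_shift: "vderivs n \<phi> (x + 2 * pi * of_int k) = vderivs n \<phi> x" for x k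
  proof (cases "k \<ge> 0")
    case True
    then show ?thesis using nat_shift[of x "nat k"] by simp
  next
    case False
    then show ?thesis
      using nat_shift[of "x + 2 * pi * of_int k" "nat (- k)"] by (simp add: algebra_simps)
  qed
  have "norm (vderivs n \<phi> x) \<le> B" for x
  proof -
    define k where "k = \<lfloor>x / (2 * pi)\<rfloor>"
    have k: "of_int k \<le> x / (2 * pi)" "x / (2 * pi) < of_int k + 1"
      unfolding k_def by linarith+
    have "2 * pi * of_int k \<le> x" "x \<le> 2 * pi * of_int k + 2 * pi"
      using k pi_gt_zero by (auto simp: field_simps)
    then have "x + 2 * pi * of_int (- k) \<in> {0..2 * pi}" by auto
    then show ?thesis using B int_shift by metis
  qed
  moreover have "B \<ge> 0" using B[of 0] norm_ge_zero[of "vderivs n \<phi> 0"] by (simp del: norm_ge_zero)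
  ultimately show ?thesis by blast
qed


section \<open>Periodic distributions\<close>

text \<open>
  The continuous linear functionals on the smooth periodic functions, whose Frechet topology is
  given by the sup norms of the derivatives. Functionals are set to \<open>0\<close> outside the test
  functions, so that equality is equality of distributions. The pairing is normalised so that
  an integrable function \<open>f\<close> acts by \<open>\<phi> \<mapsto> \<integral> f \<phi>\<close> over one period.
\<close>

definition continuous_functional :: "((real \<Rightarrow> complex) \<Rightarrow> complex) \<Rightarrow> bool" where
  "continuous_functional T \<longleftrightarrow>
     (\<exists>C N. \<forall>\<phi> B. smooth_periodic \<phi> \<longrightarrow> (\<forall>j\<le>N. \<forall>x. norm (vderivs j \<phi> x) \<le> B)
        \<longrightarrow> norm (T \<phi>) \<le> C * B)"

definition is_pdist :: "((real \<Rightarrow> complex) \<Rightarrow> complex) \<Rightarrow> bool" where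
  "is_pdist T \<longleftrightarrow>
     (\<forall>\<phi> \<psi>. smooth_periodic \<phi> \<longrightarrow> smooth_periodic \<psi> \<longrightarrow> T (\<lambda>x. \<phi> x + \<psi> x) = T \<phi> + T \<psi>) \<and>
     (\<forall>c \<phi>. smooth_periodic \<phi> \<longrightarrow> T (\<lambda>x. c * \<phi> x) = c * T \<phi>) \<and>
     continuous_functional T \<and>
     (\<forall>\<phi>. \<not> smooth_periodic \<phi> \<longrightarrow> T \<phi> = 0)"

lemma is_pdist_0: "is_pdist (\<lambda>_. 0)"
  by (auto simp: is_pdist_def continuous_functional_def intro: exI[of _ 0])

typedef pdist = "{T. is_pdist T}" morphisms pairing Abs_pdist
  using is_pdist_0 by blast

setup_lifting type_definition_pdist

lemma is_pdist_cmult: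
  assumes "is_pdist S"
  shows "is_pdist (\<lambda>\<phi>. c * S \<phi>)"
proof -
  obtain C N where C: "\<And>\<phi> B. smooth_periodic \<phi> \<Longrightarrow> (\<forall>j\<le>N. \<forall>x. norm (vderivs j \<phi> x) \<le> B)
      \<Longrightarrow> norm (S \<phi>) \<le> C * B"
    using assms unfolding is_pdist_def continuous_functional_def by metis
  have "continuous_functional (\<lambda>\<phi>. c * S \<phi>)"
    unfolding continuous_functional_def
  proof (intro exI allI impI)
    fix \<phi> :: "real \<Rightarrow> complex" and B
    assume "smooth_periodic \<phi>" "\<forall>j\<le>N. \<forall>x. norm (vderivs j \<phi> x) \<le> B"
    then show "norm (c * S \<phi>) \<le> (norm c * C) * B"
      using mult_left_mono[OF C, of \<phi> B "norm c"] by (simp add: norm_mult mult.assoc)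
  qed
  then show ?thesis using assms by (simp add: is_pdist_def algebra_simps)
qed

lemma is_pdist_add:
  assumes "is_pdist S" "is_pdist T"
  shows "is_pdist (\<lambda>\<phi>. S \<phi> + T \<phi>)"
proof -
  obtain C N where C: "\<And>\<phi> B. smooth_periodic \<phi> \<Longrightarrow> (\<forall>j\<le>N. \<forall>x. norm (vderivs j \<phi> x) \<le> B)
      \<Longrightarrow> norm (S \<phi>) \<le> C * B"
    using assms unfolding is_pdist_def continuous_functional_def by metis
  obtain D M where D: "\<And>\<phi> B. smooth_periodic \<phi> \<Longrightarrow> (\<forall>j\<le>M. \<forall>x. norm (vderivs j \<phi> x) \<le> B)
      \<Longrightarrow> norm (T \<phi>) \<le> D * B"
    using assms unfolding is_pdist_def continuous_functional_def by metis
  have "continuous_functional (\<lambda>\<phi>. S \<phi> + T \<phi>)"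
    unfolding continuous_functional_def
  proof (intro exI allI impI)
    fix \<phi> :: "real \<Rightarrow> complex" and B
    assume *: "smooth_periodic \<phi>" "\<forall>j\<le>max N M. \<forall>x. norm (vderivs j \<phi> x) \<le> B"
    then have "norm (S \<phi>) \<le> C * B" "norm (T \<phi>) \<le> D * B"
      by (auto intro!: C D)
    then show "norm (S \<phi> + T \<phi>) \<le> (C + D) * B"
      using norm_triangle_ineq[of "S \<phi>" "T \<phi>"] by (simp add: distrib_right)
  qed
  then show ?thesis using assms by (simp add: is_pdist_def algebra_simps)
qed

instantiation pdist :: real_vector
begin

lift_definition zero_pdist :: pdist is "\<lambda>_. 0"
  by (rule is_pdist_0)

lift_definition plus_pdist :: "pdist \<Rightarrow> pdist \<Rightarrow> pdist" is "\<lambda>S T \<phi>. S \<phi> + T \<phi>"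
  by (rule is_pdist_add)

lift_definition uminus_pdist :: "pdist \<Rightarrow> pdist" is "\<lambda>S \<phi>. - S \<phi>"
  using is_pdist_cmult[of _ "- 1"] by simp

lift_definition minus_pdist :: "pdist \<Rightarrow> pdist \<Rightarrow> pdist" is "\<lambda>S T \<phi>. S \<phi> - T \<phi>"
  using is_pdist_add[OF _ is_pdist_cmult[of _ "- 1"]] by simp

lift_definition scaleR_pdist :: "real \<Rightarrow> pdist \<Rightarrow> pdist" is "\<lambda>r S \<phi>. of_real r * S \<phi>"
  by (rule is_pdist_cmult)

instance
  by standard (transfer; auto simp: algebra_simps)+

end

lift_definition scaleC_pdist :: "complex \<Rightarrow> pdist \<Rightarrow> pdist" is "\<lambda>c S \<phi>. c * S \<phi>"
  by (rule is_pdist_cmult)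

lift_definition one_pdist :: pdist is
  "\<lambda>\<phi>. if smooth_periodic \<phi> then integral {0..2 * pi} \<phi> else 0"
proof -
  have int: "\<phi> integrable_on {0..2 * pi}" if "smooth_periodic \<phi>" for \<phi> :: "real \<Rightarrow> complex"
    using smooth_periodic_continuous_on[OF that, of "{0..2 * pi}" 0]
    by (auto intro: integrable_continuous_interval)
  have "continuous_functional (\<lambda>\<phi>. if smooth_periodic \<phi> then integral {0..2 * pi} \<phi> else 0)"
    unfolding continuous_functional_def
  proof (intro exI allI impI)
    fix \<phi> :: "real \<Rightarrow> complex" and B
    assume *: "smooth_periodic \<phi>" "\<forall>j\<le>0. \<forall>x. norm (vderivs j \<phi> x) \<le> B"
    have "norm (integral {0..2 * pi} \<phi>) \<le> B * (2 * pi - 0)"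
      using * smooth_periodic_continuous_on[OF *(1), of "{0..2 * pi}" 0]
      by (intro integral_bound) auto
    then show "norm (if smooth_periodic \<phi> then integral {0..2 * pi} \<phi> else 0) \<le> (2 * pi) * B"
      using * by (simp add: mult.commute)
  qed
  then show "is_pdist (\<lambda>\<phi>. if smooth_periodic \<phi> then integral {0..2 * pi} \<phi> else 0)"
    unfolding is_pdist_def
    by (auto simp: smooth_periodic_add smooth_periodic_scale integral_add int)
qed

text \<open>Multiplication of a distribution by a smooth function \<open>a\<close> (and \<open>0\<close> if \<open>a\<close> is not smooth
  and periodic).\<close>

lift_definition mult_pdist :: "(real \<Rightarrow> complex) \<Rightarrow> pdist \<Rightarrow> pdist" is
  "\<lambda>a S \<phi>. if smooth_periodic a \<and> smooth_periodic \<phi> then S (\<lambda>x. a x * \<phi> x) else 0"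
proof -
  fix a :: "real \<Rightarrow> complex" and S :: "(real \<Rightarrow> complex) \<Rightarrow> complex"
  assume S: "is_pdist S"
  let ?T = "\<lambda>\<phi>. if smooth_periodic a \<and> smooth_periodic \<phi> then S (\<lambda>x. a x * \<phi> x) else 0"
  show "is_pdist ?T"
  proof (cases "smooth_periodic a")
    case False
    then show ?thesis using is_pdist_0 by simp
  next
    case a: True
    obtain C N where C: "\<And>\<phi> B. smooth_periodic \<phi> \<Longrightarrow> (\<forall>j\<le>N. \<forall>x. norm (vderivs j \<phi> x) \<le> B)
        \<Longrightarrow> norm (S \<phi>) \<le> C * B"
      using S unfolding is_pdist_def continuous_functional_def by metis
    obtain A where A: "\<And>n. A n \<ge> 0" "\<And>n x. norm (vderivs n a x) \<le> A n"
      using vderivs_bounded[OF a] by metis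
    define E where "E = (\<Sum>n\<le>N. \<Sum>j\<le>n. real (n choose j) * A j)"
    have "continuous_functional ?T"
      unfolding continuous_functional_def
    proof (intro exI allI impI)
      fix \<phi> :: "real \<Rightarrow> complex" and B
      assume \<phi>: "smooth_periodic \<phi>" and B: "\<forall>j\<le>N. \<forall>x. norm (vderivs j \<phi> x) \<le> B"
      have B0: "0 \<le> B" using B norm_ge_zero order_trans by blast
      have "norm (vderivs n (\<lambda>x. a x * \<phi> x) x) \<le> E * B" if "n \<le> N" for n x
      proof -
        have "norm (vderivs n (\<lambda>x. a x * \<phi> x) x)
            \<le> (\<Sum>j\<le>n. norm (of_nat (n choose j) * (vderivs j a x * vderivs (n - j) \<phi> x)))"
          unfolding vderivs_mult[OF a \<phi>] by (rule norm_sum)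
        also have "\<dots> \<le> (\<Sum>j\<le>n. real (n choose j) * (A j * B))"
          unfolding norm_mult norm_of_nat
          using B that by (intro sum_mono mult_left_mono mult_mono A) auto
        also have "\<dots> = (\<Sum>j\<le>n. real (n choose j) * A j) * B"
          by (simp add: sum_distrib_right mult.assoc)
        also have "\<dots> \<le> E * B"
          unfolding E_def using that A(1) B0
          by (intro mult_right_mono member_le_sum) (auto intro!: sum_nonneg)
        finally show ?thesis .
      qed
      then have "norm (S (\<lambda>x. a x * \<phi> x)) \<le> C * (E * B)"
        by (intro C smooth_periodic_mult a \<phi>) auto
      then show "norm (?T \<phi>) \<le> (C * E) * B"
        using a \<phi> by (simp add: mult.assoc)
    qed
    moreover have "S (\<lambda>x. a x * (\<phi> x + \<psi> x)) = S (\<lambda>x. a x * \<phi> x) + S (\<lambda>x. a x * \<psi> x)"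
      if "smooth_periodic \<phi>" "smooth_periodic \<psi>" for \<phi> \<psi>
      using S smooth_periodic_mult[OF a that(1)] smooth_periodic_mult[OF a that(2)]
      by (simp add: is_pdist_def distrib_left)
    moreover have "S (\<lambda>x. a x * (c * \<phi> x)) = c * S (\<lambda>x. a x * \<phi> x)"
      if "smooth_periodic \<phi>" for \<phi> c
      using S smooth_periodic_mult[OF a that] by (simp add: is_pdist_def mult.left_commute)
    ultimately show ?thesis
      using a by (simp add: is_pdist_def smooth_periodic_add smooth_periodic_scale)
  qed
qed

definition fourier_coeff :: "pdist \<Rightarrow> int \<Rightarrow> complex" where
  "fourier_coeff f k = pairing f (\<lambda>x. exp (- (\<i> * of_int k * of_real x))) / (2 * of_real pi)"

definition mean :: "pdist \<Rightarrow> complex" where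
  "mean f = pairing f (\<lambda>_. 1) / (2 * of_real pi)"

abbreviation const_pdist :: "complex \<Rightarrow> pdist" where
  "const_pdist c \<equiv> scaleC_pdist c one_pdist"


section \<open>Sobolev spaces\<close>

definition sobolev :: "real \<Rightarrow> pdist set" where
  "sobolev s =
     {f. (\<lambda>k. (1 + (real_of_int k)\<^sup>2) powr s * (norm (fourier_coeff f k))\<^sup>2) summable_on UNIV}"

definition sobolev_norm :: "real \<Rightarrow> pdist \<Rightarrow> real" where
  "sobolev_norm s f =
     sqrt (2 * pi * (\<Sum>\<^sub>\<infinity>k. (1 + (real_of_int k)\<^sup>2) powr s * (norm (fourier_coeff f k))\<^sup>2))"

definition sobolev_bounded_linear :: "real \<Rightarrow> (pdist \<Rightarrow> pdist) \<Rightarrow> bool" where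
  "sobolev_bounded_linear s K \<longleftrightarrow>
     (\<forall>f\<in>sobolev s. K f \<in> sobolev s) \<and>
     (\<forall>f\<in>sobolev s. \<forall>h\<in>sobolev s. K (f + h) = K f + K h) \<and>
     (\<forall>c. \<forall>f\<in>sobolev s. K (scaleC_pdist c f) = scaleC_pdist c (K f)) \<and>
     (\<exists>B. \<forall>f\<in>sobolev s. sobolev_norm s (K f) \<le> B * sobolev_norm s f)"

text \<open>Membership in \<open>C([0,\<infinity>), H\<^sup>s)\<close>; values at negative times are irrelevant.\<close>

definition sobolev_continuous :: "real \<Rightarrow> (real \<Rightarrow> pdist) \<Rightarrow> bool" where
  "sobolev_continuous s u \<longleftrightarrow>
     (\<forall>t\<ge>0. u t \<in> sobolev s) \<and>
     (\<forall>t\<ge>0. ((\<lambda>t'. sobolev_norm s (u t' - u t)) \<longlongrightarrow> 0) (at t within {0..}))"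

text \<open>
  \<open>I\<close> is the (norm-convergent) Riemann integral over \<open>[a,b]\<close> of the function \<open>F\<close> with values in
  the Sobolev space of order \<open>s\<close>. The membership conditions matter because \<open>sobolev_norm s\<close>
  is meaningless outside that space.
\<close>

definition has_sobolev_integral :: "real \<Rightarrow> (real \<Rightarrow> pdist) \<Rightarrow> pdist \<Rightarrow> real \<Rightarrow> real \<Rightarrow> bool" where
  "has_sobolev_integral s F I a b \<longleftrightarrow>
     I \<in> sobolev s \<and> (\<forall>t\<in>{a..b}. F t \<in> sobolev s) \<and>
     (\<forall>\<epsilon>>0. \<exists>\<delta>>0. \<forall>p. p tagged_division_of {a..b} \<and> (\<lambda>t. ball t \<delta>) fine p \<longrightarrow>
        sobolev_norm s ((\<Sum>(t, J)\<in>p. measure lborel J *\<^sub>R F t) - I) < \<epsilon>)"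


section \<open>The control system\<close>

text \<open>\<open>\<omega> = {g > 0}\<close> is an open interval (arc) of the torus: its lift to the real line consists of the
  translates of an open interval of length at most \<open>2\<pi>\<close> by the multiples of \<open>2\<pi>\<close>.\<close>

definition control_profile :: "(real \<Rightarrow> real) \<Rightarrow> bool" where
  "control_profile g \<longleftrightarrow>
     smooth_periodic g \<and> (\<forall>x. 0 \<le> g x) \<and> integral {0..2 * pi} g = 1 \<and>
     (\<exists>a b. a < b \<and> b - a \<le> 2 * pi \<and>
        {x. g x > 0} = (\<Union>k::int. {a + 2 * pi * of_int k <..< b + 2 * pi * of_int k}))"

definition control_op :: "(real \<Rightarrow> real) \<Rightarrow> pdist \<Rightarrow> pdist" where
  "control_op g h =
     mult_pdist (\<lambda>x. of_real (g x)) (h - const_pdist (pairing h (\<lambda>x. of_real (g x))))"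

definition propagator :: "real \<Rightarrow> real \<Rightarrow> pdist \<Rightarrow> pdist" where
  "propagator \<alpha> t f = (THE F. \<forall>k. fourier_coeff F k =
     exp (\<i> * of_real ((real_of_int k)\<^sup>2 * (\<alpha> * sgn (real_of_int k) - real_of_int k) * t))
       * fourier_coeff f k)"

text \<open>Mild solutions of \<open>\<partial>\<^sub>t u - \<alpha> H \<partial>\<^sub>x\<^sup>2 u - \<partial>\<^sub>x\<^sup>3 u = K u\<close>, \<open>u(0) = u0\<close>.\<close>

definition mild_solution ::
  "real \<Rightarrow> real \<Rightarrow> (pdist \<Rightarrow> pdist) \<Rightarrow> pdist \<Rightarrow> (real \<Rightarrow> pdist) \<Rightarrow> bool" where
  "mild_solution s \<alpha> K u0 u \<longleftrightarrow>
     sobolev_continuous s u \<and>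
     (\<forall>t\<ge>0. \<exists>I. has_sobolev_integral s (\<lambda>t'. propagator \<alpha> (t - t') (K (u t'))) I 0 t \<and>
        u t = propagator \<alpha> t u0 + I)"

end

theory Submission
  imports Defs
begin

text \<open>
  The operator \<open>A\<close> of the equation is diagonal in the Fourier basis, with eigenvalues \<open>\<i> \<theta>\<^sub>k\<close>,
  \<open>\<theta>\<^sub>k = k\<^sup>2 (\<alpha> sgn k - k)\<close>. The feedback is obtained by moving this spectrum: one looks for
  bounded operators \<open>X\<close> (invertible) and \<open>Y\<close> and a diagonal operator \<open>D\<close> with

    \<open>A X + G Y = X D\<close>,  \<open>D = diag d\<^sub>j\<close>,  \<open>Re d\<^sub>j \<le> - lam\<close> for \<open>j \<noteq> 0\<close>,  \<open>d\<^sub>0 = 0\<close>.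

  Then \<open>K = G Y X\<^sup>-\<^sup>1\<close> takes its values among the admissible controls, \<open>A + K = X D X\<^sup>-\<^sup>1\<close>, and the
  closed loop is solved by \<open>u(t) = X e\<^sup>t\<^sup>D X\<^sup>-\<^sup>1 u\<^sub>0\<close>. The mean is the coordinate of index \<open>0\<close>, which
  \<open>X\<close> and the flow preserve, and all other coordinates decay at rate \<open>lam\<close>.

  The equation is solved column by column: the column \<open>x\<^sub>j\<close> of \<open>X\<close> is the resolvent of \<open>A\<close> at
  \<open>d\<^sub>j\<close> applied to \<open>- G y\<^sub>j\<close>, where the column \<open>y\<^sub>j\<close> of \<open>Y\<close> is free. For large \<open>|j|\<close> the choice
  \<open>d\<^sub>j = \<i> \<theta>\<^sub>j - lam\<close>, \<open>y\<^sub>j\<close> a multiple of \<open>e\<^sub>j\<close>, gives \<open>x\<^sub>j = e\<^sub>j + r\<^sub>j\<close>. Since \<open>\<theta>\<^sub>k\<close> is cubic in \<open>k\<close>,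
  the other eigenvalues lie at distance at least \<open>|j|\<close> from \<open>\<i> \<theta>\<^sub>j\<close> (\<open>phase_gap\<close>); hence
  \<open>r\<^sub>j = O(1/|j|)\<close>, the tail of \<open>\<Sum> |r\<^sub>j|\<^sup>2\<close> is small, and the matrix with columns \<open>x\<^sub>j\<close> for large
  \<open>|j|\<close> and \<open>e\<^sub>j\<close> for the remaining \<open>j\<close> is invertible, being near the identity.

  The remaining columns, finitely many, are replaced one at a time. Replacing \<open>e\<^sub>j\<close> by \<open>x\<close> keeps an
  invertible \<open>T\<close> invertible if and only if \<open>\<phi>(x) = (T\<^sup>-\<^sup>1 x)\<^sub>j\<close> does not vanish, so one needs a vector
  \<open>x = - (A - d)\<^sup>-\<^sup>1 G y\<close> with \<open>\<phi>(x) \<noteq> 0\<close> (\<open>admissible_column_exists\<close>). If there were none, the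
  function \<open>d \<mapsto> \<phi>((A - d)\<^sup>-\<^sup>1 G y)\<close> would vanish in a half plane for every \<open>y\<close>; separating its poles
  (\<open>resolvents_separate_eigenvalue\<close>), the functional \<open>y \<mapsto> \<phi>(P G y)\<close> would vanish, \<open>P\<close> being the
  projection onto the eigenspace of \<open>\<i> \<theta>\<^sub>j\<close>. That eigenspace may have dimension greater than one,
  but it consists of trigonometric polynomials. Thus some trigonometric polynomial would be constant
  on the interval where \<open>g\<close> is positive, hence constant, in contradiction to \<open>\<phi>(e\<^sub>j) = 1\<close>
  (\<open>control_unique_continuation\<close>).

  All operators act on the space \<open>ell2\<close> of square-summable sequences on \<open>\<int>\<close>, to which the Sobolev
  space of order \<open>s\<close> is isometric by weighting the Fourier coefficients. The transfer rests on the
  convergence of Fourier series of test functions in all derivatives, which shows that a periodic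
  distribution is determined by its coefficients and that multiplication by \<open>g\<close> is a convolution.
  Uniqueness of mild solutions is Gronwall's inequality in \<open>ell2\<close>.
\<close>

section \<open>Square-summable sequences\<close>

definition square_summable :: "(int \<Rightarrow> complex) \<Rightarrow> bool" where
  "square_summable a \<longleftrightarrow> (\<lambda>k. (norm (a k))\<^sup>2) summable_on UNIV"

lemma square_summableI:
  assumes "\<And>F. finite F \<Longrightarrow> L2_set (\<lambda>k. norm (a k)) F \<le> C"
  shows "square_summable a"
  unfolding square_summable_def
proof (rule nonneg_bdd_above_summable_on)
  have "sum (\<lambda>k. (norm (a k))\<^sup>2) F \<le> C\<^sup>2" if "finite F" for F
    using assms[OF that] by (simp add: L2_set_def sqrt_le_D)
  then show "bdd_above (sum (\<lambda>k. (norm (a k))\<^sup>2) ` {F. F \<subseteq> UNIV \<and> finite F})"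
    by (intro bdd_aboveI2) auto
qed simp

lemma L2_set_le_of_square_summable:
  assumes "square_summable a" and "finite F"
  shows "L2_set (\<lambda>k. norm (a k)) F \<le> sqrt (\<Sum>\<^sub>\<infinity>k. (norm (a k))\<^sup>2)"
  unfolding L2_set_def real_sqrt_le_iff
  using assms by (intro finite_sum_le_infsum) (auto simp: square_summable_def)

lemma square_summable_add:
  assumes "square_summable a" "square_summable b"
  shows "square_summable (\<lambda>k. a k + b k)"
proof (rule square_summableI)
  fix F :: "int set" assume F: "finite F"
  have "L2_set (\<lambda>k. norm (a k + b k)) F \<le> L2_set (\<lambda>k. norm (a k) + norm (b k)) F"
    by (intro L2_set_mono) (auto intro: norm_triangle_ineq)
  also have "\<dots> \<le> L2_set (\<lambda>k. norm (a k)) F + L2_set (\<lambda>k. norm (b k)) F"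
    by (rule L2_set_triangle_ineq)
  also have "\<dots> \<le> sqrt (\<Sum>\<^sub>\<infinity>k. (norm (a k))\<^sup>2) + sqrt (\<Sum>\<^sub>\<infinity>k. (norm (b k))\<^sup>2)"
    by (intro add_mono L2_set_le_of_square_summable assms F)
  finally show "L2_set (\<lambda>k. norm (a k + b k)) F \<le> \<dots>" .
qed

lemma square_summable_mult_bounded:
  assumes "square_summable a" and "\<And>k. norm (m k) \<le> B"
  shows "square_summable (\<lambda>k. m k * a k)"
proof (rule square_summableI)
  fix F :: "int set" assume F: "finite F"
  have B: "0 \<le> B" using assms(2) norm_ge_zero order_trans by blast
  have "L2_set (\<lambda>k. norm (m k * a k)) F \<le> L2_set (\<lambda>k. B * norm (a k)) F"
    by (intro L2_set_mono) (auto simp: norm_mult assms intro!: mult_right_mono)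
  also have "\<dots> = B * L2_set (\<lambda>k. norm (a k)) F"
    by (simp add: L2_set_right_distrib B)
  also have "\<dots> \<le> B * sqrt (\<Sum>\<^sub>\<infinity>k. (norm (a k))\<^sup>2)"
    by (intro mult_left_mono L2_set_le_of_square_summable assms F B)
  finally show "L2_set (\<lambda>k. norm (m k * a k)) F \<le> \<dots>" .
qed

typedef ell2 = "{a. square_summable a}" morphisms coord Abs_ell2
  by (rule exI[of _ "\<lambda>_. 0"]) (simp add: square_summable_def)

setup_lifting type_definition_ell2

lemma square_summable_coord: "square_summable (coord a)"
  using coord by simp

lemma ell2_eqI: "(\<And>k. coord a k = coord b k) \<Longrightarrow> a = b"
  by (metis coord_inject ext)

instantiation ell2 :: real_vector
begin

lift_definition zero_ell2 :: ell2 is "\<lambda>_. 0"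
  by (simp add: square_summable_def)

lift_definition plus_ell2 :: "ell2 \<Rightarrow> ell2 \<Rightarrow> ell2" is "\<lambda>a b k. a k + b k"
  by (rule square_summable_add)

lift_definition uminus_ell2 :: "ell2 \<Rightarrow> ell2" is "\<lambda>a k. - a k"
  by (simp add: square_summable_def)

lift_definition minus_ell2 :: "ell2 \<Rightarrow> ell2 \<Rightarrow> ell2" is "\<lambda>a b k. a k - b k"
  using square_summable_add[of _ "\<lambda>k. - _ k"] by (simp add: square_summable_def)

lift_definition scaleR_ell2 :: "real \<Rightarrow> ell2 \<Rightarrow> ell2" is "\<lambda>r a k. of_real r * a k"
  by (rule square_summable_mult_bounded) auto

instance
  by standard (transfer; simp add: algebra_simps)+

end

instantiation ell2 :: real_normed_vector
begin

lift_definition norm_ell2 :: "ell2 \<Rightarrow> real" is "\<lambda>a. sqrt (\<Sum>\<^sub>\<infinity>k. (norm (a k))\<^sup>2)" .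

definition dist_ell2 :: "ell2 \<Rightarrow> ell2 \<Rightarrow> real" where "dist_ell2 a b = norm (a - b)"
definition sgn_ell2 :: "ell2 \<Rightarrow> ell2" where "sgn_ell2 a = a /\<^sub>R norm a"
definition uniformity_ell2 :: "(ell2 \<times> ell2) filter" where
  "uniformity_ell2 = (INF e\<in>{0<..}. principal {(x, y). dist x y < e})"
definition open_ell2 :: "ell2 set \<Rightarrow> bool" where
  "open_ell2 U = (\<forall>x\<in>U. \<forall>\<^sub>F (x', y) in uniformity. x' = x \<longrightarrow> y \<in> U)"

lemma L2_coord_le_norm: "finite F \<Longrightarrow> L2_set (\<lambda>k. norm (coord a k)) F \<le> norm a"
  unfolding norm_ell2.rep_eq by (rule L2_set_le_of_square_summable[OF square_summable_coord])

lemma ell2_norm_leI: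
  assumes "\<And>F. finite F \<Longrightarrow> L2_set (\<lambda>k. norm (coord a k)) F \<le> C"
  shows "norm a \<le> C"
proof -
  have C: "0 \<le> C" using assms[of "{}"] by simp
  have "(\<Sum>\<^sub>\<infinity>k. (norm (coord a k))\<^sup>2) \<le> C\<^sup>2"
  proof (rule infsum_le_finite_sums)
    show "(\<lambda>k. (norm (coord a k))\<^sup>2) summable_on UNIV"
      using square_summable_coord by (simp add: square_summable_def)
    show "sum (\<lambda>k. (norm (coord a k))\<^sup>2) F \<le> C\<^sup>2" if "finite F" for F
      using assms[OF that] by (simp add: L2_set_def sqrt_le_D)
  qed
  then have "sqrt (\<Sum>\<^sub>\<infinity>k. (norm (coord a k))\<^sup>2) \<le> C"
    using C by (simp add: real_le_lsqrt)
  then show ?thesis by (simp add: norm_ell2.rep_eq)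
qed

lemma norm_coord_le: "norm (coord a k) \<le> norm a"
  using L2_coord_le_norm[of "{k}" a] by simp

instance
proof
  fix a b :: ell2 and r :: real and U :: "ell2 set"
  show "dist a b = norm (a - b)" by (rule dist_ell2_def)
  show "sgn a = a /\<^sub>R norm a" by (rule sgn_ell2_def)
  show "uniformity = (INF e\<in>{0<..}. principal {(x::ell2, y). dist x y < e})"
    by (rule uniformity_ell2_def)
  show "open U = (\<forall>x\<in>U. \<forall>\<^sub>F (x', y) in uniformity. x' = x \<longrightarrow> y \<in> U)"
    by (rule open_ell2_def)
  show "norm a = 0 \<longleftrightarrow> a = 0"
  proof
    assume "norm a = 0"
    then have "coord a k = coord 0 k" for k
      using norm_coord_le[of a k] by (simp add: zero_ell2.rep_eq)
    then show "a = 0" by (rule ell2_eqI)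
  qed (simp add: norm_ell2.rep_eq zero_ell2.rep_eq)
  show "norm (a + b) \<le> norm a + norm b"
  proof (rule ell2_norm_leI)
    fix F :: "int set" assume F: "finite F"
    have "L2_set (\<lambda>k. norm (coord (a + b) k)) F
        \<le> L2_set (\<lambda>k. norm (coord a k) + norm (coord b k)) F"
      unfolding plus_ell2.rep_eq by (intro L2_set_mono) (auto intro: norm_triangle_ineq)
    also have "\<dots> \<le> L2_set (\<lambda>k. norm (coord a k)) F + L2_set (\<lambda>k. norm (coord b k)) F"
      by (rule L2_set_triangle_ineq)
    also have "\<dots> \<le> norm a + norm b"
      by (intro add_mono L2_coord_le_norm F)
    finally show "L2_set (\<lambda>k. norm (coord (a + b) k)) F \<le> norm a + norm b" .
  qed
  show "norm (r *\<^sub>R a) = \<bar>r\<bar> * norm a"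
    unfolding norm_ell2.rep_eq scaleR_ell2.rep_eq
    by (simp add: norm_mult power_mult_distrib infsum_cmult_right' real_sqrt_mult)
qed

end

lemmas coord_simps [simp] = zero_ell2.rep_eq plus_ell2.rep_eq uminus_ell2.rep_eq minus_ell2.rep_eq
  scaleR_ell2.rep_eq

lemma bounded_linear_coord: "bounded_linear (\<lambda>a. coord a k)"
  by (rule bounded_linear_intro[where K = 1]) (auto simp: norm_coord_le scaleR_conv_of_real)

lemma coord_sum: "coord (\<Sum>i\<in>I. f i) k = (\<Sum>i\<in>I. coord (f i) k)"
  by (rule linear_sum[OF bounded_linear.linear[OF bounded_linear_coord]])

text \<open>Coordinatewise limits do not increase norms; with this, a Cauchy sequence converges in norm to
  its coordinatewise limit.\<close>

lemma ell2_limit_norm_le: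
  assumes "\<And>k. (\<lambda>n. coord (X n) k) \<longlonglongrightarrow> coord a k" and "\<And>n. n \<ge> N \<Longrightarrow> norm (X n) \<le> C"
  shows "norm a \<le> C"
proof (rule ell2_norm_leI)
  fix F :: "int set" assume F: "finite F"
  have "(\<lambda>n. L2_set (\<lambda>k. norm (coord (X n) k)) F) \<longlonglongrightarrow> L2_set (\<lambda>k. norm (coord a k)) F"
    unfolding L2_set_def by (intro tendsto_intros assms(1))
  moreover have "\<forall>\<^sub>F n in sequentially. L2_set (\<lambda>k. norm (coord (X n) k)) F \<le> C"
    using L2_coord_le_norm[OF F] assms(2) by (meson eventually_sequentiallyI order_trans)
  ultimately show "L2_set (\<lambda>k. norm (coord a k)) F \<le> C"
    by (rule tendsto_upperbound) simp
qed

instance ell2 :: banach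
proof
  fix X :: "nat \<Rightarrow> ell2" assume X: "Cauchy X"
  have "Cauchy (\<lambda>n. coord (X n) k)" for k
    by (rule bounded_linear.Cauchy[OF bounded_linear_coord X])
  then have "convergent (\<lambda>n. coord (X n) k)" for k
    by (rule Cauchy_convergent)
  then have a: "(\<lambda>n. coord (X n) k) \<longlonglongrightarrow> lim (\<lambda>n. coord (X n) k)" for k
    by (simp add: convergent_LIMSEQ_iff)
  define a where "a = (\<lambda>k. lim (\<lambda>n. coord (X n) k))"
  have a: "(\<lambda>n. coord (X n) k) \<longlonglongrightarrow> a k" for k
    unfolding a_def by (rule a)
  obtain C where C: "\<And>n. norm (X n) \<le> C"
    using Cauchy_Bseq[OF X] by (auto simp: Bseq_def)
  have "square_summable a"
  proof (rule square_summableI)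
    fix F :: "int set" assume F: "finite F"
    have "(\<lambda>n. L2_set (\<lambda>k. norm (coord (X n) k)) F) \<longlonglongrightarrow> L2_set (\<lambda>k. norm (a k)) F"
      unfolding L2_set_def by (intro tendsto_intros a)
    then show "L2_set (\<lambda>k. norm (a k)) F \<le> C"
      by (rule LIMSEQ_le_const2) (use order_trans[OF L2_coord_le_norm[OF F] C] in blast)
  qed
  then have coord_a: "coord (Abs_ell2 a) = a" by (simp add: Abs_ell2_inverse)
  have "X \<longlonglongrightarrow> Abs_ell2 a"
  proof (rule LIMSEQ_I)
    fix r :: real assume "0 < r"
    then obtain N where N: "\<And>m n. m \<ge> N \<Longrightarrow> n \<ge> N \<Longrightarrow> norm (X m - X n) < r / 2"
      using CauchyD[OF X, of "r / 2"] by auto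
    have "norm (X n - Abs_ell2 a) \<le> r / 2" if "n \<ge> N" for n
      by (rule ell2_limit_norm_le[where X = "\<lambda>m. X n - X m" and N = N])
        (use that in \<open>auto intro!: tendsto_intros a less_imp_le[OF N] simp: coord_a simp del: less_divide_eq_numeral1 le_divide_eq_numeral1\<close>)
    then have "norm (X n - Abs_ell2 a) < r" if "n \<ge> N" for n
      by (rule le_less_trans) (use that \<open>0 < r\<close> in auto)
    then show "\<exists>no. \<forall>n\<ge>no. norm (X n - Abs_ell2 a) < r" by blast
  qed
  then show "convergent X" by (auto simp: convergent_def)
qed

lift_definition basis :: "int \<Rightarrow> ell2" is "\<lambda>j k. if k = j then 1 else 0"
  by (rule square_summableI[where C = 1])
    (auto simp: L2_set_def if_distrib[of "\<lambda>x. x\<^sup>2"] if_distrib[of norm] cong: if_cong)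

lift_definition cscale :: "complex \<Rightarrow> ell2 \<Rightarrow> ell2" is "\<lambda>c a k. c * a k"
  by (rule square_summable_mult_bounded) auto

lemmas coord_basis [simp] = basis.rep_eq
lemmas coord_cscale [simp] = cscale.rep_eq

lemma norm_cscale: "norm (cscale c a) = norm c * norm a"
  unfolding norm_ell2.rep_eq cscale.rep_eq
  by (simp add: norm_mult power_mult_distrib infsum_cmult_right' real_sqrt_mult)

lemma norm_basis [simp]: "norm (basis j) = 1"
proof (rule antisym)
  show "norm (basis j) \<le> 1"
    by (rule ell2_norm_leI)
      (auto simp: L2_set_def if_distrib[of "\<lambda>x. x\<^sup>2"] if_distrib[of norm] cong: if_cong)
  show "1 \<le> norm (basis j)" using norm_coord_le[of "basis j" j] by simp
qed

lemma cscale_add: "cscale c (a + b) = cscale c a + cscale c b"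
  and cscale_diff: "cscale c (a - b) = cscale c a - cscale c b"
  and cscale_add_left: "cscale (c + d) a = cscale c a + cscale d a"
  and cscale_cscale: "cscale c (cscale d a) = cscale (c * d) a"
  and cscale_scaleR: "cscale c (r *\<^sub>R a) = r *\<^sub>R cscale c a"
  and cscale_0 [simp]: "cscale 0 a = 0"
  and cscale_0_right [simp]: "cscale c 0 = 0"
  and cscale_1 [simp]: "cscale 1 a = a"
  and scaleR_eq_cscale: "r *\<^sub>R a = cscale (of_real r) a"
  by (auto intro!: ell2_eqI simp: algebra_simps)

lemma bounded_linear_cscale: "bounded_linear (cscale c)"
  by (rule bounded_linear_intro[where K = "norm c"])
    (auto simp: cscale_add cscale_scaleR norm_cscale mult.commute)

lemma bounded_linear_cscale_left: "bounded_linear (\<lambda>c. cscale c a)"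
  by (rule bounded_linear_intro[where K = "norm a"])
    (auto simp: cscale_add_left scaleR_eq_cscale cscale_cscale norm_cscale scaleR_conv_of_real)

text \<open>The tails of a square-summable series are small, so a sequence is the norm limit of its finite
  sections. Bounded operators are therefore determined by the images of the basis vectors.\<close>

lemma ell2_has_sum_basis: "((\<lambda>j. cscale (coord a j) (basis j)) has_sum a) UNIV"
  unfolding has_sum_def
proof (rule tendstoI)
  fix r :: real assume r: "0 < r"
  let ?n = "\<lambda>k. (norm (coord a k))\<^sup>2"
  have sm: "?n summable_on UNIV"
    using square_summable_coord by (simp add: square_summable_def)
  have "(sum ?n \<longlongrightarrow> infsum ?n UNIV) (finite_subsets_at_top UNIV)"
    using has_sum_infsum[OF sm] by (simp add: has_sum_def)
  then have near: "\<forall>\<^sub>F F in finite_subsets_at_top UNIV. dist (sum ?n F) (infsum ?n UNIV) < (r / 2)\<^sup>2"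
    by (rule tendstoD) (use r in simp)
  have fin: "\<forall>\<^sub>F F in finite_subsets_at_top (UNIV::int set). finite F"
    by (rule eventually_finite_subsets_at_top_weakI)
  from near fin show "\<forall>\<^sub>F F in finite_subsets_at_top UNIV.
      dist (\<Sum>j\<in>F. cscale (coord a j) (basis j)) a < r"
  proof eventually_elim
    case (elim F)
    have coord_F: "coord (\<Sum>j\<in>F. cscale (coord a j) (basis j)) k = (if k \<in> F then coord a k else 0)" for k
      using elim by (simp add: coord_sum if_distrib cong: if_cong)
    have "norm ((\<Sum>j\<in>F. cscale (coord a j) (basis j)) - a) \<le> r / 2"
    proof (rule ell2_norm_leI)
      fix E :: "int set" assume E: "finite E"
      have "(\<Sum>k\<in>E. (norm (coord ((\<Sum>j\<in>F. cscale (coord a j) (basis j)) - a) k))\<^sup>2)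
          = (\<Sum>k\<in>E. if k \<in> F then 0 else ?n k)"
        by (intro sum.cong) (auto simp: coord_F)
      also have "\<dots> = sum ?n (E - F)"
        using E by (simp add: sum.If_cases Diff_eq)
      also have "\<dots> = sum ?n (E \<union> F) - sum ?n F"
        using E elim(2) by (metis Un_Diff_cancel2 add_diff_cancel_right' finite_Diff
            sum.union_disjoint Diff_disjoint inf_commute)
      also have "\<dots> \<le> infsum ?n UNIV - sum ?n F"
        using E elim(2) by (intro diff_right_mono finite_sum_le_infsum sm) auto
      also have "\<dots> \<le> (r / 2)\<^sup>2"
        using elim(1) by (simp add: dist_real_def)
      finally show "L2_set (\<lambda>k. norm (coord ((\<Sum>j\<in>F. cscale (coord a j) (basis j)) - a) k)) E \<le> r / 2"
        unfolding L2_set_def using r by (intro real_le_lsqrt) auto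
    qed
    then show ?case using r by (simp add: dist_norm)
  qed
qed

section \<open>Bounded complex-linear operators\<close>

definition bounded_clinear :: "(ell2 \<Rightarrow> ell2) \<Rightarrow> bool" where
  "bounded_clinear T \<longleftrightarrow> bounded_linear T \<and> (\<forall>c a. T (cscale c a) = cscale c (T a))"

lemma bounded_clinearI:
  assumes "\<And>a b. T (a + b) = T a + T b" "\<And>c a. T (cscale c a) = cscale c (T a)"
    and "\<And>a. norm (T a) \<le> B * norm a"
  shows "bounded_clinear T"
  unfolding bounded_clinear_def
  by (auto intro!: bounded_linear_intro[where K = B] simp: assms scaleR_eq_cscale mult.commute)

lemma bounded_clinear_add: "bounded_clinear T \<Longrightarrow> T (a + b) = T a + T b"
  and bounded_clinear_diff: "bounded_clinear T \<Longrightarrow> T (a - b) = T a - T b"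
  and bounded_clinear_0: "bounded_clinear T \<Longrightarrow> T 0 = 0"
  and bounded_clinear_cscale: "bounded_clinear T \<Longrightarrow> T (cscale c a) = cscale c (T a)"
  and bounded_clinear_linear: "bounded_clinear T \<Longrightarrow> bounded_linear T"
  by (auto simp: bounded_clinear_def linear_simps)

lemma bounded_clinear_bound:
  assumes "bounded_clinear T"
  obtains B where "B > 0" and "\<And>a. norm (T a) \<le> B * norm a"
  using bounded_linear.pos_bounded[of T] assms by (auto simp: bounded_clinear_def mult.commute)

lemma bounded_clinear_id: "bounded_clinear (\<lambda>a. a)"
  by (rule bounded_clinearI[where B = 1]) auto

lemma bounded_clinear_compose:
  "bounded_clinear S \<Longrightarrow> bounded_clinear T \<Longrightarrow> bounded_clinear (\<lambda>a. S (T a))"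
  by (auto simp: bounded_clinear_def bounded_linear_compose)

lemma bounded_clinear_plus:
  "bounded_clinear S \<Longrightarrow> bounded_clinear T \<Longrightarrow> bounded_clinear (\<lambda>a. S a + T a)"
  by (auto simp: bounded_clinear_def cscale_add intro: bounded_linear_add)

lemma bounded_clinear_minus:
  "bounded_clinear S \<Longrightarrow> bounded_clinear T \<Longrightarrow> bounded_clinear (\<lambda>a. S a - T a)"
  by (auto simp: bounded_clinear_def cscale_diff intro: bounded_linear_sub)

lemma bounded_clinear_rank_one: "bounded_clinear (\<lambda>a. cscale (coord a j) x)"
  by (rule bounded_clinearI[where B = "norm x"])
    (auto simp: cscale_add_left cscale_cscale norm_cscale mult.commute[of _ "norm x"]
      intro!: mult_left_mono norm_coord_le)

lemma bounded_clinear_has_sum_basis: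
  assumes "bounded_clinear T"
  shows "((\<lambda>j. cscale (coord a j) (T (basis j))) has_sum T a) UNIV"
  using has_sum_bounded_linear[OF bounded_clinear_linear[OF assms] ell2_has_sum_basis[of a]]
  by (simp add: bounded_clinear_cscale[OF assms])

lemma bounded_clinear_eqI:
  assumes "bounded_clinear S" "bounded_clinear T" "\<And>j. S (basis j) = T (basis j)"
  shows "S a = T a"
  using has_sum_unique[OF bounded_clinear_has_sum_basis[OF assms(1), of a]]
    bounded_clinear_has_sum_basis[OF assms(2), of a] assms(3) by simp

text \<open>Unbounded multipliers do not act on all of \<open>ell2\<close>; they are given the value \<open>0\<close>.\<close>

lift_definition diag :: "(int \<Rightarrow> complex) \<Rightarrow> ell2 \<Rightarrow> ell2" is
  "\<lambda>m a. if \<exists>B. \<forall>k. norm (m k) \<le> B then (\<lambda>k. m k * a k) else (\<lambda>_. 0)"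
  using square_summable_mult_bounded by (auto simp: square_summable_def[of "\<lambda>_. 0"])

lemma coord_diag:
  assumes "\<And>k. norm (m k) \<le> B"
  shows "coord (diag m a) k = m k * coord a k"
  using assms by (auto simp: diag.rep_eq)

text \<open>Only the multiplier on the support of the sequence enters the bound. On sequences of mean zero
  the evolution therefore decays although the multiplier at index \<open>0\<close> is \<open>1\<close>.\<close>

lemma norm_diag_le:
  assumes "\<And>k. coord a k \<noteq> 0 \<Longrightarrow> norm (m k) \<le> B" and bd: "\<And>k. norm (m k) \<le> C" and B: "0 \<le> B"
  shows "norm (diag m a) \<le> B * norm a"
proof (rule ell2_norm_leI)
  fix F :: "int set" assume F: "finite F"
  have "L2_set (\<lambda>k. norm (coord (diag m a) k)) F \<le> L2_set (\<lambda>k. B * norm (coord a k)) F"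
  proof (intro L2_set_mono)
    fix k show "norm (coord (diag m a) k) \<le> B * norm (coord a k)"
      by (cases "coord a k = 0") (auto simp: coord_diag[OF bd] norm_mult intro!: mult_right_mono assms)
  qed auto
  also have "\<dots> = B * L2_set (\<lambda>k. norm (coord a k)) F"
    by (simp add: L2_set_right_distrib B)
  also have "\<dots> \<le> B * norm a" by (intro mult_left_mono L2_coord_le_norm F B)
  finally show "L2_set (\<lambda>k. norm (coord (diag m a) k)) F \<le> B * norm a" .
qed

lemma bounded_clinear_diag:
  assumes "\<And>k. norm (m k) \<le> B"
  shows "bounded_clinear (diag m)"
proof (rule bounded_clinearI[where B = B])
  have "0 \<le> B" using assms norm_ge_zero order_trans by blast
  then show "norm (diag m a) \<le> B * norm a" for a
    by (intro norm_diag_le[where C = B] assms)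
qed (auto intro!: ell2_eqI simp: coord_diag[OF assms] algebra_simps)

lemma diag_basis:
  assumes "\<And>k. norm (m k) \<le> B"
  shows "diag m (basis j) = cscale (m j) (basis j)"
  by (auto intro!: ell2_eqI simp: coord_diag[OF assms])

text \<open>A sequence of vectors with square-summable norms is the sequence of columns of a
  Hilbert--Schmidt operator; this is the Cauchy--Schwarz inequality.\<close>

lemma operator_of_columns:
  fixes r :: "int \<Rightarrow> ell2"
  assumes r: "\<And>F. finite F \<Longrightarrow> L2_set (\<lambda>j. norm (r j)) F \<le> B"
  obtains S where "bounded_clinear S" "\<And>j. S (basis j) = r j" "\<And>a. norm (S a) \<le> B * norm a"
proof -
  have fin: "(\<Sum>j\<in>F. norm (cscale (coord a j) (r j))) \<le> B * norm a" if F: "finite F" for F a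
  proof -
    have "(\<Sum>j\<in>F. norm (cscale (coord a j) (r j))) = (\<Sum>j\<in>F. \<bar>norm (r j)\<bar> * \<bar>norm (coord a j)\<bar>)"
      by (simp add: norm_cscale mult.commute)
    also have "\<dots> \<le> L2_set (\<lambda>j. norm (r j)) F * L2_set (\<lambda>j. norm (coord a j)) F"
      by (rule L2_set_mult_ineq)
    also have "\<dots> \<le> B * norm a"
      using r[OF F] L2_coord_le_norm[OF F, of a]
      by (intro mult_mono) (auto intro: order_trans[OF L2_set_nonneg])
    finally show ?thesis .
  qed
  have abs: "(\<lambda>j. norm (cscale (coord a j) (r j))) summable_on UNIV" for a
    by (rule nonneg_bdd_above_summable_on) (use fin in \<open>auto intro!: bdd_aboveI2[where M = "B * norm a"]\<close>)
  have sm: "(\<lambda>j. cscale (coord a j) (r j)) summable_on UNIV" for a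
    by (rule abs_summable_summable[OF abs])
  define S where "S = (\<lambda>a. \<Sum>\<^sub>\<infinity>j. cscale (coord a j) (r j))"
  have bound: "norm (S a) \<le> B * norm a" for a
  proof -
    have "norm (S a) \<le> (\<Sum>\<^sub>\<infinity>j. norm (cscale (coord a j) (r j)))"
      unfolding S_def by (rule norm_infsum_bound[OF abs])
    also have "\<dots> \<le> B * norm a" by (rule infsum_le_finite_sums[OF abs fin])
    finally show ?thesis .
  qed
  have "bounded_clinear S"
  proof (rule bounded_clinearI[OF _ _ bound])
    show "S (a + b) = S a + S b" for a b
      unfolding S_def by (simp add: cscale_add_left infsum_add sm)
    show "S (cscale c a) = cscale c (S a)" for c a
      unfolding S_def
      using infsum_bounded_linear_strong[OF _ bounded_linear_cscale, of c "\<lambda>j. cscale (coord a j) (r j)" UNIV]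
        sm[of a] sm[of "cscale c a"]
      by (simp add: cscale_cscale)
  qed
  moreover have "S (basis j) = r j" for j
  proof -
    have "S (basis j) = (\<Sum>\<^sub>\<infinity>i\<in>{j}. cscale (coord (basis j) i) (r i))"
      unfolding S_def by (rule infsum_cong_neutral) auto
    then show ?thesis by simp
  qed
  ultimately show ?thesis using that bound by blast
qed

section \<open>Sums over the integers\<close>

lemma summable_on_int_inverse_square:
  "(\<lambda>k::int. 1 / (1 + (of_int k)\<^sup>2 :: real)) summable_on UNIV"
proof -
  let ?f = "\<lambda>k::int. 1 / (1 + (of_int k)\<^sup>2 :: real)"
  have *: "(\<lambda>n::nat. 1 / (1 + (real n)\<^sup>2)) summable_on UNIV"
  proof (rule norm_summable_imp_summable_on)
    have "summable (\<lambda>n. inverse (real n ^ 2))"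
      by (rule inverse_power_summable) simp
    then show "summable (\<lambda>n. norm (1 / (1 + (real n)\<^sup>2)))"
    proof (rule summable_comparison_test[rotated], intro exI[of _ 1] allI impI)
      fix n :: nat assume "1 \<le> n"
      then show "norm (norm (1 / (1 + (real n)\<^sup>2))) \<le> inverse (real n ^ 2)"
        by (simp add: inverse_eq_divide frac_le)
    qed
  qed
  have "?f summable_on range int"
    using * by (subst summable_on_reindex) (auto simp: o_def inj_on_def)
  moreover have "?f summable_on range (\<lambda>n. - int n)"
    using * by (subst summable_on_reindex) (auto simp: o_def inj_on_def)
  ultimately have "?f summable_on (range int \<union> range (\<lambda>n. - int n))"
    by (rule summable_on_union)
  also have "range int \<union> range (\<lambda>n. - int n) = UNIV"
  proof -
    have "x \<in> range int \<union> range (\<lambda>n. - int n)" for x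
      by (cases x rule: int_cases2) auto
    then show ?thesis by auto
  qed
  finally show ?thesis .
qed

lemma int_tail_sum_small:
  fixes f :: "int \<Rightarrow> real"
  assumes f: "f summable_on UNIV" "\<And>k. 0 \<le> f k" and \<epsilon>: "0 < \<epsilon>"
  obtains M where "M \<ge> m" "\<And>F. finite F \<Longrightarrow> (\<And>j. j \<in> F \<Longrightarrow> M < \<bar>j\<bar>) \<Longrightarrow> sum f F \<le> \<epsilon>"
proof -
  obtain F0 where F0: "finite F0" "dist (sum f F0) (infsum f UNIV) \<le> \<epsilon>"
    using has_sum_finite_approximation[OF has_sum_infsum[OF f(1)] \<epsilon>] by auto
  define M where "M = Max (insert m (abs ` F0))"
  have "sum f F \<le> \<epsilon>" if F: "finite F" "\<And>j. j \<in> F \<Longrightarrow> M < \<bar>j\<bar>" for F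
  proof -
    have disj: "F \<inter> F0 = {}"
    proof -
      have "\<bar>j\<bar> \<le> M" if "j \<in> F0" for j unfolding M_def using F0 that by (intro Max_ge) auto
      then show ?thesis using F(2) by fastforce
    qed
    have "sum f F + sum f F0 = sum f (F \<union> F0)"
      using F F0 disj by (simp add: sum.union_disjoint)
    also have "\<dots> \<le> infsum f UNIV"
      using F F0 by (intro finite_sum_le_infsum f) auto
    finally show ?thesis using F0(2) by (auto simp: dist_real_def)
  qed
  moreover have "M \<ge> m" unfolding M_def using F0 by (intro Max_ge) auto
  ultimately show ?thesis using that by blast
qed

section \<open>Invertible operators and their perturbations\<close>

definition inverse_pair :: "(ell2 \<Rightarrow> ell2) \<Rightarrow> (ell2 \<Rightarrow> ell2) \<Rightarrow> bool" where
  "inverse_pair T R \<longleftrightarrow> bounded_clinear T \<and> bounded_clinear R \<and> (\<forall>a. R (T a) = a) \<and> (\<forall>a. T (R a) = a)"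

lemma inverse_pairI:
  assumes T: "bounded_clinear T" and TR: "\<And>a. T (R a) = a" and below: "\<And>a. norm a \<le> C * norm (T a)"
  shows "inverse_pair T R"
proof -
  have inj: "a = b" if "T a = T b" for a b
    using below[of "a - b"] that by (simp add: bounded_clinear_diff[OF T])
  have "bounded_clinear R"
  proof (rule bounded_clinearI[where B = C])
    show "R (a + b) = R a + R b" for a b
      by (rule inj) (simp add: TR bounded_clinear_add[OF T])
    show "R (cscale c a) = cscale c (R a)" for c a
      by (rule inj) (simp add: TR bounded_clinear_cscale[OF T])
    show "norm (R a) \<le> C * norm a" for a
      using below[of "R a"] by (simp add: TR)
  qed
  moreover have "R (T a) = a" for a by (rule inj) (simp add: TR)
  ultimately show ?thesis using T TR by (simp add: inverse_pair_def)
qed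

text \<open>The inverse solves \<open>x = y - S x\<close>, a fixed point equation for a contraction.\<close>

lemma inverse_pair_near_identity:
  assumes S: "bounded_clinear S" and half: "\<And>a. norm (S a) \<le> 1 / 2 * norm a"
  shows "\<exists>R. inverse_pair (\<lambda>a. a + S a) R"
proof -
  have "\<exists>x. x + S x = y" for y
  proof -
    have "\<exists>!x. y - S x = x"
    proof (rule banach_fix_type[where c = "1 / 2"])
      show "\<forall>a b. dist (y - S a) (y - S b) \<le> 1 / 2 * dist a b"
      proof (intro allI)
        fix a b
        have "dist (y - S a) (y - S b) = norm (S (b - a))"
          by (simp add: dist_norm bounded_clinear_diff[OF S])
        also have "\<dots> \<le> 1 / 2 * dist a b"
          using half[of "b - a"] by (simp add: dist_norm norm_minus_commute)
        finally show "dist (y - S a) (y - S b) \<le> 1 / 2 * dist a b" .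
      qed
    qed auto
    then obtain x where "y - S x = x" by blast
    then have "x + S x = y" by (simp add: diff_eq_eq)
    then show ?thesis by blast
  qed
  then have "\<forall>y. \<exists>x. x + S x = y" by blast
  from choice[OF this] obtain R where R: "\<And>y. R y + S (R y) = y" by blast
  have "inverse_pair (\<lambda>a. a + S a) R"
  proof (rule inverse_pairI[where C = 2])
    show "bounded_clinear (\<lambda>a. a + S a)"
      by (intro bounded_clinear_plus bounded_clinear_id S)
    show "norm a \<le> 2 * norm (a + S a)" for a
      using half[of a] norm_triangle_ineq2[of a "- S a"] by simp
  qed (rule R)
  then show ?thesis by blast
qed

text \<open>Replacing one column is a rank-one perturbation, whose inverse is explicit.\<close>

lemma inverse_pair_replace_column:
  assumes TR: "inverse_pair T R" and x: "coord (R x) j \<noteq> 0"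
  shows "\<exists>R'. inverse_pair (\<lambda>a. T a + cscale (coord a j) (x - T (basis j))) R'"
proof -
  have T: "bounded_clinear T" and R: "bounded_clinear R"
    and RT: "\<And>a. R (T a) = a" and TR': "\<And>a. T (R a) = a"
    using TR by (auto simp: inverse_pair_def)
  define T' where "T' = (\<lambda>a. T a + cscale (coord a j) (x - T (basis j)))"
  define R' where "R' = (\<lambda>a. R a - cscale (coord (R a) j) (cscale (1 / coord (R x) j) (R x - basis j)))"
  have cT': "bounded_clinear T'"
    unfolding T'_def by (intro bounded_clinear_plus T bounded_clinear_rank_one)
  have cR': "bounded_clinear R'"
    unfolding R'_def
    by (intro bounded_clinear_minus R bounded_clinear_compose[OF bounded_clinear_rank_one R])
  have "T' (R' a) = a" for a
  proof -
    have "coord (R' a) j = coord (R a) j / coord (R x) j"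
      using x by (simp add: R'_def field_simps)
    then show ?thesis
      by (simp add: T'_def, simp add: R'_def bounded_clinear_diff[OF T] bounded_clinear_cscale[OF T] TR' cscale_cscale)
  qed
  moreover have "R' (T' a) = a" for a
  proof -
    have RT': "R (T' a) = a + cscale (coord a j) (R x - basis j)"
      by (simp add: T'_def bounded_clinear_add[OF R] bounded_clinear_cscale[OF R] bounded_clinear_diff[OF R] RT)
    show ?thesis
      unfolding R'_def RT' using x by (intro ell2_eqI) (simp add: field_simps)
  qed
  ultimately show ?thesis
    using cT' cR' unfolding inverse_pair_def T'_def by blast
qed

section \<open>Separating resolvents\<close>

text \<open>Partial fractions: the products of resolvent factors over distinct points are linear
  combinations of single factors.\<close>

lemma resolvent_products_vanish:
  fixes c :: "int \<Rightarrow> complex" and \<tau> :: "int \<Rightarrow> real"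
  assumes c: "c summable_on UNIV" and \<rho>: "0 < \<rho>0"
    and van: "\<And>\<rho>. \<rho>0 \<le> \<rho> \<Longrightarrow> (\<Sum>\<^sub>\<infinity>k. c k / (of_real \<rho> + \<i> * of_real (\<tau> k))) = 0"
    and A: "finite A" "A \<noteq> {}" "\<And>\<rho>. \<rho> \<in> A \<Longrightarrow> \<rho>0 \<le> \<rho>"
  shows "((\<lambda>k. c k * (\<Prod>\<rho>\<in>A. 1 / (of_real \<rho> + \<i> * of_real (\<tau> k)))) has_sum 0) UNIV"
proof -
  let ?w = "\<lambda>\<rho> k. 1 / (of_real \<rho> + \<i> * of_real (\<tau> k)) :: complex"
  have w: "norm (?w \<rho> k) \<le> 1 / \<rho>0" and w0: "of_real \<rho> + \<i> * of_real (\<tau> k) \<noteq> 0" if "\<rho>0 \<le> \<rho>" for \<rho> k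
  proof -
    have "\<rho> \<le> norm (of_real \<rho> + \<i> * of_real (\<tau> k))"
      using abs_Re_le_cmod[of "of_real \<rho> + \<i> * of_real (\<tau> k)"] by simp
    with that \<rho> show "norm (?w \<rho> k) \<le> 1 / \<rho>0" "of_real \<rho> + \<i> * of_real (\<tau> k) \<noteq> 0"
      by (auto simp: norm_divide divide_simps)
  qed
  have c': "(\<lambda>k. norm (c k)) summable_on UNIV" using c by (simp add: summable_on_iff_abs_summable_on_complex)
  have one: "((\<lambda>k. c k * ?w \<rho> k) has_sum 0) UNIV" if "\<rho>0 \<le> \<rho>" for \<rho>
  proof -
    have "(\<lambda>k. norm (c k * ?w \<rho> k)) summable_on UNIV"
    proof (rule Infinite_Sum.abs_summable_on_comparison_test)
      show "(\<lambda>k. norm (c k * of_real (1 / \<rho>0))) summable_on UNIV"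
        unfolding norm_mult by (rule summable_on_cmult_left[OF c'])
      show "norm (c k * ?w \<rho> k) \<le> norm (c k * of_real (1 / \<rho>0))" for k
        using mult_left_mono[OF w[OF that, of k], of "norm (c k)"] \<rho>
        by (simp add: norm_mult norm_divide)
    qed
    then have "(\<lambda>k. c k * ?w \<rho> k) summable_on UNIV" by (rule abs_summable_summable)
    then show ?thesis using van[OF that] by (simp add: has_sum_iff)
  qed
  have "\<forall>A. card A = Suc n \<longrightarrow> (\<forall>\<rho>\<in>A. \<rho>0 \<le> \<rho>) \<longrightarrow> ((\<lambda>k. c k * (\<Prod>\<rho>\<in>A. ?w \<rho> k)) has_sum 0) UNIV" for n
  proof (induction n)
    case 0
    then show ?case using one by (auto simp: card_Suc_eq)
  next
    case (Suc n)
    show ?case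
    proof (intro allI impI)
      fix A :: "real set" assume A: "card A = Suc (Suc n)" "\<forall>\<rho>\<in>A. \<rho>0 \<le> \<rho>"
      obtain a B where a: "A = insert a B" "a \<notin> B" "card B = Suc n"
        using A(1) by (metis card_Suc_eq)
      obtain b D where b: "B = insert b D" "b \<notin> D" "card D = n"
        using a(3) by (metis card_Suc_eq)
      have fD: "finite D" using a(3) b by (metis card.infinite finite_insert nat.distinct(1))
      have ab: "a \<noteq> b" "a \<notin> D" using a b by auto
      have ge: "\<rho>0 \<le> a" "\<rho>0 \<le> b" using A a b by auto
      have "((\<lambda>k. c k * (\<Prod>\<rho>\<in>insert b D. ?w \<rho> k)) has_sum 0) UNIV"
           "((\<lambda>k. c k * (\<Prod>\<rho>\<in>insert a D. ?w \<rho> k)) has_sum 0) UNIV"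
        using Suc.IH[rule_format, of "insert b D"] Suc.IH[rule_format, of "insert a D"]
          A(2) a b fD ab by (auto simp del: prod.insert)
      then have "((\<lambda>k. 1 / of_real (b - a) * (c k * (\<Prod>\<rho>\<in>insert a D. ?w \<rho> k) +
          - (c k * (\<Prod>\<rho>\<in>insert b D. ?w \<rho> k)))) has_sum 1 / of_real (b - a) * (0 + - 0)) UNIV"
        by (intro has_sum_cmult_right has_sum_add has_sum_uminusI)
      moreover have "1 / of_real (b - a) * (c k * (\<Prod>\<rho>\<in>insert a D. ?w \<rho> k) +
          - (c k * (\<Prod>\<rho>\<in>insert b D. ?w \<rho> k))) = c k * (\<Prod>\<rho>\<in>A. ?w \<rho> k)" for k
      proof -
        have "?w a k - ?w b k = of_real (b - a) * (?w a k * ?w b k)"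
          using w0[OF ge(1), of k] w0[OF ge(2), of k] by (simp add: field_simps)
        then have *: "(?w a k - ?w b k) / of_real (b - a) = ?w a k * ?w b k"
          using ab by (simp add: nonzero_divide_eq_eq mult.commute)
        have "1 / of_real (b - a) * (c k * (\<Prod>\<rho>\<in>insert a D. ?w \<rho> k) +
          - (c k * (\<Prod>\<rho>\<in>insert b D. ?w \<rho> k)))
          = c k * ((?w a k - ?w b k) / of_real (b - a)) * (\<Prod>\<rho>\<in>D. ?w \<rho> k)"
          unfolding prod.insert[OF fD ab(2)] prod.insert[OF fD b(2)]
          by (simp only: divide_inverse) (simp add: algebra_simps)
        also have "\<dots> = c k * (\<Prod>\<rho>\<in>A. ?w \<rho> k)"
          unfolding * a(1) b(1) using fD ab b(2) by simp
        finally show ?thesis .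
      qed
      ultimately show "((\<lambda>k. c k * (\<Prod>\<rho>\<in>A. ?w \<rho> k)) has_sum 0) UNIV" by simp
    qed
  qed
  moreover have "card A = Suc (card A - 1)" using A by (simp add: card_gt_0_iff)
  ultimately show ?thesis using A(3) by blast
qed

text \<open>The weighted products over \<open>n\<close> nearby points equal \<open>1\<close> where \<open>\<tau>\<close> vanishes and decay
  geometrically in \<open>n\<close> elsewhere, so they isolate the part of the sum that sits at the
  eigenvalue \<open>\<tau> = 0\<close>.\<close>

lemma resolvents_separate_eigenvalue:
  fixes c :: "int \<Rightarrow> complex" and \<tau> :: "int \<Rightarrow> real"
  assumes c: "c summable_on UNIV" and \<rho>: "0 < \<rho>0"
    and van: "\<And>\<rho>. \<rho>0 \<le> \<rho> \<Longrightarrow> (\<Sum>\<^sub>\<infinity>k. c k / (of_real \<rho> + \<i> * of_real (\<tau> k))) = 0"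
    and \<eta>: "0 < \<eta>" "\<And>k. \<tau> k \<noteq> 0 \<Longrightarrow> \<eta> \<le> \<bar>\<tau> k\<bar>"
  shows "infsum c {k. \<tau> k = 0} = 0"
proof -
  define E where "E = {k. \<tau> k = 0}"
  define R where "R = \<rho>0 + 1"
  define q where "q = R / sqrt (R\<^sup>2 + \<eta>\<^sup>2)"
  have R: "0 < R" using \<rho> by (simp add: R_def)
  have "R < sqrt (R\<^sup>2 + \<eta>\<^sup>2)"
    using \<eta>(1) by (intro real_less_rsqrt) simp
  then have q: "0 \<le> q" "q < 1"
    using R by (auto simp: q_def divide_less_eq_1 add_pos_nonneg)
  have c': "(\<lambda>k. norm (c k)) summable_on UNIV" using c by (simp add: summable_on_iff_abs_summable_on_complex)
  have cE: "c summable_on E" "c summable_on - E"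
    using summable_on_subset_banach[OF c] by auto
  have bound: "norm (infsum c E) \<le> q ^ Suc n * (\<Sum>\<^sub>\<infinity>k. norm (c k))" for n
  proof -
    \<comment> \<open>distinct points that stay in the bounded interval from \<open>\<rho>0\<close> to \<open>R\<close>, so that one ratio \<open>q < 1\<close>
      serves all factors\<close>
    define A where "A = (\<lambda>i. \<rho>0 + 1 / (real i + 1)) ` {..n}"
    have inj: "inj_on (\<lambda>i. \<rho>0 + 1 / (real i + 1)) {..n}" by (auto simp: inj_on_def)
    have A: "finite A" "A \<noteq> {}" "card A = Suc n"
      using card_image[OF inj] by (auto simp: A_def)
    have range_A: "\<rho>0 \<le> x" "x \<le> R" if "x \<in> A" for x
      using that by (auto simp: A_def R_def)
    define p where "p = (\<lambda>k. \<Prod>x\<in>A. of_real x / (of_real x + \<i> * of_real (\<tau> k)) :: complex)"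
    have p_eq: "p k = (\<Prod>x\<in>A. of_real x) * (\<Prod>x\<in>A. 1 / (of_real x + \<i> * of_real (\<tau> k)))" for k
      by (simp add: p_def flip: prod.distrib)
    have pE: "p k = 1" if "k \<in> E" for k
      unfolding p_def using that range_A(1) \<rho> by (intro prod.neutral) (force simp: E_def)
    have p_le: "norm (p k) \<le> q ^ Suc n" if "k \<notin> E" for k
    proof -
      have "norm (of_real x / (of_real x + \<i> * of_real (\<tau> k)) :: complex) \<le> q" if x: "x \<in> A" for x
      proof -
        have x0: "0 < x" "x \<le> R" using range_A[OF x] \<rho> by auto
        have nm: "norm (of_real x + \<i> * of_real (\<tau> k) :: complex) = sqrt (x\<^sup>2 + (\<tau> k)\<^sup>2)"
          by (simp add: cmod_def)
        have \<tau>: "\<eta>\<^sup>2 \<le> (\<tau> k)\<^sup>2"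
          using \<eta> \<open>k \<notin> E\<close> by (simp add: E_def abs_le_square_iff[symmetric])
        have "x * sqrt (R\<^sup>2 + \<eta>\<^sup>2) = sqrt (x\<^sup>2 * R\<^sup>2 + x\<^sup>2 * \<eta>\<^sup>2)"
          using x0 by (simp add: real_sqrt_mult flip: distrib_left)
        also have "\<dots> \<le> sqrt (R\<^sup>2 * x\<^sup>2 + R\<^sup>2 * (\<tau> k)\<^sup>2)"
          using mult_mono[OF power_mono[OF x0(2)] \<tau>, of 2] x0 by (simp add: mult.commute)
        also have "\<dots> = R * sqrt (x\<^sup>2 + (\<tau> k)\<^sup>2)"
          using R by (simp add: real_sqrt_mult flip: distrib_left)
        finally show ?thesis
          unfolding q_def norm_divide nm using x0 R \<eta>
          by (simp add: divide_simps add_pos_nonneg)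
      qed
      then have "norm (p k) \<le> (\<Prod>x\<in>A. q)"
        unfolding p_def prod_norm[symmetric] by (intro prod_mono) auto
      then show ?thesis by (simp add: A)
    qed
    have "((\<lambda>k. c k * (\<Prod>x\<in>A. 1 / (of_real x + \<i> * of_real (\<tau> k)))) has_sum 0) UNIV"
      by (rule resolvent_products_vanish[OF c \<rho> van A(1,2)]) (use range_A in auto)
    then have "((\<lambda>k. (\<Prod>x\<in>A. of_real x) * (c k * (\<Prod>x\<in>A. 1 / (of_real x + \<i> * of_real (\<tau> k)))))
        has_sum (\<Prod>x\<in>A. of_real x) * 0) UNIV"
      by (rule has_sum_cmult_right)
    then have cp: "((\<lambda>k. c k * p k) has_sum 0) UNIV"
      by (simp add: p_eq mult.left_commute)
    then have sp: "(\<lambda>k. c k * p k) summable_on E" "(\<lambda>k. c k * p k) summable_on - E"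
      using summable_on_subset_banach[OF has_sum_imp_summable[OF cp]] by auto
    have "0 = infsum (\<lambda>k. c k * p k) (E \<union> - E)"
      using cp by (simp add: has_sum_iff)
    also have "\<dots> = infsum (\<lambda>k. c k * p k) E + infsum (\<lambda>k. c k * p k) (- E)"
      by (rule infsum_Un_disjoint[OF sp]) simp
    also have "infsum (\<lambda>k. c k * p k) E = infsum c E"
      by (rule infsum_cong) (simp add: pE)
    finally have "norm (infsum c E) = norm (infsum (\<lambda>k. c k * p k) (- E))"
      by (metis add_eq_0_iff norm_minus_cancel)
    also have "\<dots> \<le> (\<Sum>\<^sub>\<infinity>k\<in>-E. q ^ Suc n * norm (c k))"
    proof (rule norm_infsum_le[OF has_sum_infsum[OF sp(2)] has_sum_infsum])
      show "(\<lambda>k. q ^ Suc n * norm (c k)) summable_on - E"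
        by (rule summable_on_cmult_right[OF summable_on_subset_banach[OF c']]) simp
      show "norm (c k * p k) \<le> q ^ Suc n * norm (c k)" if "k \<in> - E" for k
        using mult_right_mono[OF p_le[of k], of "norm (c k)"] that by (simp add: norm_mult mult.commute)
    qed
    also have "\<dots> = q ^ Suc n * (\<Sum>\<^sub>\<infinity>k\<in>-E. norm (c k))"
      by (rule infsum_cmult_right) (use summable_on_subset_banach[OF c'] in auto)
    also have "\<dots> \<le> q ^ Suc n * (\<Sum>\<^sub>\<infinity>k. norm (c k))"
      by (intro mult_left_mono infsum_mono2 c' summable_on_subset_banach[OF c']) (use q in auto)
    finally show ?thesis .
  qed
  have "(\<lambda>n. q ^ Suc n * (\<Sum>\<^sub>\<infinity>k. norm (c k))) \<longlonglongrightarrow> 0 * (\<Sum>\<^sub>\<infinity>k. norm (c k))"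
    using q by (intro tendsto_mult_right LIMSEQ_Suc LIMSEQ_realpow_zero) auto
  then have "norm (infsum c E) \<le> 0 * (\<Sum>\<^sub>\<infinity>k. norm (c k))"
    by (rule LIMSEQ_le_const) (use bound in blast)
  then show ?thesis by (simp add: E_def)
qed

section \<open>Shifting the spectrum by feedback\<close>

text \<open>What the abstract argument uses of the control system: a spectral gap that grows with the
  frequency, diagonal entries of the control operator bounded away from zero at high frequencies, and
  the property that, among the functionals supported on one eigenspace, only the multiples of the mean
  (the coordinate of index \<open>0\<close>) are invisible to the control.\<close>

locale spectral_control =
  fixes \<theta> :: "int \<Rightarrow> real" and G :: "ell2 \<Rightarrow> ell2" and lam :: real and N :: int and \<gamma> :: real
  assumes G: "bounded_clinear G" and lam: "0 < lam" and N: "1 \<le> N"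
    and gap: "\<And>j k. N < \<bar>j\<bar> \<Longrightarrow> k \<noteq> j \<Longrightarrow> of_int \<bar>j\<bar> \<le> \<bar>\<theta> k - \<theta> j\<bar>"
    and \<theta>_0: "\<theta> 0 = 0" and G_0: "\<And>y. coord (G y) 0 = 0"
    and \<gamma>: "0 < \<gamma>" "\<And>j. N < \<bar>j\<bar> \<Longrightarrow> \<gamma> \<le> norm (coord (G (basis j)) j)"
    and observable: "\<And>j \<phi>. j \<noteq> 0 \<Longrightarrow>
      (\<And>y. (\<Sum>k | \<theta> k = \<theta> j. \<phi> k * coord (G y) k) = 0) \<Longrightarrow> \<phi> j = 0"
begin

text \<open>The vectors that can serve as a column of \<open>X\<close>: \<open>x\<close> becomes an eigenvector of the closed loop
  with eigenvalue \<open>d\<close> if the feedback answers \<open>x\<close> with the control \<open>y\<close>.\<close>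

definition admissible :: "ell2 \<Rightarrow> bool" where
  "admissible x \<longleftrightarrow> (\<exists>d y. Re d \<le> - lam \<and> (\<forall>k. (\<i> * \<theta> k - d) * coord x k = - coord (G y) k))"

lemma finite_eigenvalues_near: "finite {k. \<bar>\<theta> k - \<theta> j\<bar> < 1}"
proof (rule finite_subset)
  show "{k. \<bar>\<theta> k - \<theta> j\<bar> < 1} \<subseteq> insert j {- N..N}"
  proof
    fix k assume k: "k \<in> {k. \<bar>\<theta> k - \<theta> j\<bar> < 1}"
    show "k \<in> insert j {- N..N}"
    proof (rule ccontr)
      assume "k \<notin> insert j {- N..N}"
      then have "N < \<bar>k\<bar>" "j \<noteq> k" by auto
      then have "of_int \<bar>k\<bar> \<le> \<bar>\<theta> j - \<theta> k\<bar>" "1 \<le> \<bar>k\<bar>" using gap N by auto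
      then show False using k by (auto simp: abs_minus_commute)
    qed
  qed
qed simp

lemma eigenvalue_isolated:
  obtains \<eta> where "0 < \<eta>" "\<And>k. \<theta> k - \<theta> j \<noteq> 0 \<Longrightarrow> \<eta> \<le> \<bar>\<theta> k - \<theta> j\<bar>"
proof -
  define D where "D = insert 1 ((\<lambda>k. \<bar>\<theta> k - \<theta> j\<bar>) ` {k. \<bar>\<theta> k - \<theta> j\<bar> < 1 \<and> \<theta> k \<noteq> \<theta> j})"
  have D: "finite D" "D \<noteq> {}"
    unfolding D_def by (auto intro!: finite_imageI finite_subset[OF _ finite_eigenvalues_near[of j]])
  have "0 < Min D" using D by (auto simp: D_def)
  moreover have "Min D \<le> \<bar>\<theta> k - \<theta> j\<bar>" if "\<theta> k - \<theta> j \<noteq> 0" for k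
  proof (cases "\<bar>\<theta> k - \<theta> j\<bar> < 1")
    case True
    then show ?thesis using that D by (intro Min_le) (auto simp: D_def)
  next
    case False
    have "Min D \<le> 1" using D by (intro Min_le) (auto simp: D_def)
    then show ?thesis using False by simp
  qed
  ultimately show ?thesis using that by blast
qed

lemma norm_resolvent_le:
  assumes "lam \<le> \<rho>"
  shows "norm (1 / (of_real \<rho> + \<i> * of_real \<tau>) :: complex) \<le> 1 / lam"
proof -
  have "\<rho> \<le> norm (of_real \<rho> + \<i> * of_real \<tau>)"
    using abs_Re_le_cmod[of "of_real \<rho> + \<i> * of_real \<tau>"] by simp
  with assms lam show ?thesis by (simp add: norm_divide frac_le)
qed

text \<open>If every admissible column had vanishing \<open>j\<close>-th coordinate after applying \<open>R\<close>, the functional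
  \<open>x \<mapsto> coord (R x) j\<close> would annihilate all resolvents of \<open>G y\<close>, hence the part of \<open>G y\<close> at the
  eigenvalue \<open>\<theta> j\<close>, for every \<open>y\<close>; observability excludes this.\<close>

lemma admissible_column_exists:
  assumes TR: "inverse_pair T R" and j: "j \<noteq> 0" "T (basis j) = basis j"
  shows "\<exists>x. admissible x \<and> coord (R x) j \<noteq> 0"
proof (rule ccontr)
  assume "\<not> ?thesis"
  then have van: "coord (R x) j = 0" if "admissible x" for x using that by blast
  have R: "bounded_clinear R" and RT: "\<And>a. R (T a) = a"
    using TR by (auto simp: inverse_pair_def)
  define \<phi> where "\<phi> = (\<lambda>k. coord (R (basis k)) j)"
  have expand: "((\<lambda>k. coord x k * \<phi> k) has_sum coord (R x) j) UNIV" for x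
    using has_sum_bounded_linear[OF bounded_linear_coord bounded_clinear_has_sum_basis[OF R, of x]]
    by (simp add: \<phi>_def)
  have \<phi>_j: "\<phi> j = 1"
    using RT[of "basis j"] j by (simp add: \<phi>_def)
  obtain \<eta> where \<eta>: "0 < \<eta>" "\<And>k. \<theta> k - \<theta> j \<noteq> 0 \<Longrightarrow> \<eta> \<le> \<bar>\<theta> k - \<theta> j\<bar>"
    using eigenvalue_isolated by blast
  have "(\<Sum>k | \<theta> k = \<theta> j. \<phi> k * coord (G y) k) = 0" for y
  proof -
    define c where "c = (\<lambda>k. coord (G y) k * \<phi> k)"
    have "infsum c {k. \<theta> k - \<theta> j = 0} = 0"
    proof (rule resolvents_separate_eigenvalue[OF _ lam _ \<eta>])
      show "c summable_on UNIV" unfolding c_def using expand by (rule has_sum_imp_summable)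
      fix \<rho> assume \<rho>: "lam \<le> \<rho>"
      define m where "m = (\<lambda>k. 1 / (of_real \<rho> + \<i> * of_real (\<theta> k - \<theta> j)) :: complex)"
      define x where "x = diag m (G y)"
      have x: "coord x k = m k * coord (G y) k" for k
        unfolding x_def m_def by (rule coord_diag[OF norm_resolvent_le[OF \<rho>]])
      have "admissible x"
        unfolding admissible_def
      proof (intro exI conjI allI)
        \<comment> \<open>the eigenvalues \<open>\<i> \<theta> j - \<rho>\<close> with \<open>\<rho> \<ge> lam\<close> suffice for the separation\<close>
        show "Re (\<i> * \<theta> j - of_real \<rho>) \<le> - lam" using \<rho> by simp
        fix k
        have "of_real \<rho> + \<i> * of_real (\<theta> k - \<theta> j) \<noteq> 0"
          using \<rho> lam by (simp add: complex_eq_iff)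
        then show "(\<i> * \<theta> k - (\<i> * \<theta> j - of_real \<rho>)) * coord x k = - coord (G (- y)) k"
          using bounded_clinear_diff[OF G, of 0 y]
          by (simp add: x m_def bounded_clinear_0[OF G]) (simp add: field_simps)
      qed
      then show "(\<Sum>\<^sub>\<infinity>k. c k / (of_real \<rho> + \<i> * of_real (\<theta> k - \<theta> j))) = 0"
        using infsumI[OF expand[of x]] by (simp add: van x m_def c_def)
    qed
    moreover have "finite {k. \<theta> k = \<theta> j}"
      by (rule finite_subset[OF _ finite_eigenvalues_near[of j]]) auto
    ultimately show ?thesis by (simp add: c_def mult.commute)
  qed
  then have "\<phi> j = 0" by (rule observable[OF j(1)])
  with \<phi>_j show False by simp
qed

text \<open>The gain that normalises the \<open>j\<close>-th coordinate of the \<open>j\<close>-th column to \<open>1\<close>.\<close>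

definition high_gain :: "int \<Rightarrow> complex" where
  "high_gain j = lam / coord (G (basis j)) j"

text \<open>For high frequencies the control \<open>y = - c e\<^sub>j\<close> moves the eigenvalue \<open>\<i> \<theta> j\<close> to
  \<open>\<i> \<theta> j - lam\<close>; the new eigenvector is \<open>e\<^sub>j\<close> plus a correction that the spectral gap makes small.\<close>

lemma high_frequency_column:
  assumes B: "\<And>a. norm (G a) \<le> B * norm a" "0 \<le> B" and j: "N < \<bar>j\<bar>"
  shows "\<exists>r. norm r \<le> lam * B / \<gamma> / of_int \<bar>j\<bar> \<and>
    (\<forall>k. (\<i> * \<theta> k - (\<i> * \<theta> j - lam)) * coord (basis j + r) k
       = - coord (G (cscale (- high_gain j) (basis j))) k)"
proof -
  let ?g = "coord (G (basis j)) j"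
  have g: "\<gamma> \<le> norm ?g" "?g \<noteq> 0" using \<gamma>(2)[OF j] \<gamma>(1) by auto
  have j1: "1 \<le> \<bar>j\<bar>" using j N by simp
  define m where "m = (\<lambda>k. if k = j then 0 else high_gain j / (\<i> * \<theta> k - (\<i> * \<theta> j - lam)))"
  have m: "norm (m k) \<le> lam / \<gamma> / of_int \<bar>j\<bar>" for k
  proof (cases "k = j")
    case False
    have "of_int \<bar>j\<bar> \<le> \<bar>\<theta> k - \<theta> j\<bar>" by (rule gap[OF j False])
    also have "\<dots> = \<bar>Im (\<i> * \<theta> k - (\<i> * \<theta> j - lam))\<bar>" by simp
    also have "\<dots> \<le> norm (\<i> * \<theta> k - (\<i> * \<theta> j - lam))" by (rule abs_Im_le_cmod)
    finally have 1: "of_int \<bar>j\<bar> \<le> norm (\<i> * \<theta> k - (\<i> * \<theta> j - lam))" .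
    have "norm (high_gain j) \<le> lam / \<gamma>"
      using g lam \<gamma>(1) by (simp add: high_gain_def norm_divide frac_le)
    moreover have "0 < real_of_int \<bar>j\<bar>" using j1 by simp
    ultimately have "norm (high_gain j) / norm (\<i> * \<theta> k - (\<i> * \<theta> j - lam)) \<le> lam / \<gamma> / of_int \<bar>j\<bar>"
      using 1 lam \<gamma>(1) by (intro frac_le) auto
    then show ?thesis using False by (simp add: m_def norm_divide)
  qed (use lam \<gamma> in \<open>simp add: m_def\<close>)
  define r where "r = diag m (G (basis j))"
  have r: "coord r k = m k * coord (G (basis j)) k" for k
    unfolding r_def by (rule coord_diag[OF m])
  have "norm r \<le> (lam / \<gamma> / of_int \<bar>j\<bar>) * norm (G (basis j))"
    unfolding r_def by (rule norm_diag_le[OF m m]) (use lam \<gamma> in simp)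
  also have "\<dots> \<le> (lam / \<gamma> / of_int \<bar>j\<bar>) * B"
    using B(1)[of "basis j"] lam \<gamma> by (intro mult_left_mono) auto
  finally have "norm r \<le> lam * B / \<gamma> / of_int \<bar>j\<bar>" by simp
  moreover have "(\<i> * \<theta> k - (\<i> * \<theta> j - lam)) * coord (basis j + r) k
       = - coord (G (cscale (- high_gain j) (basis j))) k" for k
  proof -
    have "\<i> * \<theta> k - (\<i> * \<theta> j - lam) \<noteq> 0" using lam by (simp add: complex_eq_iff)
    then show ?thesis
      using g by (cases "k = j") (simp_all add: bounded_clinear_cscale[OF G] r m_def high_gain_def)
  qed
  ultimately show ?thesis by blast
qed

text \<open>The matrix identity \<open>A X + G Y = X D\<close>, column by column: \<open>X\<close> conjugates the closed loop
  \<open>A + G Y X\<^sup>-\<^sup>1\<close> to the diagonal operator \<open>D\<close>.\<close>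

lemma spectrum_shift:
  obtains X R Y d where "inverse_pair X R" "bounded_clinear Y" "X (basis 0) = basis 0"
    "d 0 = 0" "\<And>j. j \<noteq> 0 \<Longrightarrow> Re (d j) \<le> - lam"
    "\<And>j k. (\<i> * \<theta> k - d j) * coord (X (basis j)) k = - coord (G (Y (basis j))) k"
proof -
  obtain B where B: "B > 0" "\<And>a. norm (G a) \<le> B * norm a"
    using bounded_clinear_bound[OF G] by blast
  have B0: "0 \<le> B" using B by simp
  define C where "C = lam * B / \<gamma>"
  have C: "0 < C" using lam B \<gamma> by (simp add: C_def)
  \<comment> \<open>with \<open>1 / j\<^sup>2 \<le> 2 / (1 + j\<^sup>2)\<close> the squared norms of the corrections \<open>r j\<close> then sum to at most
    \<open>2 C\<^sup>2 \<epsilon> = (1 / 2)\<^sup>2\<close>\<close>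
  define \<epsilon> where "\<epsilon> = 1 / (8 * C\<^sup>2)"
  have \<epsilon>: "0 < \<epsilon>" using C by (simp add: \<epsilon>_def)
  obtain M where M: "N \<le> M"
    "\<And>F. finite F \<Longrightarrow> (\<And>j. j \<in> F \<Longrightarrow> M < \<bar>j\<bar>) \<Longrightarrow> (\<Sum>j\<in>F. 1 / (1 + (real_of_int j)\<^sup>2)) \<le> \<epsilon>"
    using int_tail_sum_small[OF summable_on_int_inverse_square _ \<epsilon>] by (auto simp: add_nonneg_nonneg)
  have M1: "1 \<le> M" using M N by simp
  have "\<forall>j. \<exists>r. M < \<bar>j\<bar> \<longrightarrow> norm r \<le> C / of_int \<bar>j\<bar> \<and>
    (\<forall>k. (\<i> * \<theta> k - (\<i> * \<theta> j - lam)) * coord (basis j + r) k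
       = - coord (G (cscale (- high_gain j) (basis j))) k)"
    using high_frequency_column[OF B(2) B0] M(1) unfolding C_def by (metis dual_order.strict_trans2)
  from choice[OF this] obtain r where r: "\<And>j. M < \<bar>j\<bar> \<Longrightarrow> norm (r j) \<le> C / of_int \<bar>j\<bar>"
    "\<And>j k. M < \<bar>j\<bar> \<Longrightarrow> (\<i> * \<theta> k - (\<i> * \<theta> j - lam)) * coord (basis j + r j) k
       = - coord (G (cscale (- high_gain j) (basis j))) k" by blast
  define r' where "r' = (\<lambda>j. if M < \<bar>j\<bar> then r j else 0)"
  have r'_le: "L2_set (\<lambda>j. norm (r' j)) F \<le> 1 / 2" if F: "finite F" for F
  proof -
    let ?F = "{j\<in>F. M < \<bar>j\<bar>}"
    have "(\<Sum>j\<in>F. (norm (r' j))\<^sup>2) = (\<Sum>j\<in>?F. (norm (r j))\<^sup>2)"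
      using F by (intro sum.mono_neutral_cong_right) (auto simp: r'_def)
    also have "\<dots> \<le> (\<Sum>j\<in>?F. 2 * C\<^sup>2 * (1 / (1 + (real_of_int j)\<^sup>2)))"
    proof (rule sum_mono)
      fix j assume j: "j \<in> ?F"
      then have "1 \<le> \<bar>j\<bar>" using M1 by simp
      then have j1: "1 \<le> \<bar>real_of_int j\<bar>" by (metis of_int_1_le_iff of_int_abs)
      then have "1 \<le> (real_of_int j)\<^sup>2" using one_le_power[OF j1, of 2] by simp
      moreover have "(norm (r j))\<^sup>2 \<le> (C / of_int \<bar>j\<bar>)\<^sup>2"
        using j r(1) by (intro power_mono) auto
      moreover have "(C / of_int \<bar>j\<bar>)\<^sup>2 = C\<^sup>2 * (1 / (real_of_int j)\<^sup>2)"
        by (simp add: power_divide)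
      moreover have "1 / (real_of_int j)\<^sup>2 \<le> 2 * (1 / (1 + (real_of_int j)\<^sup>2))"
        using \<open>1 \<le> (real_of_int j)\<^sup>2\<close> by (simp add: divide_simps)
      ultimately show "(norm (r j))\<^sup>2 \<le> 2 * C\<^sup>2 * (1 / (1 + (real_of_int j)\<^sup>2))"
        using mult_left_mono[of "1 / (real_of_int j)\<^sup>2" "2 * (1 / (1 + (real_of_int j)\<^sup>2))" "C\<^sup>2"]
        by (simp add: mult.commute[of _ 2])
    qed
    also have "\<dots> = 2 * C\<^sup>2 * (\<Sum>j\<in>?F. 1 / (1 + (real_of_int j)\<^sup>2))"
      by (rule sum_distrib_left[symmetric])
    also have "\<dots> \<le> 2 * C\<^sup>2 * \<epsilon>"
      by (intro mult_left_mono M) (use F in auto)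
    also have "\<dots> = (1 / 2)\<^sup>2" using C by (simp add: \<epsilon>_def power2_eq_square)
    finally show ?thesis unfolding L2_set_def by (intro real_le_lsqrt) auto
  qed
  obtain S where S: "bounded_clinear S" "\<And>j. S (basis j) = r' j" "\<And>a. norm (S a) \<le> 1 / 2 * norm a"
    using operator_of_columns[OF r'_le] by blast
  define J where "J = {j. j \<noteq> 0 \<and> \<bar>j\<bar> \<le> M}"
  have J: "finite J"
    by (rule finite_subset[of _ "{- M..M}"]) (auto simp: J_def)
  \<comment> \<open>replace the low-frequency columns one at a time\<close>
  have "J' \<subseteq> J \<Longrightarrow> \<exists>T R. inverse_pair T R \<and> (\<forall>j. j \<notin> J' \<longrightarrow> T (basis j) = basis j + r' j)
      \<and> (\<forall>j\<in>J'. admissible (T (basis j)))" if "finite J'" for J'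
    using that
  proof (induction J' rule: finite_induct)
    case empty
    obtain R where "inverse_pair (\<lambda>a. a + S a) R"
      using inverse_pair_near_identity[OF S(1,3)] by blast
    then show ?case
      using S(2) by (intro exI[of _ "\<lambda>a. a + S a"] exI[of _ R]) auto
  next
    case (insert i J')
    then obtain T R where T: "inverse_pair T R" "\<And>j. j \<notin> J' \<Longrightarrow> T (basis j) = basis j + r' j"
      "\<And>j. j \<in> J' \<Longrightarrow> admissible (T (basis j))" by auto
    have i: "i \<noteq> 0" "\<not> M < \<bar>i\<bar>" using insert.prems by (auto simp: J_def)
    have Ti: "T (basis i) = basis i" using T(2)[OF insert.hyps(2)] i by (simp add: r'_def)
    obtain x where x: "admissible x" "coord (R x) i \<noteq> 0"
      using admissible_column_exists[OF T(1) i(1) Ti] by blast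
    obtain R' where R': "inverse_pair (\<lambda>a. T a + cscale (coord a i) (x - T (basis i))) R'"
      using inverse_pair_replace_column[OF T(1) x(2)] by blast
    show ?case
    proof (intro exI conjI allI ballI impI)
      show "inverse_pair (\<lambda>a. T a + cscale (coord a i) (x - T (basis i))) R'" by (rule R')
    qed (use T x insert.hyps in \<open>auto\<close>)
  qed
  from this[OF J order.refl] obtain X R where X: "inverse_pair X R"
    "\<And>j. j \<notin> J \<Longrightarrow> X (basis j) = basis j + r' j" "\<And>j. j \<in> J \<Longrightarrow> admissible (X (basis j))"
    by blast
  have "\<forall>j. \<exists>p. j \<in> J \<longrightarrow> Re (fst p) \<le> - lam \<and>
      (\<forall>k. (\<i> * \<theta> k - fst p) * coord (X (basis j)) k = - coord (G (snd p)) k)"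
    using X(3) unfolding admissible_def by simp
  from choice[OF this] obtain p where p: "\<And>j. j \<in> J \<Longrightarrow> Re (fst (p j)) \<le> - lam"
    "\<And>j k. j \<in> J \<Longrightarrow> (\<i> * \<theta> k - fst (p j)) * coord (X (basis j)) k = - coord (G (snd (p j))) k"
    by blast
  define q where "q = (\<lambda>j. if j \<in> J then snd (p j) else 0)"
  obtain Y1 where Y1: "bounded_clinear Y1" "\<And>j. Y1 (basis j) = q j"
  proof -
    have le: "L2_set (\<lambda>j. norm (q j)) F \<le> L2_set (\<lambda>j. norm (q j)) J" if "finite F" for F
    proof -
      have "(\<Sum>j\<in>F. (norm (q j))\<^sup>2) = (\<Sum>j\<in>F \<inter> J. (norm (q j))\<^sup>2)"
        using that by (intro sum.mono_neutral_cong_right) (auto simp: q_def)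
      also have "\<dots> \<le> (\<Sum>j\<in>J. (norm (q j))\<^sup>2)"
        using J by (intro sum_mono2) auto
      finally have "(\<Sum>j\<in>F. (norm (q j))\<^sup>2) \<le> (\<Sum>j\<in>J. (norm (q j))\<^sup>2)" .
      then show ?thesis by (simp add: L2_set_def)
    qed
    obtain S' where "bounded_clinear S'" "\<And>j. S' (basis j) = q j"
      using operator_of_columns[of q, OF le] by metis
    then show ?thesis by (rule that)
  qed
  define m where "m = (\<lambda>j. if M < \<bar>j\<bar> then - high_gain j else 0)"
  have m: "norm (m j) \<le> lam / \<gamma>" for j
    using \<gamma>(2)[of j] M(1) lam \<gamma>(1) by (auto simp: m_def high_gain_def norm_divide frac_le)
  define Y where "Y = (\<lambda>a. Y1 a + diag m a)"
  have Y: "bounded_clinear Y"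
    unfolding Y_def by (intro bounded_clinear_plus Y1 bounded_clinear_diag[OF m])
  have Y_basis: "Y (basis j) = (if j \<in> J then snd (p j) else if j = 0 then 0 else cscale (- high_gain j) (basis j))" for j
    unfolding Y_def Y1 diag_basis[OF m] using M1 by (auto simp: q_def m_def J_def)
  define d where "d = (\<lambda>j. if j \<in> J then fst (p j) else if j = 0 then 0 else \<i> * \<theta> j - lam)"
  show ?thesis
  proof (rule that[OF X(1) Y])
    have 0: "0 \<notin> J" by (simp add: J_def)
    show X0: "X (basis 0) = basis 0" using X(2)[OF 0] M1 by (simp add: r'_def)
    show "d 0 = 0" using 0 by (simp add: d_def)
    show "Re (d j) \<le> - lam" if "j \<noteq> 0" for j using that p(1)[of j] by (auto simp: d_def)
    show "(\<i> * \<theta> k - d j) * coord (X (basis j)) k = - coord (G (Y (basis j))) k" for j k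
    proof -
      consider "j \<in> J" | "j = 0" | "j \<notin> J" "j \<noteq> 0" "M < \<bar>j\<bar>" by (force simp: J_def)
      then show ?thesis
      proof cases
        case 1
        then show ?thesis using p(2) by (simp add: d_def Y_basis)
      next
        case 2
        then show ?thesis using X0 0 by (auto simp: d_def Y_basis \<theta>_0 bounded_clinear_0[OF G])
      next
        case 3
        then show ?thesis using r(2)[of j k] X(2)[of j] by (simp add: d_def Y_basis r'_def)
      qed
    qed
  qed
qed

end

section \<open>Diagonal evolutions and mild solutions\<close>

text \<open>The finite sections of the sequence evolve continuously and approximate uniformly in time, because
  the evolution is contractive.\<close>

lemma continuous_on_diag:
  fixes m :: "real \<Rightarrow> int \<Rightarrow> complex"
  assumes m: "\<And>t k. t \<in> S \<Longrightarrow> norm (m t k) \<le> 1" and cont: "\<And>k. continuous_on S (\<lambda>t. m t k)"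
  shows "continuous_on S (\<lambda>t. diag (m t) a)"
proof (rule uniform_limit_theorem)
  define p where "p = (\<lambda>F. \<Sum>j\<in>F. cscale (coord a j) (basis j))"
  show "\<forall>\<^sub>F F in finite_subsets_at_top UNIV. continuous_on S (\<lambda>t. \<Sum>j\<in>F. cscale (m t j) (cscale (coord a j) (basis j)))"
    by (intro always_eventually allI continuous_on_sum
        bounded_linear.continuous_on[OF bounded_linear_cscale_left] cont)
  show "uniform_limit S (\<lambda>F t. \<Sum>j\<in>F. cscale (m t j) (cscale (coord a j) (basis j)))
      (\<lambda>t. diag (m t) a) (finite_subsets_at_top UNIV)"
  proof (rule uniform_limitI)
    fix e :: real assume e: "0 < e"
    have "(p \<longlongrightarrow> a) (finite_subsets_at_top UNIV)"
      using ell2_has_sum_basis[of a] by (simp add: has_sum_def p_def)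
    from tendstoD[OF this e]
    show "\<forall>\<^sub>F F in finite_subsets_at_top UNIV. \<forall>t\<in>S.
        dist (\<Sum>j\<in>F. cscale (m t j) (cscale (coord a j) (basis j))) (diag (m t) a) < e"
    proof eventually_elim
      case (elim F)
      show ?case
      proof
        fix t assume t: "t \<in> S"
        have lin: "linear (diag (m t))"
          by (rule bounded_linear.linear[OF bounded_clinear_linear[OF bounded_clinear_diag[OF m[OF t]]]])
        have "(\<Sum>j\<in>F. cscale (m t j) (cscale (coord a j) (basis j))) = diag (m t) (p F)"
          unfolding p_def linear_sum[OF lin]
          by (intro sum.cong refl ell2_eqI) (simp add: coord_diag[OF m[OF t]])
        then have "dist (\<Sum>j\<in>F. cscale (m t j) (cscale (coord a j) (basis j))) (diag (m t) a)
            = norm (diag (m t) (p F - a))"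
          by (simp add: dist_norm linear_diff[OF lin])
        also have "\<dots> \<le> 1 * norm (p F - a)"
          by (rule norm_diag_le[OF m[OF t] m[OF t]]) auto
        also have "\<dots> < e" using elim by (simp add: dist_norm)
        finally show "dist (\<Sum>j\<in>F. cscale (m t j) (cscale (coord a j) (basis j))) (diag (m t) a) < e" .
      qed
    qed
  qed
qed simp

text \<open>A strongly continuous family of contractions may be applied to a continuous curve.\<close>

lemma continuous_on_diag_curve:
  fixes m :: "real \<Rightarrow> int \<Rightarrow> complex"
  assumes m: "\<And>t k. t \<in> S \<Longrightarrow> norm (m t k) \<le> 1" and cont: "\<And>k. continuous_on S (\<lambda>t. m t k)"
    and w: "continuous_on S w"
  shows "continuous_on S (\<lambda>t. diag (m t) (w t))"
  unfolding continuous_on_def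
proof
  fix t0 assume t0: "t0 \<in> S"
  have lin: "diag (m t) (w t) - diag (m t0) (w t0)
      = diag (m t) (w t - w t0) + (diag (m t) (w t0) - diag (m t0) (w t0))" if "t \<in> S" for t
    by (simp add: bounded_clinear_diff[OF bounded_clinear_diag[OF m[OF that]]])
  have "((\<lambda>t. norm (w t - w t0) + norm (diag (m t) (w t0) - diag (m t0) (w t0))) \<longlongrightarrow> 0 + 0) (at t0 within S)"
    using w continuous_on_diag[OF m cont, where a = "w t0"] t0
    by (intro tendsto_add tendsto_norm_zero; simp add: continuous_on_def LIM_zero_iff)
  then have lim: "((\<lambda>t. norm (w t - w t0) + norm (diag (m t) (w t0) - diag (m t0) (w t0))) \<longlongrightarrow> 0) (at t0 within S)"
    by simp
  have "((\<lambda>t. diag (m t) (w t) - diag (m t0) (w t0)) \<longlongrightarrow> 0) (at t0 within S)"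
  proof (rule Lim_null_comparison[OF _ lim])
    show "\<forall>\<^sub>F t in at t0 within S. norm (diag (m t) (w t) - diag (m t0) (w t0))
        \<le> norm (w t - w t0) + norm (diag (m t) (w t0) - diag (m t0) (w t0))"
      unfolding eventually_at_filter
    proof (intro always_eventually allI impI)
      fix t assume t: "t \<in> S"
      have "norm (diag (m t) (w t - w t0)) \<le> 1 * norm (w t - w t0)"
        by (rule norm_diag_le[OF m[OF t] m[OF t]]) auto
      then show "norm (diag (m t) (w t) - diag (m t0) (w t0))
        \<le> norm (w t - w t0) + norm (diag (m t) (w t0) - diag (m t0) (w t0))"
        unfolding lin[OF t] by (intro order_trans[OF norm_triangle_ineq]) simp
    qed
  qed
  then show "((\<lambda>t. diag (m t) (w t)) \<longlongrightarrow> diag (m t0) (w t0)) (at t0 within S)"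
    by (simp add: LIM_zero_iff)
qed

definition unitary :: "(int \<Rightarrow> real) \<Rightarrow> real \<Rightarrow> ell2 \<Rightarrow> ell2" where
  "unitary \<theta> t = diag (\<lambda>k. exp (\<i> * of_real (\<theta> k * t)))"

lemma norm_exp_imag: "norm (exp (\<i> * complex_of_real x)) \<le> 1"
  by simp

lemma coord_unitary: "coord (unitary \<theta> t a) k = exp (\<i> * of_real (\<theta> k * t)) * coord a k"
  unfolding unitary_def by (rule coord_diag[OF norm_exp_imag])

lemma norm_unitary_le: "norm (unitary \<theta> t a) \<le> norm a"
proof -
  have "norm (diag (\<lambda>k. exp (\<i> * of_real (\<theta> k * t))) a) \<le> 1 * norm a"
    by (rule norm_diag_le[OF norm_exp_imag norm_exp_imag]) simp
  then show ?thesis by (simp add: unitary_def)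
qed

lemma continuous_on_unitary_curve:
  fixes f :: "real \<Rightarrow> real"
  assumes "continuous_on S f" "continuous_on S w"
  shows "continuous_on S (\<lambda>t. unitary \<theta> (f t) (w t))"
  unfolding unitary_def
  by (rule continuous_on_diag_curve[where m = "\<lambda>t k. exp (\<i> * of_real (\<theta> k * f t))"]) (auto intro!: continuous_intros assms)

text \<open>Uniqueness is Gronwall's inequality, obtained by iterating the integral equation.\<close>

lemma volterra_zero:
  fixes w :: "real \<Rightarrow> ell2"
  assumes K: "bounded_clinear K" and w: "continuous_on {0..} w"
    and eq: "\<And>t. 0 \<le> t \<Longrightarrow> w t = integral {0..t} (\<lambda>\<tau>. unitary \<theta> (t - \<tau>) (K (w \<tau>)))"
    and t: "0 \<le> t"
  shows "w t = 0"
proof -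
  obtain B where B: "B > 0" "\<And>a. norm (K a) \<le> B * norm a"
    using bounded_clinear_bound[OF K] by blast
  have cont: "continuous_on {0..x} w" for x
    by (rule continuous_on_subset[OF w]) auto
  have int: "(\<lambda>\<tau>. unitary \<theta> (x - \<tau>) (K (w \<tau>))) integrable_on {0..x}" for x
    by (intro integrable_continuous_interval continuous_on_unitary_curve continuous_intros
        bounded_linear.continuous_on[OF bounded_clinear_linear[OF K]] cont)
  obtain C where C: "\<And>x. x \<in> {0..t} \<Longrightarrow> norm (w x) \<le> C"
    using compact_imp_bounded[OF compact_continuous_image[OF cont compact_Icc, of t]]
    unfolding bounded_iff by (metis imageI)
  have bound: "\<forall>x\<in>{0..t}. norm (w x) \<le> C * (B * x) ^ n / fact n" for n
  proof (induction n)
    case 0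
    then show ?case using C by simp
  next
    case (Suc n)
    show ?case
    proof
      fix x assume x: "x \<in> {0..t}"
      \<comment> \<open>a primitive of the bound that the induction hypothesis gives for the integrand\<close>
      define P where "P = (\<lambda>y. C * B ^ Suc n * y ^ Suc n / fact (Suc n) :: real)"
      have P': "(P has_real_derivative B * (C * (B * y) ^ n / fact n)) (at y within T)" for y T
      proof -
        have "((\<lambda>y. C * B ^ Suc n / fact (Suc n) * y ^ Suc n) has_real_derivative
            C * B ^ Suc n / fact (Suc n) * (real (Suc n) * y ^ n)) (at y within T)"
          using DERIV_cmult[OF DERIV_pow[of "Suc n" y T], of "C * B ^ Suc n / fact (Suc n)"]
          by (simp del: power_Suc fact_Suc)
        moreover have "C * B ^ Suc n / fact (Suc n) * (real (Suc n) * y ^ n) = B * (C * (B * y) ^ n / fact n)"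
          by (simp add: power_mult_distrib del: of_nat_Suc)
        ultimately show ?thesis by (simp add: P_def power_mult_distrib mult.left_commute[of B])
      qed
      have hi: "((\<lambda>y. B * (C * (B * y) ^ n / fact n)) has_integral (P x - P 0)) {0..x}"
        using x P' unfolding has_real_derivative_iff_has_vector_derivative
        by (intro fundamental_theorem_of_calculus) auto
      have "norm (w x) = norm (integral {0..x} (\<lambda>\<tau>. unitary \<theta> (x - \<tau>) (K (w \<tau>))))"
        using eq x by simp
      also have "\<dots> \<le> integral {0..x} (\<lambda>y. B * (C * (B * y) ^ n / fact n))"
      proof (rule integral_norm_bound_integral[OF int])
        show "(\<lambda>y. B * (C * (B * y) ^ n / fact n)) integrable_on {0..x}"
          using hi by blast
        fix y assume y: "y \<in> {0..x}"
        have "norm (unitary \<theta> (x - y) (K (w y))) \<le> B * norm (w y)"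
          by (rule order_trans[OF norm_unitary_le B(2)])
        also have "\<dots> \<le> B * (C * (B * y) ^ n / fact n)"
          using Suc x y B(1) by (intro mult_left_mono) auto
        finally show "norm (unitary \<theta> (x - y) (K (w y))) \<le> B * (C * (B * y) ^ n / fact n)" .
      qed
      also have "\<dots> = P x - P 0" using hi by (rule integral_unique)
      also have "\<dots> = C * (B * x) ^ Suc n / fact (Suc n)"
        by (simp add: P_def power_mult_distrib)
      finally show "norm (w x) \<le> C * (B * x) ^ Suc n / fact (Suc n)" .
    qed
  qed
  have "(\<lambda>n. C * (inverse (fact n) * (B * t) ^ n)) \<longlonglongrightarrow> C * 0"
    by (intro tendsto_mult_left summable_LIMSEQ_zero summable_exp)
  moreover have "norm (w t) \<le> C * (inverse (fact n) * (B * t) ^ n)" for n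
    using bspec[OF bound[of n], of t] t by (simp add: divide_inverse mult_ac)
  ultimately have "norm (w t) \<le> C * 0"
    by (intro LIMSEQ_le_const) auto
  then show ?thesis by simp
qed

text \<open>Both sides are bounded operators of \<open>b\<close>, so the variation-of-constants identity needs to be
  checked only for \<open>b = e\<^sub>j\<close>, where it is the fundamental theorem of calculus in each coordinate.\<close>

lemma conjugated_evolution_mild:
  fixes d :: "int \<Rightarrow> complex"
  assumes X: "bounded_clinear X" and L: "bounded_clinear L" and d: "\<And>j. Re (d j) \<le> 0"
    and eq: "\<And>j k. (\<i> * \<theta> k - d j) * coord (X (basis j)) k = - coord (L (basis j)) k"
    and t: "0 \<le> t"
  shows "X (diag (\<lambda>j. exp (of_real t * d j)) b) = unitary \<theta> t (X b)
    + integral {0..t} (\<lambda>\<tau>. unitary \<theta> (t - \<tau>) (L (diag (\<lambda>j. exp (of_real \<tau> * d j)) b)))"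
proof -
  let ?E = "\<lambda>\<tau>. diag (\<lambda>j. exp (of_real \<tau> * d j))"
  have dm: "norm (exp (of_real \<tau> * d j)) \<le> 1" if "0 \<le> \<tau>" for \<tau> j
    using that d[of j] by (simp add: norm_exp_eq_Re mult_nonneg_nonpos)
  have E: "bounded_clinear (?E \<tau>)" if "0 \<le> \<tau>" for \<tau>
    by (rule bounded_clinear_diag[OF dm[OF that]])
  have E_le: "norm (?E \<tau> a) \<le> norm a" if "0 \<le> \<tau>" for \<tau> a
    using norm_diag_le[OF dm[OF that] dm[OF that], where a = a] by simp
  have contE: "continuous_on {0..t} (\<lambda>\<tau>. ?E \<tau> a)" for a
    by (rule continuous_on_diag) (use dm in \<open>auto intro!: continuous_intros\<close>)
  obtain B where B: "B > 0" "\<And>a. norm (L a) \<le> B * norm a"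
    using bounded_clinear_bound[OF L] by blast
  define f where "f = (\<lambda>a \<tau>. unitary \<theta> (t - \<tau>) (L (?E \<tau> a)))"
  have cont: "continuous_on {0..t} (f a)" for a
    unfolding f_def
    by (intro continuous_on_unitary_curve continuous_intros
        bounded_linear.continuous_on[OF bounded_clinear_linear[OF L]] contE)
  have int: "f a integrable_on {0..t}" for a
    by (rule integrable_continuous_interval[OF cont])
  have U: "bounded_clinear (unitary \<theta> r)" for r
    unfolding unitary_def by (rule bounded_clinear_diag[OF norm_exp_imag])
  have "bounded_clinear (\<lambda>a. unitary \<theta> t (X a) + integral {0..t} (f a))"
  proof (rule bounded_clinear_plus[OF bounded_clinear_compose[OF U X]], rule bounded_clinearI[where B = "B * t"])
    show "integral {0..t} (f (a + b)) = integral {0..t} (f a) + integral {0..t} (f b)" for a b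
      unfolding integral_add[OF int int, symmetric]
      by (rule integral_cong)
        (simp add: f_def bounded_clinear_add[OF E] bounded_clinear_add[OF L] bounded_clinear_add[OF U])
    show "integral {0..t} (f (cscale c a)) = cscale c (integral {0..t} (f a))" for c a
      using integral_linear[OF int bounded_linear_cscale, of c a]
        integral_cong[of "{0..t}" "cscale c \<circ> f a" "f (cscale c a)"]
      by (simp add: f_def bounded_clinear_cscale[OF E] bounded_clinear_cscale[OF L] bounded_clinear_cscale[OF U])
    show "norm (integral {0..t} (f a)) \<le> B * t * norm a" for a
    proof -
      have "norm (integral {0..t} (f a)) \<le> B * norm a * (t - 0)"
      proof (rule integral_bound[OF t cont])
        fix \<tau> assume \<tau>: "\<tau> \<in> {0..t}"
        have "norm (f a \<tau>) \<le> B * norm (?E \<tau> a)"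
          unfolding f_def by (rule order_trans[OF norm_unitary_le B(2)])
        also have "\<dots> \<le> B * norm a"
          using \<tau> B(1) by (intro mult_left_mono E_le) auto
        finally show "norm (f a \<tau>) \<le> B * norm a" .
      qed
      then show ?thesis by (simp add: mult.commute mult.left_commute)
    qed
  qed
  moreover have "bounded_clinear (\<lambda>a. X (?E t a))"
    by (rule bounded_clinear_compose[OF X E[OF t]])
  moreover have "X (?E t (basis j)) = unitary \<theta> t (X (basis j)) + integral {0..t} (f (basis j))" for j
  proof (rule ell2_eqI)
    fix k
    let ?x = "coord (X (basis j)) k"
    have Eb: "?E \<tau> (basis j) = cscale (exp (of_real \<tau> * d j)) (basis j)" if "0 \<le> \<tau>" for \<tau>
      by (rule diag_basis[OF dm[OF that]])
    define \<Phi> where "\<Phi> = (\<lambda>\<tau>::real. exp (\<i> * \<theta> k * of_real t + of_real \<tau> * (d j - \<i> * \<theta> k)) * ?x)"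
    have "((\<lambda>z. exp (\<i> * \<theta> k * of_real t + z * (d j - \<i> * \<theta> k)) * ?x) has_field_derivative
        exp (\<i> * \<theta> k * of_real t + of_real \<tau> * (d j - \<i> * \<theta> k)) * (d j - \<i> * \<theta> k) * ?x) (at (of_real \<tau>))" for \<tau> :: real
      by (auto intro!: derivative_eq_intros)
    then have "(\<Phi> has_vector_derivative exp (\<i> * \<theta> k * of_real t + of_real \<tau> * (d j - \<i> * \<theta> k)) * (d j - \<i> * \<theta> k) * ?x) (at \<tau>)" for \<tau>
      unfolding \<Phi>_def by (rule has_vector_derivative_real_field)
    then have "((\<lambda>\<tau>. exp (\<i> * \<theta> k * of_real t + of_real \<tau> * (d j - \<i> * \<theta> k)) * (d j - \<i> * \<theta> k) * ?x)
        has_integral \<Phi> t - \<Phi> 0) {0..t}"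
      by (intro fundamental_theorem_of_calculus t) (auto intro: has_vector_derivative_at_within)
    moreover have "exp (\<i> * \<theta> k * of_real t + of_real \<tau> * (d j - \<i> * \<theta> k)) * (d j - \<i> * \<theta> k) * ?x
        = coord (f (basis j) \<tau>) k" if "\<tau> \<in> {0..t}" for \<tau>
    proof -
      have "\<i> * \<theta> k * of_real t + of_real \<tau> * (d j - \<i> * \<theta> k)
          = \<i> * of_real (\<theta> k * (t - \<tau>)) + of_real \<tau> * d j"
        by (simp add: algebra_simps)
      moreover have "(d j - \<i> * \<theta> k) * ?x = coord (L (basis j)) k"
        using eq[of k j] by (simp add: algebra_simps)
      ultimately show ?thesis
        using that by (simp add: f_def coord_unitary Eb bounded_clinear_cscale[OF L] exp_add mult.assoc)
    qed
    ultimately have "((\<lambda>\<tau>. coord (f (basis j) \<tau>) k) has_integral \<Phi> t - \<Phi> 0) {0..t}"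
      by (rule has_integral_eq[rotated])
    moreover have "((\<lambda>\<tau>. coord (f (basis j) \<tau>) k) has_integral coord (integral {0..t} (f (basis j))) k) {0..t}"
      using has_integral_linear[OF integrable_integral[OF int[of "basis j"]] bounded_linear_coord[of k]]
      by (simp add: o_def)
    ultimately have "coord (integral {0..t} (f (basis j))) k = \<Phi> t - \<Phi> 0"
      by (rule has_integral_unique[rotated])
    moreover have "\<Phi> t = exp (of_real t * d j) * ?x" "\<Phi> 0 = exp (\<i> * of_real (\<theta> k * t)) * ?x"
      by (simp_all add: \<Phi>_def algebra_simps)
    ultimately show "coord (X (?E t (basis j))) k
        = coord (unitary \<theta> t (X (basis j)) + integral {0..t} (f (basis j))) k"
      by (simp add: Eb[OF t] bounded_clinear_cscale[OF X] coord_unitary)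
  qed
  ultimately show ?thesis
    using bounded_clinear_eqI[of "\<lambda>a. X (?E t a)" "\<lambda>a. unitary \<theta> t (X a) + integral {0..t} (f a)" b]
    by (simp add: f_def)
qed

section \<open>Fourier series of smooth periodic functions\<close>

text \<open>The sign is that of the Fourier kernel: the \<open>k\<close>-th coefficient pairs with \<open>mode k\<close>, and the
  \<open>k\<close>-th basis function of the series is \<open>mode (- k)\<close>.\<close>

definition mode :: "int \<Rightarrow> real \<Rightarrow> complex" where
  "mode k x = exp (- (\<i> * of_int k * of_real x))"

definition fcoef :: "(real \<Rightarrow> complex) \<Rightarrow> int \<Rightarrow> complex" where
  "fcoef \<phi> k = integral {0..2 * pi} (\<lambda>x. \<phi> x * mode k x) / (2 * of_real pi)"

lemma smooth_periodic_mode: "smooth_periodic (mode k)"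
  unfolding mode_def[abs_def] by (rule smooth_periodic_exp)

lemma mode_period: "mode k (x + 2 * pi) = mode k x"
  by (rule smooth_periodic_period[OF smooth_periodic_mode])

lemma mode_add: "mode (j + k) x = mode j x * mode k x"
  by (simp add: mode_def exp_add[symmetric] algebra_simps)

lemma mode_0 [simp]: "mode 0 x = 1" by (simp add: mode_def)

lemma norm_mode [simp]: "norm (mode k x) = 1"
  by (simp add: mode_def norm_exp_eq_Re)

lemma mode_uminus: "mode (- k) x = cnj (mode k x)"
  by (simp add: mode_def exp_cnj)

lemma mode_nonzero [simp]: "mode k x \<noteq> 0" by (simp add: mode_def)

lemma mode_derivative: "(mode k has_vector_derivative - (\<i> * of_int k) * mode k x) (at x within S)"
proof -
  have "((\<lambda>z. exp (- (\<i> * of_int k * z))) has_field_derivative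
      - (\<i> * of_int k) * exp (- (\<i> * of_int k * of_real x))) (at (of_real x))"
    by (auto intro!: derivative_eq_intros)
  from has_vector_derivative_real_field[OF this]
  show ?thesis by (auto simp: mode_def[abs_def] intro: has_vector_derivative_at_within)
qed

lemma continuous_on_mode [continuous_intros]: "continuous_on S (mode k)"
  using smooth_periodic_continuous_on[OF smooth_periodic_mode, of S 0] by simp

lemma integral_mode: "integral {0..2 * pi} (mode k) = (if k = 0 then 2 * of_real pi else 0)"
proof (cases "k = 0")
  case True
  have "mode 0 = (\<lambda>_. 1)" by auto
  then show ?thesis using True by (simp add: scaleR_conv_of_real)
next
  case False
  have "((\<lambda>x. - (\<i> * of_int k) * mode k x) has_integral mode k (2 * pi) - mode k 0) {0..2 * pi}"
    by (intro fundamental_theorem_of_calculus mode_derivative) simp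
  then have "((\<lambda>x. - (\<i> * of_int k) * mode k x) has_integral 0) {0..2 * pi}"
    using mode_period[of k 0] by simp
  from has_integral_mult_right[OF this, of "inverse (- (\<i> * of_int k))"]
  have "((\<lambda>x. inverse (- (\<i> * of_int k)) * (- (\<i> * of_int k) * mode k x)) has_integral 0) {0..2 * pi}"
    by (simp only: mult_zero_right)
  then have "(mode k has_integral 0) {0..2 * pi}"
    by (rule has_integral_eq[rotated]) (use False in \<open>simp add: field_simps\<close>)
  then show ?thesis using False by (simp add: integral_unique)
qed

lemma fcoef_mode: "fcoef (mode j) k = (if k = - j then 1 else 0)"
proof -
  have "(\<lambda>x. mode j x * mode k x) = mode (j + k)" by (simp add: fun_eq_iff mode_add)
  then show ?thesis by (auto simp: fcoef_def integral_mode add_eq_0_iff)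
qed

lemma integrable_mult_mode:
  assumes "continuous_on {0..2 * pi} f"
  shows "(\<lambda>x. f x * mode k x) integrable_on {0..2 * pi}"
  by (intro integrable_continuous_interval continuous_intros assms)

lemma norm_fcoef_le:
  assumes "continuous_on {0..2 * pi} f" and "\<And>x. norm (f x) \<le> B"
  shows "norm (fcoef f k) \<le> B"
proof -
  have "norm (integral {0..2 * pi} (\<lambda>x. f x * mode k x)) \<le> B * (2 * pi - 0)"
    by (intro integral_bound continuous_intros assms) (auto simp: norm_mult assms)
  then show ?thesis by (simp add: fcoef_def norm_divide norm_mult divide_simps mult.commute)
qed

lemma vderivs_vderivs: "vderivs m (vderivs n \<phi>) = vderivs (m + n) \<phi>"
  by (simp add: vderivs_def funpow_add)

lemma smooth_periodic_vderivs:
  assumes "smooth_periodic \<phi>"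
  shows "smooth_periodic (vderivs n \<phi>)"
  using assms vderivs_periodic[OF assms] by (simp add: smooth_periodic_def vderivs_vderivs)

text \<open>Integration by parts; the boundary terms cancel by periodicity.\<close>

lemma fcoef_vderivs:
  assumes "smooth_periodic \<phi>"
  shows "fcoef (vderivs n \<phi>) k = (\<i> * of_int k) ^ n * fcoef \<phi> k"
proof (induction n)
  case (Suc n)
  let ?f = "vderivs n \<phi>" and ?f' = "vderivs (Suc n) \<phi>"
  have cont: "continuous_on {0..2 * pi} ?f" "continuous_on {0..2 * pi} ?f'"
    by (intro smooth_periodic_continuous_on assms)+
  have "((\<lambda>x. ?f x * mode k x) has_vector_derivative
      ?f x * (- (\<i> * of_int k) * mode k x) + ?f' x * mode k x) (at x within {0..2 * pi})" for x
    by (rule has_vector_derivative_mult[OF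
        has_vector_derivative_at_within[OF smooth_periodic_has_vector_derivative[OF assms]] mode_derivative])
  then have "((\<lambda>x. ?f x * (- (\<i> * of_int k) * mode k x) + ?f' x * mode k x) has_integral
      ?f (2 * pi) * mode k (2 * pi) - ?f 0 * mode k 0) {0..2 * pi}"
    by (intro fundamental_theorem_of_calculus) auto
  moreover have "?f (2 * pi) * mode k (2 * pi) = ?f 0 * mode k 0"
    using vderivs_periodic[OF assms, of n 0] mode_period[of k 0] by simp
  ultimately have zero: "((\<lambda>x. ?f x * (- (\<i> * of_int k) * mode k x) + ?f' x * mode k x) has_integral 0) {0..2 * pi}"
    by simp
  have "((\<lambda>x. - (\<i> * of_int k) * (?f x * mode k x) + ?f' x * mode k x) has_integral
      - (\<i> * of_int k) * integral {0..2 * pi} (\<lambda>x. ?f x * mode k x)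
        + integral {0..2 * pi} (\<lambda>x. ?f' x * mode k x)) {0..2 * pi}"
    by (intro has_integral_add has_integral_mult_right integrable_integral integrable_mult_mode cont)
  then have "((\<lambda>x. ?f x * (- (\<i> * of_int k) * mode k x) + ?f' x * mode k x) has_integral
      - (\<i> * of_int k) * integral {0..2 * pi} (\<lambda>x. ?f x * mode k x)
        + integral {0..2 * pi} (\<lambda>x. ?f' x * mode k x)) {0..2 * pi}"
    by (rule has_integral_eq[rotated]) (simp add: algebra_simps)
  from has_integral_unique[OF zero this]
  have "integral {0..2 * pi} (\<lambda>x. ?f' x * mode k x)
      = \<i> * of_int k * integral {0..2 * pi} (\<lambda>x. ?f x * mode k x)"
    by (simp add: algebra_simps)
  then show ?case using Suc by (simp add: fcoef_def)
qed simp

lemma fcoef_decay: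
  assumes \<phi>: "smooth_periodic \<phi>" and B: "\<And>j x. j \<le> 2 \<Longrightarrow> norm (vderivs j \<phi> x) \<le> B"
  shows "norm (fcoef \<phi> k) \<le> 2 * B * (1 / (1 + (of_int k)\<^sup>2))"
proof -
  have *: "norm (fcoef (vderivs n \<phi>) k) \<le> B" if "n \<le> 2" for n
    by (rule norm_fcoef_le[OF smooth_periodic_continuous_on[OF \<phi>] B[OF that]])
  have "norm (fcoef (vderivs 2 \<phi>) k) = (of_int k)\<^sup>2 * norm (fcoef \<phi> k)"
    by (simp add: fcoef_vderivs[OF \<phi>] norm_mult norm_power)
  with *[of 0] *[of 2] have "(1 + (of_int k)\<^sup>2) * norm (fcoef \<phi> k) \<le> 2 * B"
    by (simp add: distrib_right)
  moreover have "0 < 1 + (real_of_int k)\<^sup>2" by (simp add: add_pos_nonneg)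
  ultimately show ?thesis by (simp add: field_simps)
qed

lemma summable_on_fcoef:
  assumes "smooth_periodic \<phi>"
  shows "(\<lambda>k. norm (fcoef \<phi> k)) summable_on UNIV"
proof -
  obtain A where A: "\<And>n x. norm (vderivs n \<phi> x) \<le> A n"
    using vderivs_bounded[OF assms] by metis
  define B where "B = Max (A ` {..2})"
  have B: "norm (vderivs j \<phi> x) \<le> B" if "j \<le> 2" for j x
    unfolding B_def using A that by (meson Max_ge atMost_iff finite_atMost finite_imageI imageI order_trans)
  show ?thesis
  proof (rule summable_on_comparison_test)
    show "(\<lambda>k::int. 2 * B * (1 / (1 + (of_int k)\<^sup>2))) summable_on UNIV"
      by (intro summable_on_cmult_right summable_on_int_inverse_square)
  qed (use fcoef_decay[OF assms B] in auto)
qed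

text \<open>Bessel's inequality; it yields the Riemann--Lebesgue lemma for continuous functions.\<close>

lemma bessel_inequality:
  assumes h: "continuous_on {0..2 * pi} h" and F: "finite F"
  shows "2 * pi * (\<Sum>k\<in>F. (norm (fcoef h k))\<^sup>2) \<le> integral {0..2 * pi} (\<lambda>x. (norm (h x))\<^sup>2)"
proof -
  let ?I = "integral {0..2 * pi}"
  define p where "p = (\<lambda>x. \<Sum>k\<in>F. fcoef h k * mode (- k) x)"
  define S where "S = 2 * complex_of_real pi * (\<Sum>k\<in>F. fcoef h k * cnj (fcoef h k))"
  have p: "continuous_on {0..2 * pi} p"
    unfolding p_def by (intro continuous_intros)
  have cnj_p: "cnj (p x) = (\<Sum>k\<in>F. cnj (fcoef h k) * mode k x)" for x
    by (simp add: p_def flip: mode_uminus)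
  have against_p: "?I (\<lambda>x. f x * cnj (p x)) = (\<Sum>k\<in>F. cnj (fcoef h k) * (2 * of_real pi * fcoef f k))"
    if f: "continuous_on {0..2 * pi} f" for f
  proof -
    have "?I (\<lambda>x. f x * cnj (p x)) = ?I (\<lambda>x. \<Sum>k\<in>F. cnj (fcoef h k) * (f x * mode k x))"
      by (rule integral_cong) (simp add: cnj_p sum_distrib_left mult.left_commute)
    also have "\<dots> = (\<Sum>k\<in>F. ?I (\<lambda>x. cnj (fcoef h k) * (f x * mode k x)))"
      by (intro integral_sum F integrable_on_mult_right integrable_mult_mode f)
    finally show ?thesis by (simp add: fcoef_def)
  qed
  have fcoef_p: "fcoef p k = fcoef h k" if k: "k \<in> F" for k
  proof -
    have "?I (\<lambda>x. p x * mode k x) = ?I (\<lambda>x. \<Sum>j\<in>F. fcoef h j * (mode (- j) x * mode k x))"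
      by (rule integral_cong) (simp add: p_def sum_distrib_right mult.assoc)
    also have "\<dots> = (\<Sum>j\<in>F. ?I (\<lambda>x. fcoef h j * (mode (- j) x * mode k x)))"
      by (intro integral_sum F integrable_on_mult_right integrable_mult_mode continuous_intros)
    also have "\<dots> = (\<Sum>j\<in>F. fcoef h j * (2 * of_real pi * fcoef (mode (- j)) k))"
      by (simp add: fcoef_def)
    also have "\<dots> = 2 * of_real pi * fcoef h k"
      using F k by (simp add: fcoef_mode if_distrib cong: if_cong)
    finally show ?thesis by (simp add: fcoef_def)
  qed
  have hp: "?I (\<lambda>x. h x * cnj (p x)) = S" "?I (\<lambda>x. p x * cnj (p x)) = S"
    unfolding against_p[OF h] against_p[OF p] S_def sum_distrib_left
    by (auto intro!: sum.cong simp: fcoef_p)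
  have ph: "?I (\<lambda>x. p x * cnj (h x)) = cnj S"
  proof -
    have "((\<lambda>x. cnj (h x * cnj (p x))) has_integral cnj S) {0..2 * pi}"
      using has_integral_linear[OF integrable_integral[OF integrable_continuous_interval] bounded_linear_cnj,
          of 0 "2 * pi" "\<lambda>x. h x * cnj (p x)"] h p hp(1)
      by (simp add: o_def continuous_intros)
    then show ?thesis by (simp add: integral_unique mult.commute)
  qed
  have cnj_S: "cnj S = S" by (simp add: S_def mult.commute)
  have int: "(\<lambda>x. f x * cnj (g x)) integrable_on {0..2 * pi}"
    if "continuous_on {0..2 * pi} f" "continuous_on {0..2 * pi} g" for f g
    by (intro integrable_continuous_interval continuous_intros that)
  have of_real_I: "?I (\<lambda>x. f x * cnj (f x)) = of_real (?I (\<lambda>x. (norm (f x))\<^sup>2))"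
    if f: "continuous_on {0..2 * pi} f" for f
  proof -
    have "((\<lambda>x. complex_of_real ((norm (f x))\<^sup>2)) has_integral of_real (?I (\<lambda>x. (norm (f x))\<^sup>2))) {0..2 * pi}"
      using has_integral_linear[OF integrable_integral[OF integrable_continuous_interval] bounded_linear_of_real,
          of 0 "2 * pi" "\<lambda>x. (norm (f x))\<^sup>2"] f
      by (simp add: o_def continuous_intros)
    then show ?thesis unfolding complex_norm_square by (rule integral_unique)
  qed
  have "?I (\<lambda>x. (h x - p x) * cnj (h x - p x))
      = ?I (\<lambda>x. (h x * cnj (h x) - h x * cnj (p x)) - (p x * cnj (h x) - p x * cnj (p x)))"
    by (rule integral_cong) (simp add: algebra_simps)
  also have "\<dots> = (?I (\<lambda>x. h x * cnj (h x)) - ?I (\<lambda>x. h x * cnj (p x)))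
      - (?I (\<lambda>x. p x * cnj (h x)) - ?I (\<lambda>x. p x * cnj (p x)))"
    by (simp add: integral_diff integrable_diff int h p)
  also have "\<dots> = ?I (\<lambda>x. h x * cnj (h x)) - S"
    by (simp add: hp ph cnj_S)
  finally have "of_real (?I (\<lambda>x. (norm (h x - p x))\<^sup>2)) = of_real (?I (\<lambda>x. (norm (h x))\<^sup>2)) - S"
    using of_real_I[of "\<lambda>x. h x - p x"] of_real_I[OF h] h p by (simp add: continuous_intros)
  moreover have "S = of_real (2 * pi * (\<Sum>k\<in>F. (norm (fcoef h k))\<^sup>2))"
    by (simp add: S_def complex_norm_square del: of_real_power)
  ultimately have "complex_of_real (?I (\<lambda>x. (norm (h x - p x))\<^sup>2))
      = of_real (?I (\<lambda>x. (norm (h x))\<^sup>2) - 2 * pi * (\<Sum>k\<in>F. (norm (fcoef h k))\<^sup>2))"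
    by (simp only: of_real_diff)
  then have "?I (\<lambda>x. (norm (h x - p x))\<^sup>2)
      = ?I (\<lambda>x. (norm (h x))\<^sup>2) - 2 * pi * (\<Sum>k\<in>F. (norm (fcoef h k))\<^sup>2)"
    by (simp only: of_real_eq_iff)
  moreover have "0 \<le> ?I (\<lambda>x. (norm (h x - p x))\<^sup>2)"
    by (intro integral_nonneg integrable_continuous_interval continuous_intros h p) auto
  ultimately show ?thesis by simp
qed

lemma riemann_lebesgue:
  assumes h: "continuous_on {0..2 * pi} h" and f: "inj f"
  shows "(\<lambda>n::nat. fcoef h (f n)) \<longlonglongrightarrow> 0"
proof -
  let ?A = "integral {0..2 * pi} (\<lambda>x. (norm (h x))\<^sup>2) / (2 * pi)"
  have "summable (\<lambda>n. (norm (fcoef h (f n)))\<^sup>2)"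
  proof (rule bounded_imp_summable)
    fix n
    have inj: "inj_on f {..n}" using f by (rule inj_on_subset) simp
    show "(\<Sum>i\<le>n. (norm (fcoef h (f i)))\<^sup>2) \<le> ?A"
      using bessel_inequality[OF h, of "f ` {..n}"]
      by (simp add: sum.reindex[OF inj] field_simps)
  qed simp
  then have "(\<lambda>n. (norm (fcoef h (f n)))\<^sup>2) \<longlonglongrightarrow> 0" by (rule summable_LIMSEQ_zero)
  from tendsto_real_sqrt[OF this] show ?thesis by (simp add: tendsto_norm_zero_iff)
qed

lemma has_sum_int_symmetric_limit:
  fixes f :: "int \<Rightarrow> complex"
  assumes "(f has_sum S) UNIV"
  shows "(\<lambda>n. sum f {- int n..int n}) \<longlonglongrightarrow> S"
proof -
  have "filterlim (\<lambda>n. {- int n..int n}) (finite_subsets_at_top UNIV) sequentially"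
    unfolding filterlim_finite_subsets_at_top
  proof (intro allI impI)
    fix X :: "int set" assume X: "finite X \<and> X \<subseteq> UNIV"
    have "X \<subseteq> {- int n..int n}" if n: "n \<ge> nat (Max (insert 0 (abs ` X)))" for n
    proof
      fix x assume "x \<in> X"
      then have "\<bar>x\<bar> \<le> Max (insert 0 (abs ` X))" using X by (intro Max_ge) auto
      then show "x \<in> {- int n..int n}" using n by auto
    qed
    then show "\<forall>\<^sub>F n in sequentially. finite {- int n..int n} \<and> X \<subseteq> {- int n..int n} \<and> {- int n..int n} \<subseteq> UNIV"
      by (intro eventually_sequentiallyI[of "nat (Max (insert 0 (abs ` X)))"]) auto
  qed
  then show ?thesis
    using assms filterlim_compose unfolding has_sum_def by blast
qed

lemma vector_derivative_quotient:
  fixes f :: "real \<Rightarrow> complex"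
  assumes "(f has_vector_derivative D) (at x)"
  shows "((\<lambda>z. (f z - f x) / of_real (z - x)) \<longlongrightarrow> D) (at x)"
proof -
  have "((\<lambda>z. norm (f z - f x - (z - x) *\<^sub>R D) / norm (z - x)) \<longlongrightarrow> 0) (at x)"
    using assms by (simp add: has_vector_derivative_def has_derivative_iff_norm)
  moreover have "\<forall>\<^sub>F z in at x. norm (f z - f x - (z - x) *\<^sub>R D) / norm (z - x)
      = norm ((f z - f x) / of_real (z - x) - D)"
    unfolding eventually_at_filter
  proof (intro always_eventually allI impI)
    fix z assume "z \<noteq> x"
    then have "f z - f x - (z - x) *\<^sub>R D = of_real (z - x) * ((f z - f x) / of_real (z - x) - D)"
      by (simp add: scaleR_conv_of_real field_simps)
    then show "norm (f z - f x - (z - x) *\<^sub>R D) / norm (z - x) = norm ((f z - f x) / of_real (z - x) - D)"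
      using \<open>z \<noteq> x\<close> by (simp only: norm_mult) (simp add: norm_of_real del: of_real_diff)
  qed
  ultimately have "((\<lambda>z. norm ((f z - f x) / of_real (z - x) - D)) \<longlongrightarrow> 0) (at x)"
    by (rule Lim_transform_eventually)
  then show ?thesis by (rule LIM_zero_cancel[OF tendsto_norm_zero_cancel])
qed

text \<open>Chernoff's argument: dividing \<open>\<phi> x - \<phi> y\<close> by \<open>e\<^bsup>ix\<^esup> - e\<^bsup>iy\<^esup>\<close> leaves a continuous function,
  and turns the symmetric partial sums of the Fourier series at \<open>y\<close> into telescoping sums, whose end
  terms are coefficients of that function and vanish by the Riemann--Lebesgue lemma.\<close>

lemma fourier_inversion:
  assumes \<phi>: "smooth_periodic \<phi>"
  shows "((\<lambda>k. fcoef \<phi> k * mode (- k) y) has_sum \<phi> y) UNIV"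
proof -
  let ?e = "mode (- 1)" and ?D = "vderivs 1 \<phi>"
  have \<phi>': "(\<phi> has_vector_derivative ?D x) (at x)" for x
    using smooth_periodic_has_vector_derivative[OF \<phi>, of 0 x] by simp
  have e': "(?e has_vector_derivative \<i> * ?e x) (at x)" for x
    using mode_derivative[of "- 1" x UNIV] by simp
  \<comment> \<open>at the zeros of the denominator the quotient has the limit \<open>\<phi>'(x) / (i e\<^bsup>ix\<^esup>)\<close>\<close>
  define h where "h = (\<lambda>x. if ?e x = ?e y then ?D x / (\<i> * ?e x) else (\<phi> x - \<phi> y) / (?e x - ?e y))"
  have e_eq: "\<phi> x = \<phi> y" if "?e x = ?e y" for x
  proof -
    have "exp (\<i> * of_real x) = exp (\<i> * of_real y)"
      using that by (simp add: mode_def)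
    then obtain n :: int where "\<i> * of_real x = \<i> * of_real y + (of_int (2 * n) * of_real pi) * \<i>"
      by (auto simp: exp_eq)
    then have "\<i> * of_real x = \<i> * complex_of_real (y + 2 * pi * of_int n)"
      by (simp add: algebra_simps)
    then have x: "x = y + 2 * pi * of_int n"
      by (simp only: mult_cancel_left of_real_eq_iff) auto
    have shift: "\<phi> (z + 2 * pi * real m) = \<phi> z" for z m
    proof (induction m)
      case (Suc m)
      have "z + 2 * pi * real (Suc m) = (z + 2 * pi * real m) + 2 * pi" by (simp add: algebra_simps)
      then show ?case using Suc smooth_periodic_period[OF \<phi>] by metis
    qed simp
    show ?thesis
    proof (cases "n \<ge> 0")
      case True
      then show ?thesis using shift[of y "nat n"] x by simp
    next
      case False
      then show ?thesis using shift[of x "nat (- n)"] x by (simp add: algebra_simps)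
    qed
  qed
  have h_eq: "\<phi> x - \<phi> y = h x * (?e x - ?e y)" for x
    using e_eq[of x] by (auto simp: h_def)
  have "isCont h x" for x
  proof (cases "?e x = ?e y")
    case False
    have "\<forall>\<^sub>F z in nhds x. ?e z \<noteq> ?e y"
    proof (rule tendsto_imp_eventually_ne[OF _ False])
      show "(?e \<longlongrightarrow> ?e x) (nhds x)"
        using has_vector_derivative_continuous[OF e'[of x]]
        by (simp add: isCont_def tendsto_at_iff_tendsto_nhds)
    qed
    then have "\<forall>\<^sub>F z in nhds x. h z = (\<phi> z - \<phi> y) / (?e z - ?e y)"
      by eventually_elim (simp add: h_def)
    moreover have "isCont (\<lambda>z. (\<phi> z - \<phi> y) / (?e z - ?e y)) x"
      using False has_vector_derivative_continuous[OF \<phi>'] has_vector_derivative_continuous[OF e']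
      by (intro continuous_intros) auto
    ultimately show ?thesis by (subst isCont_cong)
  next
    case True
    have quot: "((\<lambda>z. (\<phi> z - \<phi> x) / of_real (z - x) / ((?e z - ?e x) / of_real (z - x)))
        \<longlongrightarrow> ?D x / (\<i> * ?e x)) (at x)"
      by (intro tendsto_divide vector_derivative_quotient \<phi>' e') simp
    have "\<forall>\<^sub>F z in at x. (?e z - ?e x) / of_real (z - x) \<noteq> 0"
      by (rule tendsto_imp_eventually_ne[OF vector_derivative_quotient[OF e']]) simp
    then have "\<forall>\<^sub>F z in at x. (\<phi> z - \<phi> x) / of_real (z - x) / ((?e z - ?e x) / of_real (z - x)) = h z"
      by eventually_elim (use True e_eq[OF True] in \<open>auto simp: h_def divide_simps\<close>)
    from Lim_transform_eventually[OF quot this] show ?thesis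
      using True by (simp add: isCont_def h_def)
  qed
  then have h: "continuous_on {0..2 * pi} h"
    by (simp add: continuous_at_imp_continuous_on)
  have c\<phi>: "continuous_on {0..2 * pi} \<phi>"
    using smooth_periodic_continuous_on[OF \<phi>, of _ 0] by simp
  have telescope: "fcoef \<phi> k * mode (- k) y
      = (if k = 0 then \<phi> y else 0) + (fcoef h (k - 1) * mode (- k) y - fcoef h k * mode (- k - 1) y)" for k
  proof -
    have "integral {0..2 * pi} (\<lambda>x. \<phi> x * mode k x)
        = integral {0..2 * pi} (\<lambda>x. \<phi> y * mode k x + (h x * mode (k - 1) x - ?e y * (h x * mode k x)))"
    proof (rule integral_cong)
      fix x
      have "mode (k - 1) x = mode k x * ?e x" using mode_add[of k "- 1" x] by simp
      moreover have "\<phi> x = \<phi> y + h x * (?e x - ?e y)" using h_eq[of x] by (simp add: algebra_simps)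
      ultimately show "\<phi> x * mode k x = \<phi> y * mode k x + (h x * mode (k - 1) x - ?e y * (h x * mode k x))"
        by (simp only:) (simp add: algebra_simps)
    qed
    also have "\<dots> = \<phi> y * (if k = 0 then 2 * of_real pi else 0) + (integral {0..2 * pi} (\<lambda>x. h x * mode (k - 1) x)
        - ?e y * integral {0..2 * pi} (\<lambda>x. h x * mode k x))"
      by (simp add: integral_add integral_diff integrable_diff integrable_mult_mode h
          integrable_on_mult_right integrable_continuous_interval continuous_on_mode integral_mode)
    finally have "integral {0..2 * pi} (\<lambda>x. \<phi> x * mode k x) = \<phi> y * (if k = 0 then 2 * of_real pi else 0)
        + (integral {0..2 * pi} (\<lambda>x. h x * mode (k - 1) x) - ?e y * integral {0..2 * pi} (\<lambda>x. h x * mode k x))" .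
    then have A: "fcoef \<phi> k = (if k = 0 then \<phi> y else 0) + (fcoef h (k - 1) - ?e y * fcoef h k)"
      by (simp add: fcoef_def add_divide_distrib diff_divide_distrib)
    have "mode (- k - 1) y = mode (- k) y * ?e y" using mode_add[of "- k" "- 1" y] by simp
    then show ?thesis unfolding A by (cases "k = 0") (simp_all add: algebra_simps)
  qed
  define a where "a = (\<lambda>k. fcoef h k * mode (- k - 1) y)"
  have tel: "fcoef \<phi> k * mode (- k) y = a (k - 1) - a k" if "k \<noteq> 0" for k
    using telescope[of k] that by (simp add: a_def)
  have partial: "(\<Sum>k\<in>{- int n..int n}. fcoef \<phi> k * mode (- k) y) = \<phi> y + (a (- int n - 1) - a (int n))" for n
  proof (induction n)
    case 0
    show ?case using telescope[of 0] by (simp add: a_def)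
  next
    case (Suc n)
    let ?t = "\<lambda>k. fcoef \<phi> k * mode (- k) y"
    have "{- int (Suc n)..int (Suc n)} = insert (- int (Suc n)) (insert (int (Suc n)) {- int n..int n})"
      by auto
    then have "sum ?t {- int (Suc n)..int (Suc n)}
        = ?t (- int (Suc n)) + (?t (int (Suc n)) + sum ?t {- int n..int n})"
      by simp
    also have "?t (- int (Suc n)) = a (- int (Suc n) - 1) - a (- int (Suc n))" by (rule tel) simp
    also have "?t (int (Suc n)) = a (int (Suc n) - 1) - a (int (Suc n))" by (rule tel) simp
    also have "int (Suc n) - 1 = int n" by simp
    also have "sum ?t {- int n..int n} = \<phi> y + (a (- int (Suc n)) - a (int n))"
    proof -
      have "- int (Suc n) = - int n - 1" by simp
      then show ?thesis unfolding Suc by (simp only:)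
    qed
    finally show ?case by simp
  qed
  have a0: "(\<lambda>n::nat. a (f n)) \<longlonglongrightarrow> 0" if "inj f" for f
  proof -
    have "(\<lambda>n. norm (fcoef h (f n))) \<longlonglongrightarrow> 0" by (intro tendsto_norm_zero riemann_lebesgue h that)
    then have "(\<lambda>n. norm (a (f n))) \<longlonglongrightarrow> 0" by (simp add: a_def norm_mult)
    then show ?thesis by (rule tendsto_norm_zero_cancel)
  qed
  have "(\<lambda>n. \<phi> y + (a (- int n - 1) - a (int n))) \<longlonglongrightarrow> \<phi> y + (0 - 0)"
    by (intro tendsto_intros a0) (auto simp: inj_def)
  then have lim: "(\<lambda>n. \<Sum>k\<in>{- int n..int n}. fcoef \<phi> k * mode (- k) y) \<longlonglongrightarrow> \<phi> y"
    by (simp add: partial)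
  have "(\<lambda>k. norm (fcoef \<phi> k * mode (- k) y)) summable_on UNIV"
    using summable_on_fcoef[OF \<phi>] by (simp add: norm_mult)
  then have "(\<lambda>k. fcoef \<phi> k * mode (- k) y) summable_on UNIV" by (rule abs_summable_summable)
  then have "((\<lambda>k. fcoef \<phi> k * mode (- k) y) has_sum (\<Sum>\<^sub>\<infinity>k. fcoef \<phi> k * mode (- k) y)) UNIV"
    by (rule has_sum_infsum)
  from LIMSEQ_unique[OF has_sum_int_symmetric_limit[OF this] lim] this show ?thesis by simp
qed

section \<open>Fourier coefficients of periodic distributions\<close>

lemma is_pdist_pairing: "is_pdist (pairing T)"
  using pairing by simp

lemma pairing_add:
  "smooth_periodic \<phi> \<Longrightarrow> smooth_periodic \<psi> \<Longrightarrow> pairing T (\<lambda>x. \<phi> x + \<psi> x) = pairing T \<phi> + pairing T \<psi>"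
  and pairing_scale: "smooth_periodic \<phi> \<Longrightarrow> pairing T (\<lambda>x. c * \<phi> x) = c * pairing T \<phi>"
  and pairing_not_smooth: "\<not> smooth_periodic \<phi> \<Longrightarrow> pairing T \<phi> = 0"
  using is_pdist_pairing[of T] by (auto simp: is_pdist_def)

lemma pairing_trig_poly:
  assumes "finite F"
  shows "smooth_periodic (\<lambda>x. \<Sum>k\<in>F. c k * mode (- k) x) \<and>
    pairing T (\<lambda>x. \<Sum>k\<in>F. c k * mode (- k) x) = (\<Sum>k\<in>F. c k * pairing T (mode (- k)))"
  using assms
proof (induction F rule: finite_induct)
  case empty
  have "pairing T (\<lambda>x. 0 * mode 0 x) = 0 * pairing T (mode 0)"
    by (rule pairing_scale[OF smooth_periodic_mode])
  then show ?case by (simp add: smooth_periodic_const)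
next
  case (insert j F)
  have "smooth_periodic (\<lambda>x. c j * mode (- j) x)"
    by (intro smooth_periodic_scale smooth_periodic_mode)
  then show ?case
    using insert by (simp add: smooth_periodic_add pairing_add pairing_scale smooth_periodic_mode)
qed

lemma has_sum_tail_bound:
  fixes f :: "int \<Rightarrow> complex"
  assumes f: "(f has_sum S) UNIV" and g: "(g has_sum W) UNIV" and F: "finite F"
    and le: "\<And>k. norm (f k) \<le> g k"
  shows "norm (S - sum f F) \<le> W - sum g F"
proof -
  have cut: "((\<lambda>k. if k \<in> F then 0 else f' k) has_sum S' - sum f' F) UNIV"
    if "(f' has_sum S') UNIV" for f' :: "int \<Rightarrow> 'b::real_normed_vector" and S'
  proof -
    have "((\<lambda>k. if k \<in> F then - f' k else 0) has_sum - sum f' F) UNIV"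
      by (rule has_sum_finite_neutralI[OF F]) (auto simp: sum_negf)
    from has_sum_add[OF that this] show ?thesis
      by (auto elim!: back_subst[of "\<lambda>f. (f has_sum _) _"])
  qed
  show ?thesis
    by (rule norm_infsum_le[OF cut[OF f] cut[OF g]]) (use le in auto)
qed

text \<open>The partial sums of the Fourier series of a test function converge together with all
  derivatives, because differentiation multiplies the coefficients by \<open>\<i> k\<close> and every derivative is
  again a test function. A distribution may thus be paired with the series term by term.\<close>

lemma pairing_fourier_series:
  assumes \<phi>: "smooth_periodic \<phi>"
  shows "((\<lambda>k. fcoef \<phi> k * pairing T (mode (- k))) has_sum pairing T \<phi>) UNIV"
proof -
  obtain C N where C: "\<And>\<psi> B. smooth_periodic \<psi> \<Longrightarrow> (\<forall>j\<le>N. \<forall>x. norm (vderivs j \<psi> x) \<le> B)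
      \<Longrightarrow> norm (pairing T \<psi>) \<le> C * B"
    using is_pdist_pairing[of T] unfolding is_pdist_def continuous_functional_def by metis
  define w where "w = (\<lambda>n k. norm (fcoef (vderivs n \<phi>) k))"
  define W where "W = (\<lambda>n. infsum (w n) UNIV)"
  have w: "(w n has_sum W n) UNIV" for n
    unfolding W_def w_def
    by (rule has_sum_infsum[OF summable_on_fcoef[OF smooth_periodic_vderivs[OF \<phi>]]])
  \<comment> \<open>a common bound for the derivatives up to order \<open>N\<close> of the remainder after the terms in \<open>F\<close>\<close>
  define B where "B = (\<lambda>F. \<Sum>n\<le>N. W n - sum (w n) F)"
  have B0: "(B \<longlongrightarrow> (\<Sum>n\<le>N. W n - W n)) (finite_subsets_at_top UNIV)"
    unfolding B_def using w by (intro tendsto_intros) (simp add: has_sum_def)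
  have bound: "norm (pairing T \<phi> - (\<Sum>k\<in>F. fcoef \<phi> k * pairing T (mode (- k)))) \<le> C * B F"
    if F: "finite F" for F
  proof -
    define D where "D = (\<lambda>n x. vderivs n \<phi> x - (\<Sum>k\<in>F. fcoef (vderivs n \<phi>) k * mode (- k) x))"
    have D': "(D n has_vector_derivative D (Suc n) x) (at x)" for n x
    proof -
      have "((\<lambda>x. fcoef (vderivs n \<phi>) k * mode (- k) x) has_vector_derivative
          fcoef (vderivs (Suc n) \<phi>) k * mode (- k) x) (at x)" for k
        using has_vector_derivative_mult_right[OF mode_derivative[of "- k" x UNIV], of "fcoef (vderivs n \<phi>) k"]
        by (simp add: fcoef_vderivs[OF \<phi>] mult_ac)
      then show ?thesis unfolding D_def
        by (intro has_vector_derivative_diff has_vector_derivative_sum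
            smooth_periodic_has_vector_derivative \<phi>) auto
    qed
    have per: "D 0 (x + 2 * pi) = D 0 x" for x
      by (simp add: D_def mode_period smooth_periodic_period[OF \<phi>])
    have sD: "smooth_periodic (D 0)" by (rule smooth_periodicI[of D, OF refl D' per])
    have vD: "vderivs n (D 0) = D n" for n by (rule vderivs_unique[of D, OF refl D'])
    have D_le: "norm (D n x) \<le> W n - sum (w n) F" for n x
      unfolding D_def
      by (rule has_sum_tail_bound[OF fourier_inversion[OF smooth_periodic_vderivs[OF \<phi>]] w F])
        (simp add: w_def norm_mult)
    have "norm (pairing T (D 0)) \<le> C * B F"
    proof (rule C[OF sD], intro allI impI)
      fix j x assume j: "j \<le> N"
      have "norm (vderivs j (D 0) x) \<le> W j - sum (w j) F" by (simp add: vD D_le)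
      also have "\<dots> \<le> B F"
        unfolding B_def using j D_le order_trans[OF norm_ge_zero D_le]
        by (intro member_le_sum[of j "{..N}" "\<lambda>n. W n - sum (w n) F"]) auto
      finally show "norm (vderivs j (D 0) x) \<le> B F" .
    qed
    moreover have "pairing T (D 0) = pairing T \<phi> - (\<Sum>k\<in>F. fcoef \<phi> k * pairing T (mode (- k)))"
    proof -
      let ?p = "\<lambda>x. \<Sum>k\<in>F. fcoef \<phi> k * mode (- k) x"
      have "pairing T \<phi> = pairing T (\<lambda>x. D 0 x + ?p x)" by (simp add: D_def)
      also have "\<dots> = pairing T (D 0) + pairing T ?p"
        using pairing_trig_poly[OF F] by (intro pairing_add sD) blast
      finally show ?thesis using pairing_trig_poly[OF F, of "fcoef \<phi>" T] by simp
    qed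
    ultimately show ?thesis by simp
  qed
  have "((\<lambda>F. C * B F) \<longlongrightarrow> C * 0) (finite_subsets_at_top UNIV)"
    using B0 by (intro tendsto_mult_left) simp
  then have lim: "((\<lambda>F. C * B F) \<longlongrightarrow> 0) (finite_subsets_at_top UNIV)" by simp
  have "((\<lambda>F. pairing T \<phi> - (\<Sum>k\<in>F. fcoef \<phi> k * pairing T (mode (- k)))) \<longlongrightarrow> 0) (finite_subsets_at_top UNIV)"
    by (rule Lim_null_comparison[OF _ lim])
      (auto intro!: eventually_finite_subsets_at_top_weakI bound)
  from tendsto_diff[OF tendsto_const[of "pairing T \<phi>"] this]
  show ?thesis by (simp add: has_sum_def)
qed

lemma fourier_coeff_eq: "fourier_coeff T k = pairing T (mode k) / (2 * of_real pi)"
  by (simp add: fourier_coeff_def mode_def[abs_def])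

lemma pairing_has_sum:
  assumes "smooth_periodic \<phi>"
  shows "((\<lambda>k. 2 * of_real pi * (fcoef \<phi> (- k) * fourier_coeff T k)) has_sum pairing T \<phi>) UNIV"
proof -
  have "((\<lambda>k. fcoef \<phi> (- k) * pairing T (mode k)) has_sum pairing T \<phi>) UNIV"
    using pairing_fourier_series[OF assms, of T]
    by (subst has_sum_reindex_bij_witness[where i = uminus and j = uminus and T = UNIV
        and h = "\<lambda>k. fcoef \<phi> k * pairing T (mode (- k))"]) auto
  then show ?thesis by (simp add: fourier_coeff_eq)
qed

lemma pdist_eqI:
  assumes "\<And>k. fourier_coeff S k = fourier_coeff T k"
  shows "S = T"
proof -
  have "pairing S \<phi> = pairing T \<phi>" for \<phi>
  proof (cases "smooth_periodic \<phi>")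
    case True
    show ?thesis
      by (rule has_sum_unique[OF pairing_has_sum[OF True, of S]])
        (use pairing_has_sum[OF True, of T] in \<open>simp add: assms\<close>)
  qed (simp add: pairing_not_smooth)
  then show ?thesis by (simp add: pairing_inject[symmetric] fun_eq_iff)
qed

text \<open>The coefficients of a test function are summable with a bound in terms of its first two
  derivatives, so every bounded sequence defines a distribution of order at most two.\<close>

lemma pdist_with_coeffs:
  assumes a: "\<And>k. norm (a k) \<le> A"
  shows "\<exists>T. \<forall>k. fourier_coeff T k = a k"
proof -
  define P where "P = (\<lambda>\<phi>. if smooth_periodic \<phi> then 2 * complex_of_real pi * (\<Sum>\<^sub>\<infinity>k. fcoef \<phi> (- k) * a k) else 0)"
  have A: "0 \<le> A" using a norm_ge_zero order_trans by blast
  have term_le: "norm (fcoef \<phi> (- k) * a k) \<le> A * norm (fcoef \<phi> (- k))" for \<phi> k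
    using a[of k] by (simp add: norm_mult mult.commute mult_right_mono)
  have abs: "(\<lambda>k. norm (fcoef \<phi> (- k) * a k)) summable_on UNIV" if \<phi>: "smooth_periodic \<phi>" for \<phi>
  proof (rule summable_on_comparison_test)
    have "(\<lambda>k. norm (fcoef \<phi> (- k))) summable_on UNIV"
      using summable_on_fcoef[OF \<phi>]
      by (subst summable_on_reindex_bij_witness[where i = uminus and j = uminus and T = UNIV
        and h = "\<lambda>k. norm (fcoef \<phi> k)"]) auto
    then show "(\<lambda>k. A * norm (fcoef \<phi> (- k))) summable_on UNIV"
      by (rule summable_on_cmult_right)
  qed (use term_le in auto)
  have sm: "(\<lambda>k. fcoef \<phi> (- k) * a k) summable_on UNIV" if "smooth_periodic \<phi>" for \<phi>
    by (rule abs_summable_summable[OF abs[OF that]])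
  have int: "(\<lambda>x. \<phi> x * mode k x) integrable_on {0..2 * pi}" if "smooth_periodic \<phi>" for \<phi> k
    using smooth_periodic_continuous_on[OF that, of _ 0] by (intro integrable_mult_mode) simp
  have "is_pdist P"
    unfolding is_pdist_def
  proof (intro conjI allI impI)
    fix \<phi> \<psi> :: "real \<Rightarrow> complex" assume s: "smooth_periodic \<phi>" "smooth_periodic \<psi>"
    have "fcoef (\<lambda>x. \<phi> x + \<psi> x) k = fcoef \<phi> k + fcoef \<psi> k" for k
      using int[OF s(1)] int[OF s(2)] by (simp add: fcoef_def distrib_right integral_add add_divide_distrib)
    then show "P (\<lambda>x. \<phi> x + \<psi> x) = P \<phi> + P \<psi>"
      using s sm by (simp add: P_def smooth_periodic_add distrib_right infsum_add distrib_left)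
  next
    fix c and \<phi> :: "real \<Rightarrow> complex" assume s: "smooth_periodic \<phi>"
    have "fcoef (\<lambda>x. c * \<phi> x) k = c * fcoef \<phi> k" for k
      by (simp add: fcoef_def mult.assoc)
    then show "P (\<lambda>x. c * \<phi> x) = c * P \<phi>"
      using s by (simp add: P_def smooth_periodic_scale mult.assoc infsum_cmult_right' mult.left_commute)
  next
    let ?Q = "\<Sum>\<^sub>\<infinity>k::int. 1 / (1 + (real_of_int k)\<^sup>2)"
    show "continuous_functional P"
      unfolding continuous_functional_def
    proof (intro exI[of _ "4 * pi * A * ?Q"] exI[of _ 2] allI impI)
      fix \<phi> :: "real \<Rightarrow> complex" and B
      assume s: "smooth_periodic \<phi>" and B: "\<forall>j\<le>2. \<forall>x. norm (vderivs j \<phi> x) \<le> B"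
      have sQ: "(\<lambda>k::int. 2 * A * B * (1 / (1 + (real_of_int k)\<^sup>2))) summable_on UNIV"
        by (rule summable_on_cmult_right[OF summable_on_int_inverse_square])
      have "norm (\<Sum>\<^sub>\<infinity>k. fcoef \<phi> (- k) * a k) \<le> (\<Sum>\<^sub>\<infinity>k::int. 2 * A * B * (1 / (1 + (real_of_int k)\<^sup>2)))"
      proof (rule norm_infsum_le[OF has_sum_infsum[OF sm[OF s]] has_sum_infsum[OF sQ]])
        fix k
        have "norm (fcoef \<phi> (- k) * a k) \<le> A * (2 * B * (1 / (1 + (of_int (- k))\<^sup>2)))"
          using B by (intro order_trans[OF term_le] mult_left_mono fcoef_decay s A) auto
        then show "norm (fcoef \<phi> (- k) * a k) \<le> 2 * A * B * (1 / (1 + (real_of_int k)\<^sup>2))"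
          by (simp add: mult_ac)
      qed
      also have "\<dots> = 2 * A * B * ?Q"
        by (rule infsum_cmult_right) (rule summable_on_int_inverse_square)
      finally have "norm (P \<phi>) \<le> 2 * pi * (2 * A * B * ?Q)"
        using s by (simp add: P_def norm_mult)
      then show "norm (P \<phi>) \<le> 4 * pi * A * ?Q * B" by (simp add: mult_ac)
    qed
  qed (simp add: P_def)
  then have P: "pairing (Abs_pdist P) = P" by (simp add: Abs_pdist_inverse)
  have "fourier_coeff (Abs_pdist P) k = a k" for k
  proof -
    have "(\<Sum>\<^sub>\<infinity>j. fcoef (mode k) (- j) * a j) = (\<Sum>\<^sub>\<infinity>j\<in>{k}. fcoef (mode k) (- j) * a j)"
      by (rule infsum_cong_neutral) (auto simp: fcoef_mode)
    then show ?thesis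
      unfolding fourier_coeff_eq P by (simp add: P_def smooth_periodic_mode fcoef_mode)
  qed
  then show ?thesis by blast
qed

lemma fourier_coeff_add: "fourier_coeff (S + T) k = fourier_coeff S k + fourier_coeff T k"
  and fourier_coeff_diff: "fourier_coeff (S - T) k = fourier_coeff S k - fourier_coeff T k"
  and fourier_coeff_scaleC: "fourier_coeff (scaleC_pdist c S) k = c * fourier_coeff S k"
  and fourier_coeff_scaleR: "fourier_coeff (r *\<^sub>R S) k = of_real r * fourier_coeff S k"
  by (simp_all add: fourier_coeff_eq plus_pdist.rep_eq minus_pdist.rep_eq scaleC_pdist.rep_eq
      scaleR_pdist.rep_eq add_divide_distrib diff_divide_distrib)

lemma fourier_coeff_one: "fourier_coeff one_pdist k = (if k = 0 then 1 else 0)"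
  by (simp add: fourier_coeff_eq one_pdist.rep_eq smooth_periodic_mode integral_mode)

lemma mean_eq: "mean T = fourier_coeff T 0"
  by (simp add: mean_def fourier_coeff_def)

lemma fourier_coeff_mult_pdist:
  assumes a: "smooth_periodic a"
  shows "((\<lambda>j. fcoef a (k - j) * fourier_coeff T j) has_sum fourier_coeff (mult_pdist a T) k) UNIV"
proof -
  have sm: "smooth_periodic (\<lambda>x. a x * mode k x)"
    by (intro smooth_periodic_mult a smooth_periodic_mode)
  have "fcoef (\<lambda>x. a x * mode k x) (- j) = fcoef a (k - j)" for j
    using mode_add[of k "- j"] by (simp add: fcoef_def mult.assoc)
  with pairing_has_sum[OF sm, of T]
  have "((\<lambda>j. 2 * of_real pi * (fcoef a (k - j) * fourier_coeff T j))
      has_sum pairing T (\<lambda>x. a x * mode k x)) UNIV" by simp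
  from has_sum_cmult_right[OF this, of "1 / (2 * of_real pi)"]
  show ?thesis
    by (simp add: fourier_coeff_eq[of "mult_pdist a T"] mult_pdist.rep_eq a smooth_periodic_mode)
qed

text \<open>The nonlocal term of the control operator is a Fourier coefficient as well: \<open>\<integral> g h\<close> is \<open>2 \<pi>\<close> times
  the mean of the product \<open>g h\<close>.\<close>

lemma control_op_eq:
  assumes "smooth_periodic g"
  shows "control_op g h = mult_pdist (\<lambda>x. of_real (g x)) h
    - scaleC_pdist (2 * of_real pi * fourier_coeff (mult_pdist (\<lambda>x. of_real (g x)) h) 0)
        (mult_pdist (\<lambda>x. of_real (g x)) one_pdist)"
proof -
  let ?g = "\<lambda>x. complex_of_real (g x)"
  have g: "smooth_periodic ?g" by (rule smooth_periodic_of_real[OF assms])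
  have "pairing h ?g = 2 * of_real pi * fourier_coeff (mult_pdist ?g h) 0"
    by (simp add: fourier_coeff_eq mult_pdist.rep_eq g smooth_periodic_mode)
  moreover have "mult_pdist ?g (h - scaleC_pdist c one_pdist)
      = mult_pdist ?g h - scaleC_pdist c (mult_pdist ?g one_pdist)" for c
    by (rule pairing_inject[THEN iffD1])
      (simp add: fun_eq_iff mult_pdist.rep_eq minus_pdist.rep_eq scaleC_pdist.rep_eq)
  ultimately show ?thesis by (simp add: control_op_def)
qed

section \<open>Sobolev spaces as sequence spaces\<close>

definition weight :: "real \<Rightarrow> int \<Rightarrow> real" where
  "weight s k = (1 + (real_of_int k)\<^sup>2) powr (s / 2)"

lemma weight_pos [simp]: "0 < weight s k"
proof -
  have "0 < 1 + (real_of_int k)\<^sup>2" by (simp add: add_pos_nonneg)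
  then show ?thesis by (simp add: weight_def)
qed

lemma weight_nonzero [simp]: "weight s k \<noteq> 0"
  by (rule less_imp_neq[THEN not_sym]) simp

lemma weight_0 [simp]: "weight s 0 = 1" by (simp add: weight_def)

lemma weight_ge_1: "0 \<le> s \<Longrightarrow> 1 \<le> weight s k"
  by (simp add: weight_def ge_one_powr_ge_zero)

lemma weight_square: "(weight s k)\<^sup>2 = (1 + (real_of_int k)\<^sup>2) powr s"
  by (simp add: weight_def power2_eq_square flip: powr_add)

text \<open>Peetre's inequality.\<close>

lemma weight_shift_le:
  assumes "0 \<le> s"
  shows "weight s k / weight s (k - m) \<le> (2 * (1 + (real_of_int m)\<^sup>2)) powr (s / 2)"
proof -
  let ?n = "real_of_int (k - m)" and ?m = "real_of_int m"
  have "0 \<le> (?m - ?n)\<^sup>2 + 2 * ?m\<^sup>2 * ?n\<^sup>2 + 1" by simp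
  then have "1 + (?m + ?n)\<^sup>2 \<le> 2 * (1 + ?m\<^sup>2) * (1 + ?n\<^sup>2)"
    by (simp add: power2_eq_square algebra_simps)
  moreover have "real_of_int k = ?m + ?n" by simp
  ultimately have "1 + (real_of_int k)\<^sup>2 \<le> 2 * (1 + ?m\<^sup>2) * (1 + ?n\<^sup>2)" by (simp only:)
  then have "weight s k \<le> (2 * (1 + ?m\<^sup>2) * (1 + ?n\<^sup>2)) powr (s / 2)"
    unfolding weight_def using assms by (intro powr_mono2) (auto simp: add_nonneg_nonneg)
  also have "\<dots> = (2 * (1 + ?m\<^sup>2)) powr (s / 2) * weight s (k - m)"
    unfolding weight_def by (rule powr_mult)
  finally show ?thesis by (simp add: pos_divide_le_eq)
qed

text \<open>The factor \<open>sqrt (2 \<pi>)\<close> makes the correspondence isometric.\<close>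

definition sob :: "real \<Rightarrow> ell2 \<Rightarrow> pdist" where
  "sob s a = (SOME T. \<forall>k. fourier_coeff T k = coord a k / of_real (sqrt (2 * pi) * weight s k))"

definition unsob :: "real \<Rightarrow> pdist \<Rightarrow> ell2" where
  "unsob s f = Abs_ell2 (\<lambda>k. of_real (sqrt (2 * pi) * weight s k) * fourier_coeff f k)"

lemma fourier_coeff_sob:
  assumes s: "0 \<le> s"
  shows "fourier_coeff (sob s a) k = coord a k / of_real (sqrt (2 * pi) * weight s k)"
proof -
  have "\<exists>T. \<forall>k. fourier_coeff T k = coord a k / of_real (sqrt (2 * pi) * weight s k)"
  proof (rule pdist_with_coeffs)
    fix k
    have "1 \<le> sqrt (2 * pi)" using pi_ge_two by (intro real_le_rsqrt) simp
    then have "1 \<le> sqrt (2 * pi) * weight s k"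
      using mult_mono[of 1 "sqrt (2 * pi)" 1 "weight s k"] weight_ge_1[OF s, of k] by simp
    then have "norm (coord a k / of_real (sqrt (2 * pi) * weight s k)) \<le> norm (coord a k) / 1"
      unfolding norm_divide norm_of_real by (intro divide_left_mono) auto
    also have "\<dots> \<le> norm a" by (simp add: norm_coord_le)
    finally show "norm (coord a k / of_real (sqrt (2 * pi) * weight s k)) \<le> norm a" .
  qed
  from someI_ex[OF this] show ?thesis by (simp add: sob_def)
qed

lemma sobolev_iff:
  "f \<in> sobolev s \<longleftrightarrow> square_summable (\<lambda>k. of_real (sqrt (2 * pi) * weight s k) * fourier_coeff f k)"
proof -
  have "(norm (of_real (sqrt (2 * pi) * weight s k) * fourier_coeff f k))\<^sup>2
      = 2 * pi * ((1 + (real_of_int k)\<^sup>2) powr s * (norm (fourier_coeff f k))\<^sup>2)" for k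
    by (simp add: norm_mult power_mult_distrib weight_square abs_mult)
  then show ?thesis by (simp add: sobolev_def square_summable_def summable_on_cmult_right')
qed

lemma coord_unsob:
  "f \<in> sobolev s \<Longrightarrow> coord (unsob s f) k = of_real (sqrt (2 * pi) * weight s k) * fourier_coeff f k"
  by (simp add: unsob_def Abs_ell2_inverse sobolev_iff)

lemma sob_in_sobolev: "0 \<le> s \<Longrightarrow> sob s a \<in> sobolev s"
  using square_summable_coord[of a] by (simp add: sobolev_iff fourier_coeff_sob)

lemma unsob_sob: "0 \<le> s \<Longrightarrow> unsob s (sob s a) = a"
  by (rule ell2_eqI) (simp add: coord_unsob sob_in_sobolev fourier_coeff_sob)

lemma sob_unsob: "0 \<le> s \<Longrightarrow> f \<in> sobolev s \<Longrightarrow> sob s (unsob s f) = f"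
  by (rule pdist_eqI) (simp add: coord_unsob fourier_coeff_sob)

lemma sobolev_norm_sob:
  assumes "0 \<le> s"
  shows "sobolev_norm s (sob s a) = norm a"
proof -
  have "(1 + (real_of_int k)\<^sup>2) powr s * (norm (fourier_coeff (sob s a) k))\<^sup>2
      = 1 / (2 * pi) * (norm (coord a k))\<^sup>2" for k
    unfolding weight_square[symmetric]
    by (simp add: fourier_coeff_sob[OF assms] norm_divide norm_mult power_divide power_mult_distrib abs_mult)
  then have "sobolev_norm s (sob s a) = sqrt (2 * pi * (\<Sum>\<^sub>\<infinity>k. 1 / (2 * pi) * (norm (coord a k))\<^sup>2))"
    by (simp only: sobolev_norm_def)
  also have "\<dots> = norm a"
    by (simp only: infsum_cmult_right' norm_ell2.rep_eq) simp
  finally show ?thesis .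
qed

lemma sob_add: "0 \<le> s \<Longrightarrow> sob s (a + b) = sob s a + sob s b"
  and sob_diff: "0 \<le> s \<Longrightarrow> sob s (a - b) = sob s a - sob s b"
  and sob_cscale: "0 \<le> s \<Longrightarrow> sob s (cscale c a) = scaleC_pdist c (sob s a)"
  and sob_scaleR: "0 \<le> s \<Longrightarrow> sob s (r *\<^sub>R a) = r *\<^sub>R sob s a"
  by (auto intro!: pdist_eqI simp: fourier_coeff_sob fourier_coeff_add fourier_coeff_diff
      fourier_coeff_scaleC fourier_coeff_scaleR add_divide_distrib diff_divide_distrib)

lemma sob_0: "0 \<le> s \<Longrightarrow> sob s 0 = 0"
  using sob_diff[of s 0 0] by simp

lemma sob_sum: "0 \<le> s \<Longrightarrow> sob s (\<Sum>i\<in>I. f i) = (\<Sum>i\<in>I. sob s (f i))"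
  by (induction I rule: infinite_finite_induct) (auto simp: sob_0 sob_add)

lemma sob_basis_0: "0 \<le> s \<Longrightarrow> sob s (cscale (of_real (sqrt (2 * pi)) * c) (basis 0)) = const_pdist c"
  by (auto intro!: pdist_eqI simp: fourier_coeff_sob fourier_coeff_scaleC fourier_coeff_one)

lemma const_mean_sob:
  "0 \<le> s \<Longrightarrow> const_pdist (mean (sob s a)) = sob s (cscale (coord a 0) (basis 0))"
  by (auto intro!: pdist_eqI simp: fourier_coeff_sob fourier_coeff_scaleC fourier_coeff_one mean_eq)

text \<open>The dispersion relation: the \<open>k\<close>-th Fourier mode evolves freely by \<open>exp (\<i> t phase \<alpha> k)\<close>.\<close>

definition phase :: "real \<Rightarrow> int \<Rightarrow> real" where
  "phase \<alpha> k = (real_of_int k)\<^sup>2 * (\<alpha> * sgn (real_of_int k) - real_of_int k)"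

lemma propagator_sob:
  assumes "0 \<le> s"
  shows "propagator \<alpha> t (sob s a) = sob s (unitary (phase \<alpha>) t a)"
  unfolding propagator_def
proof (rule the_equality)
  show eq: "\<forall>k. fourier_coeff (sob s (unitary (phase \<alpha>) t a)) k =
      exp (\<i> * of_real ((real_of_int k)\<^sup>2 * (\<alpha> * sgn (real_of_int k) - real_of_int k) * t))
        * fourier_coeff (sob s a) k"
    unfolding phase_def[symmetric] by (simp add: fourier_coeff_sob assms coord_unitary)
  show "F = sob s (unitary (phase \<alpha>) t a)" if "\<forall>k. fourier_coeff F k =
      exp (\<i> * of_real ((real_of_int k)\<^sup>2 * (\<alpha> * sgn (real_of_int k) - real_of_int k) * t))
        * fourier_coeff (sob s a) k" for F
    using that eq by (intro pdist_eqI) simp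
qed

text \<open>The Riemann integral of a continuous curve agrees with the integral in the Banach space
  \<open>ell2\<close>: uniform continuity bounds the error of every sufficiently fine Riemann sum.\<close>

lemma has_sobolev_integral_sob:
  assumes s: "0 \<le> s" and t: "0 \<le> t" and F: "continuous_on {0..t} F"
  shows "has_sobolev_integral s (\<lambda>x. sob s (F x)) (sob s (integral {0..t} F)) 0 t"
  unfolding has_sobolev_integral_def
proof (intro conjI ballI allI impI)
  fix \<epsilon> :: real assume \<epsilon>: "0 < \<epsilon>"
  define e where "e = \<epsilon> / (2 * (t + 1))"
  have e: "0 < e" using \<epsilon> t by (simp add: e_def)
  have "e * t \<le> e * (t + 1)" using e by simp
  also have "\<dots> = \<epsilon> / 2" using t by (simp add: e_def field_simps)
  finally have et: "e * t < \<epsilon>" using \<epsilon> by simp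
  obtain \<delta> where \<delta>: "0 < \<delta>" "\<forall>x\<in>{0..t}. \<forall>y\<in>{0..t}. dist y x < \<delta> \<longrightarrow> dist (F y) (F x) < e"
    using compact_uniformly_continuous[OF F compact_Icc, unfolded uniformly_continuous_on_def, rule_format, OF e]
    by (elim exE conjE) (rule that)
  show "\<exists>\<delta>>0. \<forall>p. p tagged_division_of {0..t} \<and> (\<lambda>t. ball t \<delta>) fine p \<longrightarrow>
      sobolev_norm s ((\<Sum>(x, J)\<in>p. measure lborel J *\<^sub>R sob s (F x)) - sob s (integral {0..t} F)) < \<epsilon>"
  proof (intro exI[of _ \<delta>] conjI \<delta>(1) allI impI)
    fix p assume p: "p tagged_division_of {0..t} \<and> (\<lambda>t. ball t \<delta>) fine p"
    then have pt: "p tagged_division_of cbox 0 t" by simp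
    have int: "F integrable_on cbox 0 t" using integrable_continuous_interval[OF F] by simp
    have fin: "finite p" using pt by (rule tagged_division_of_finite)
    have I: "integral {0..t} F = (\<Sum>(x, J)\<in>p. integral J F)"
      using integral_combine_tagged_division_topdown[OF int pt] by simp
    have item: "norm (measure lborel J *\<^sub>R F x - integral J F) \<le> e * measure lborel J" if xJ: "(x, J) \<in> p" for x J
    proof -
      obtain a b where J: "J = cbox a b" using tagged_division_ofD(4)[OF pt xJ] by blast
      have sub: "J \<subseteq> {0..t}" "x \<in> J" using tagged_division_ofD(2,3)[OF pt xJ] by auto
      have ball: "J \<subseteq> ball x \<delta>" using p xJ by (auto simp: fine_def)
      have ab: "a \<le> b" using sub(2) J by auto
      have JF: "F integrable_on J"
        using integrable_on_subcbox[OF int] sub J by simp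
      have "((\<lambda>y. F x - F y) has_integral (measure lborel J *\<^sub>R F x - integral J F)) (cbox a b)"
        using JF unfolding J by (intro has_integral_diff has_integral_const integrable_integral)
      then have "norm (measure lborel J *\<^sub>R F x - integral J F) \<le> e * measure lborel (cbox a b)"
      proof (rule has_integral_bound[OF less_imp_le[OF e]])
        fix y assume "y \<in> cbox a b"
        then have "y \<in> {0..t}" "dist x y < \<delta>" "x \<in> {0..t}" using sub ball J by auto
        then show "norm (F x - F y) \<le> e" using \<delta>(2) by (auto simp: dist_norm norm_minus_commute less_imp_le)
      qed
      then show ?thesis by (simp add: J)
    qed
    have "norm ((\<Sum>(x, J)\<in>p. measure lborel J *\<^sub>R F x) - integral {0..t} F)
        = norm (\<Sum>(x, J)\<in>p. measure lborel J *\<^sub>R F x - integral J F)"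
      unfolding I by (simp add: sum_subtractf[symmetric] case_prod_unfold)
    also have "\<dots> \<le> (\<Sum>(x, J)\<in>p. e * measure lborel J)"
      by (rule sum_norm_le) (use item in auto)
    also have "\<dots> = e * t"
      using additive_content_tagged_division[OF pt] t
      by (simp add: case_prod_unfold flip: sum_distrib_left)
    finally have "norm ((\<Sum>(x, J)\<in>p. measure lborel J *\<^sub>R F x) - integral {0..t} F) < \<epsilon>"
      using et by simp
    moreover have "(\<Sum>(x, J)\<in>p. measure lborel J *\<^sub>R sob s (F x)) - sob s (integral {0..t} F)
        = sob s ((\<Sum>(x, J)\<in>p. measure lborel J *\<^sub>R F x) - integral {0..t} F)"
      by (simp add: sob_diff sob_sum sob_scaleR s case_prod_unfold)
    ultimately show "sobolev_norm s ((\<Sum>(x, J)\<in>p. measure lborel J *\<^sub>R sob s (F x)) - sob s (integral {0..t} F)) < \<epsilon>"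
      by (simp add: sobolev_norm_sob s)
  qed
qed (use s in \<open>auto intro: sob_in_sobolev\<close>)

text \<open>Some tagged division is fine enough for both integrals, and its Riemann sum is close to both.\<close>

lemma has_sobolev_integral_unique:
  assumes s: "0 \<le> s" and I: "has_sobolev_integral s F I a b" and I': "has_sobolev_integral s F I' a b"
  shows "I = I'"
proof -
  have mem: "I \<in> sobolev s" "I' \<in> sobolev s" "\<And>t. t \<in> {a..b} \<Longrightarrow> F t \<in> sobolev s"
    using I I' by (auto simp: has_sobolev_integral_def)
  have "norm (unsob s I - unsob s I') \<le> 0 + \<epsilon>" if \<epsilon>: "0 < \<epsilon>" for \<epsilon>
  proof -
    have e2: "0 < \<epsilon> / 2" using \<epsilon> by simp
    obtain d1 where d1: "0 < d1" "\<And>p. p tagged_division_of {a..b} \<Longrightarrow> (\<lambda>t. ball t d1) fine p \<Longrightarrow>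
        sobolev_norm s ((\<Sum>(t, J)\<in>p. measure lborel J *\<^sub>R F t) - I) < \<epsilon> / 2"
      using I e2 unfolding has_sobolev_integral_def by meson
    obtain d2 where d2: "0 < d2" "\<And>p. p tagged_division_of {a..b} \<Longrightarrow> (\<lambda>t. ball t d2) fine p \<Longrightarrow>
        sobolev_norm s ((\<Sum>(t, J)\<in>p. measure lborel J *\<^sub>R F t) - I') < \<epsilon> / 2"
      using I' e2 unfolding has_sobolev_integral_def by meson
    have "gauge (\<lambda>t::real. ball t d1 \<inter> ball t d2)" using d1 d2 by (intro gauge_Int gauge_ball)
    then obtain p where p: "p tagged_division_of cbox a b" "(\<lambda>t. ball t d1 \<inter> ball t d2) fine p"
      by (rule fine_division_exists)
    have pf: "(\<lambda>t. ball t d1) fine p" "(\<lambda>t. ball t d2) fine p"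
      using p(2) by (simp_all add: fine_Int)
    define S where "S = (\<Sum>(t, J)\<in>p. measure lborel J *\<^sub>R unsob s (F t))"
    have "(\<Sum>(t, J)\<in>p. measure lborel J *\<^sub>R F t) = (\<Sum>(t, J)\<in>p. measure lborel J *\<^sub>R sob s (unsob s (F t)))"
      using tag_in_interval[OF p(1)] mem(3) s by (intro sum.cong) (auto simp: sob_unsob)
    then have S: "(\<Sum>(t, J)\<in>p. measure lborel J *\<^sub>R F t) = sob s S"
      by (simp add: S_def sob_sum sob_scaleR s case_prod_unfold)
    have "sobolev_norm s (sob s S - sob s (unsob s I)) < \<epsilon> / 2"
         "sobolev_norm s (sob s S - sob s (unsob s I')) < \<epsilon> / 2"
      using d1(2)[of p] d2(2)[of p] p(1) pf S mem s by (simp_all add: sob_unsob)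
    then have "norm (S - unsob s I) < \<epsilon> / 2" "norm (S - unsob s I') < \<epsilon> / 2"
      by (simp_all add: sobolev_norm_sob s flip: sob_diff[OF s])
    then show ?thesis
      using norm_triangle_ineq4[of "S - unsob s I'" "S - unsob s I"] by simp
  qed
  then have "norm (unsob s I - unsob s I') \<le> 0" by (rule field_le_epsilon)
  then have "unsob s I = unsob s I'" by simp
  then have "sob s (unsob s I) = sob s (unsob s I')" by (rule arg_cong)
  then show ?thesis using mem s by (simp add: sob_unsob)
qed

lemma sobolev_continuous_sob_iff:
  assumes s: "0 \<le> s" and v: "\<And>t. 0 \<le> t \<Longrightarrow> v t = sob s (w t)"
  shows "sobolev_continuous s v \<longleftrightarrow> continuous_on {0..} w"
proof -
  have "((\<lambda>t'. sobolev_norm s (v t' - v t)) \<longlongrightarrow> 0) (at t within {0..})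
      \<longleftrightarrow> ((\<lambda>t'. norm (w t' - w t)) \<longlongrightarrow> 0) (at t within {0..})" if t: "0 \<le> t" for t
  proof (rule tendsto_cong)
    show "\<forall>\<^sub>F t' in at t within {0..}. sobolev_norm s (v t' - v t) = norm (w t' - w t)"
      unfolding eventually_at_filter
      by (intro always_eventually allI impI) (use t in \<open>simp add: v sobolev_norm_sob s flip: sob_diff[OF s]\<close>)
  qed
  moreover have "((\<lambda>t'. norm (w t' - w t)) \<longlongrightarrow> 0) (at t within {0..}) \<longleftrightarrow> (w \<longlongrightarrow> w t) (at t within {0..})" for t
    by (simp add: tendsto_norm_zero_iff LIM_zero_iff)
  ultimately show ?thesis
    by (auto simp: sobolev_continuous_def continuous_on_def v sob_in_sobolev s)
qed

section \<open>The control operator on sequences\<close>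

lemma operator_series:
  fixes T :: "int \<Rightarrow> ell2 \<Rightarrow> ell2"
  assumes T: "\<And>m. bounded_clinear (T m)" and le: "\<And>m a. norm (T m a) \<le> \<beta> m * norm a"
    and \<beta>: "\<beta> summable_on UNIV"
  obtains S where "bounded_clinear S" "\<And>a. ((\<lambda>m. T m a) has_sum S a) UNIV"
proof -
  have s\<beta>: "(\<lambda>m. \<beta> m * norm a) summable_on UNIV" for a :: ell2
    by (rule summable_on_cmult_left[OF \<beta>])
  have "(\<lambda>m. norm (T m a)) summable_on UNIV" for a
    by (rule summable_on_comparison_test[OF s\<beta>[of a]]) (use le in auto)
  then have sm: "(\<lambda>m. T m a) summable_on UNIV" for a by (rule abs_summable_summable)
  define S where "S = (\<lambda>a. \<Sum>\<^sub>\<infinity>m. T m a)"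
  have S: "((\<lambda>m. T m a) has_sum S a) UNIV" for a
    unfolding S_def by (rule has_sum_infsum[OF sm])
  have "bounded_clinear S"
  proof (rule bounded_clinearI[where B = "infsum \<beta> UNIV"])
    show "S (a + b) = S a + S b" for a b
      using has_sum_add[OF S[of a] S[of b]] S[of "a + b"]
      by (intro has_sum_unique[OF S[of "a + b"]]) (simp add: bounded_clinear_add[OF T])
    show "S (cscale c a) = cscale c (S a)" for c a
      using has_sum_bounded_linear[OF bounded_linear_cscale S[of a], of c]
      by (intro has_sum_unique[OF S[of "cscale c a"]]) (simp add: bounded_clinear_cscale[OF T])
    show "norm (S a) \<le> infsum \<beta> UNIV * norm a" for a
      using norm_infsum_le[OF S[of a] has_sum_infsum[OF s\<beta>[of a]]] le
      by (simp add: infsum_cmult_left')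
  qed
  then show ?thesis using S that by blast
qed

lift_definition shift :: "int \<Rightarrow> ell2 \<Rightarrow> ell2" is "\<lambda>m a k. a (k - m)"
  unfolding square_summable_def
  by (subst summable_on_reindex_bij_witness[where i = "\<lambda>k. k + m" and j = "\<lambda>k. k - m" and T = UNIV
      and h = "\<lambda>k. (norm (a k))\<^sup>2" for m a]) auto

lemma coord_shift [simp]: "coord (shift m a) k = coord a (k - m)"
  by (simp add: shift.rep_eq)

lemma norm_shift: "norm (shift m a) = norm a"
proof -
  have "(\<Sum>\<^sub>\<infinity>k. (norm (coord a (k - m)))\<^sup>2) = (\<Sum>\<^sub>\<infinity>k. (norm (coord a k))\<^sup>2)"
    by (rule infsum_reindex_bij_witness[where i = "\<lambda>k. k + m" and j = "\<lambda>k. k - m"]) auto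
  then show ?thesis by (simp add: norm_ell2.rep_eq)
qed

lemma bounded_clinear_shift: "bounded_clinear (shift m)"
  by (rule bounded_clinearI[where B = 1]) (auto intro!: ell2_eqI simp: norm_shift)

text \<open>The polynomial weight is absorbed by finitely many derivatives of \<open>a\<close>.\<close>

lemma summable_on_fcoef_weighted:
  assumes a: "smooth_periodic a" and s: "0 \<le> s"
  shows "(\<lambda>m. norm (fcoef a m) * (2 * (1 + (real_of_int m)\<^sup>2)) powr (s / 2)) summable_on UNIV"
proof -
  define n where "n = nat \<lceil>s / 2\<rceil>"
  have n: "s / 2 \<le> real n" unfolding n_def using s by linarith
  have "(\<lambda>m. 4 ^ n * (norm (fcoef a m) + norm (fcoef (vderivs (2 * n) a) m))) summable_on UNIV"
    by (intro summable_on_cmult_right summable_on_add summable_on_fcoef smooth_periodic_vderivs a)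
  then show ?thesis
  proof (rule summable_on_comparison_test)
    fix m :: int
    let ?x = "(real_of_int m)\<^sup>2"
    have "(2 * (1 + ?x)) powr (s / 2) \<le> (2 * (1 + ?x)) powr real n"
      by (intro powr_mono n) simp
    also have "\<dots> = (2 * (1 + ?x)) ^ n"
      by (intro powr_realpow) (simp add: add_pos_nonneg)
    also have "\<dots> \<le> (4 * max 1 ?x) ^ n"
      by (intro power_mono) auto
    also have "\<dots> = 4 ^ n * (max 1 ?x) ^ n" by (rule power_mult_distrib)
    also have "\<dots> \<le> 4 ^ n * (1 + ?x ^ n)"
      by (intro mult_left_mono) (auto simp: max_def)
    finally have "norm (fcoef a m) * (2 * (1 + ?x)) powr (s / 2) \<le> norm (fcoef a m) * (4 ^ n * (1 + ?x ^ n))"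
      by (rule mult_left_mono) simp
    also have "\<dots> = 4 ^ n * (norm (fcoef a m) + norm (fcoef (vderivs (2 * n) a) m))"
    proof -
      have "norm (fcoef (vderivs (2 * n) a) m) = ?x ^ n * norm (fcoef a m)"
        by (simp add: fcoef_vderivs[OF a] norm_mult norm_power power_mult)
      then show ?thesis by (simp add: algebra_simps)
    qed
    finally show "norm (fcoef a m) * (2 * (1 + ?x)) powr (s / 2)
        \<le> 4 ^ n * (norm (fcoef a m) + norm (fcoef (vderivs (2 * n) a) m))" .
  qed simp
qed

text \<open>Multiplication by a smooth function is an absolutely convergent series of weighted shifts.\<close>

lemma multiplication_on_sequences:
  assumes a: "smooth_periodic a" and s: "0 \<le> s"
  obtains M where "bounded_clinear M" "\<And>x. sob s (M x) = mult_pdist a (sob s x)"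
proof -
  define \<beta> where "\<beta> = (\<lambda>m. (2 * (1 + (real_of_int m)\<^sup>2)) powr (s / 2))"
  define q where "q = (\<lambda>m k. complex_of_real (weight s k / weight s (k - m)))"
  have q: "norm (q m k) \<le> \<beta> m" for m k
    using weight_shift_le[OF s, of k m]
    by (simp add: q_def \<beta>_def norm_divide abs_of_pos[OF weight_pos])
  have \<beta>0: "0 \<le> \<beta> m" for m by (simp add: \<beta>_def)
  define T where "T = (\<lambda>m x. cscale (fcoef a m) (diag (q m) (shift m x)))"
  have cs: "bounded_clinear (cscale c)" for c
    by (auto simp: bounded_clinear_def bounded_linear_cscale cscale_cscale mult.commute)
  have T: "bounded_clinear (T m)" for m
    unfolding T_def
    by (intro bounded_clinear_compose[OF cs] bounded_clinear_compose[OF bounded_clinear_diag]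
        bounded_clinear_shift) (rule q)
  have T_le: "norm (T m x) \<le> (norm (fcoef a m) * \<beta> m) * norm x" for m x
  proof -
    have "norm (diag (q m) (shift m x)) \<le> \<beta> m * norm (shift m x)"
      by (rule norm_diag_le[OF q q \<beta>0])
    then show ?thesis
      unfolding T_def norm_cscale norm_shift mult.assoc by (intro mult_left_mono) auto
  qed
  obtain M where M: "bounded_clinear M" "\<And>x. ((\<lambda>m. T m x) has_sum M x) UNIV"
  proof (rule operator_series[of T "\<lambda>m. norm (fcoef a m) * \<beta> m", OF T T_le])
    show "(\<lambda>m. norm (fcoef a m) * \<beta> m) summable_on UNIV"
      unfolding \<beta>_def by (rule summable_on_fcoef_weighted[OF a s])
  qed (rule that)
  have "sob s (M x) = mult_pdist a (sob s x)" for x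
  proof (rule pdist_eqI)
    fix k
    let ?c = "complex_of_real (sqrt (2 * pi) * weight s k)"
    have "((\<lambda>m. coord (T m x) k) has_sum coord (M x) k) UNIV"
      by (rule has_sum_bounded_linear[OF bounded_linear_coord M(2)])
    then have "((\<lambda>j. coord (T (k - j) x) k) has_sum coord (M x) k) UNIV"
      by (subst has_sum_reindex_bij_witness[where i = "\<lambda>m. k - m" and j = "\<lambda>j. k - j" and T = UNIV
        and h = "\<lambda>m. coord (T m x) k"]) auto
    moreover have "coord (T (k - j) x) k = ?c * (fcoef a (k - j) * fourier_coeff (sob s x) j)" for j
      unfolding T_def coord_cscale coord_diag[OF q] coord_shift fourier_coeff_sob[OF s]
      by (simp add: q_def field_simps)
    ultimately have "((\<lambda>j. ?c * (fcoef a (k - j) * fourier_coeff (sob s x) j)) has_sum coord (M x) k) UNIV"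
      by simp
    moreover have "((\<lambda>j. ?c * (fcoef a (k - j) * fourier_coeff (sob s x) j)) has_sum
        ?c * fourier_coeff (mult_pdist a (sob s x)) k) UNIV"
      by (rule has_sum_cmult_right[OF fourier_coeff_mult_pdist[OF a]])
    ultimately have "coord (M x) k = ?c * fourier_coeff (mult_pdist a (sob s x)) k"
      by (rule has_sum_unique)
    then show "fourier_coeff (sob s (M x)) k = fourier_coeff (mult_pdist a (sob s x)) k"
      by (simp add: fourier_coeff_sob[OF s])
  qed
  then show ?thesis using M(1) that by blast
qed

lemma mult_pdist_scaleC: "mult_pdist a (scaleC_pdist c S) = scaleC_pdist c (mult_pdist a S)"
  by (rule pairing_inject[THEN iffD1]) (simp add: fun_eq_iff mult_pdist.rep_eq scaleC_pdist.rep_eq)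

lemma fcoef_0_normalised:
  assumes g: "smooth_periodic g" "integral {0..2 * pi} g = (1::real)"
  shows "fcoef (\<lambda>x. of_real (g x)) 0 = 1 / (2 * of_real pi)"
proof -
  have "(g has_integral 1) {0..2 * pi}"
    using smooth_periodic_continuous_on[OF g(1), of "{0..2 * pi}" 0] integrable_integral[of g "{0..2 * pi}"]
    by (simp add: integrable_continuous_interval g(2))
  from has_integral_linear[OF this bounded_linear_of_real[where 'a = complex]]
  show ?thesis by (simp add: fcoef_def o_def integral_unique)
qed

text \<open>The matrix of the control operator in the weighted basis: a convolution and a correction of rank one,
  which removes the mean.\<close>

lemma control_on_sequences:
  assumes g: "smooth_periodic g" "integral {0..2 * pi} g = 1" and s: "0 \<le> s"
  obtains G where "bounded_clinear G" "\<And>a. sob s (G a) = control_op g (sob s a)"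
    "\<And>y. coord (G y) 0 = 0"
    "\<And>j k. coord (G (basis j)) k = of_real (weight s k / weight s j) *
      (fcoef (\<lambda>x. of_real (g x)) (k - j)
        - 2 * of_real pi * fcoef (\<lambda>x. of_real (g x)) (- j) * fcoef (\<lambda>x. of_real (g x)) k)"
proof -
  let ?g = "\<lambda>x. complex_of_real (g x)" and ?r = "complex_of_real (sqrt (2 * pi))"
  have r: "?r \<noteq> 0" "?r * ?r = 2 * of_real pi"
    by (simp, simp only: of_real_mult[symmetric], simp)
  have sg: "smooth_periodic ?g" by (rule smooth_periodic_of_real[OF g(1)])
  obtain M where M: "bounded_clinear M" "\<And>x. sob s (M x) = mult_pdist ?g (sob s x)"
    using multiplication_on_sequences[OF sg s] by blast
  have M_basis: "coord (M (basis j)) k = of_real (weight s k / weight s j) * fcoef ?g (k - j)" for j k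
  proof -
    have "fourier_coeff (sob s (M (basis j))) k = (\<Sum>\<^sub>\<infinity>i. fcoef ?g (k - i) * fourier_coeff (sob s (basis j)) i)"
      using fourier_coeff_mult_pdist[OF sg, of k "sob s (basis j)"] by (simp add: M(2) infsumI)
    also have "\<dots> = (\<Sum>\<^sub>\<infinity>i\<in>{j}. fcoef ?g (k - i) * fourier_coeff (sob s (basis j)) i)"
      by (rule infsum_cong_neutral) (auto simp: fourier_coeff_sob[OF s])
    finally show ?thesis
      by (simp add: fourier_coeff_sob[OF s] field_simps)
  qed
  note g0 = fcoef_0_normalised[OF g]
  define G where "G = (\<lambda>a. M a - cscale (coord (M a) 0) (cscale (2 * of_real pi) (M (basis 0))))"
  have "bounded_clinear G"
    unfolding G_def
    by (intro bounded_clinear_minus M bounded_clinear_compose[OF bounded_clinear_rank_one M(1)])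
  moreover have "sob s (G a) = control_op g (sob s a)" for a
  proof -
    have "sob s (basis 0) = const_pdist (1 / ?r)"
      using sob_basis_0[OF s, of "1 / ?r"] r by simp
    then have "sob s (G a) = mult_pdist ?g (sob s a)
        - scaleC_pdist (coord (M a) 0) (scaleC_pdist (2 * of_real pi) (scaleC_pdist (1 / ?r) (mult_pdist ?g one_pdist)))"
      by (simp add: G_def sob_diff[OF s] sob_cscale[OF s] M(2) mult_pdist_scaleC)
    also have "\<dots> = mult_pdist ?g (sob s a) - scaleC_pdist (2 * of_real pi * (coord (M a) 0 / ?r)) (mult_pdist ?g one_pdist)"
      by (rule pdist_eqI) (simp add: fourier_coeff_diff fourier_coeff_scaleC)
    also have "coord (M a) 0 / ?r = fourier_coeff (mult_pdist ?g (sob s a)) 0"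
      by (simp add: fourier_coeff_sob[OF s] flip: M(2))
    finally show ?thesis by (simp add: control_op_eq[OF g(1)])
  qed
  moreover have "coord (G y) 0 = 0" for y
    by (simp add: G_def M_basis g0)
  moreover have "coord (G (basis j)) k = of_real (weight s k / weight s j) *
      (fcoef ?g (k - j) - 2 * of_real pi * fcoef ?g (- j) * fcoef ?g k)" for j k
    by (simp add: G_def M_basis field_simps)
  ultimately show ?thesis using that by blast
qed

section \<open>Spectral gap and unique continuation\<close>

lemma phase_uminus: "phase \<alpha> (- k) = - phase \<alpha> k"
  by (simp add: phase_def algebra_simps)

lemma phase_nonneg: "0 \<le> k \<Longrightarrow> phase \<alpha> k = (real_of_int k)\<^sup>2 * (\<alpha> - real_of_int k)"
  by (cases "k = 0") (simp_all add: phase_def)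

text \<open>The cubic term dominates: the distance of \<open>phase \<alpha> j\<close> from the other phases grows at least
  linearly.\<close>

lemma phase_gap_pos:
  assumes \<alpha>: "0 < \<alpha>" and j: "2 * \<alpha> + 2 \<le> real_of_int j" and k: "k \<noteq> j"
  shows "real_of_int j \<le> \<bar>phase \<alpha> k - phase \<alpha> j\<bar>"
proof -
  let ?J = "real_of_int j"
  have J: "0 < ?J" "1 \<le> ?J" "0 \<le> j" using j \<alpha> by auto
  show ?thesis
  proof (cases "0 \<le> k")
    case True
    let ?K = "real_of_int k"
    have K: "0 \<le> ?K" using True by simp
    have "1 \<le> \<bar>k - j\<bar>" using k by simp
    then have kj: "1 \<le> \<bar>?K - ?J\<bar>" by (metis of_int_1_le_iff of_int_abs of_int_diff)
    have eq: "phase \<alpha> k - phase \<alpha> j = (?J - ?K) * (?K\<^sup>2 + ?K * ?J + ?J\<^sup>2 - \<alpha> * (?K + ?J))"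
      by (simp add: phase_nonneg True J power2_eq_square algebra_simps)
    have "?J \<le> (?K + ?J) * (?J - \<alpha>)"
      using mult_mono[of ?J "?K + ?J" 1 "?J - \<alpha>"] J K j \<alpha> by simp
    also have "\<dots> \<le> ?K\<^sup>2 + ?K * ?J + ?J\<^sup>2 - \<alpha> * (?K + ?J)"
      by (simp add: power2_eq_square algebra_simps)
    finally have *: "?J \<le> ?K\<^sup>2 + ?K * ?J + ?J\<^sup>2 - \<alpha> * (?K + ?J)" .
    then have "1 * ?J \<le> \<bar>?J - ?K\<bar> * \<bar>?K\<^sup>2 + ?K * ?J + ?J\<^sup>2 - \<alpha> * (?K + ?J)\<bar>"
      using J kj by (intro mult_mono) auto
    then show ?thesis by (simp only: eq abs_mult mult_1)
  next
    case False
    define K where "K = real_of_int (- k)"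
    have K: "0 < K" using False by (simp add: K_def)
    have "phase \<alpha> k = - phase \<alpha> (- k)" using phase_uminus[of \<alpha> k] by simp
    then have eq: "phase \<alpha> k - phase \<alpha> j = K\<^sup>2 * (K - \<alpha>) + ?J\<^sup>2 * (?J - \<alpha>)"
      using phase_nonneg[of "- k" \<alpha>] False J by (simp add: phase_nonneg K_def algebra_simps)
    have "0 \<le> (K + ?J) * (K - ?J)\<^sup>2" using K J by simp
    then have "(K\<^sup>2 + ?J\<^sup>2) * ((K + ?J) / 2 - \<alpha>) \<le> K\<^sup>2 * (K - \<alpha>) + ?J\<^sup>2 * (?J - \<alpha>)"
      by (simp add: power2_eq_square field_simps)
    moreover have "(K\<^sup>2 + ?J\<^sup>2) * 1 \<le> (K\<^sup>2 + ?J\<^sup>2) * ((K + ?J) / 2 - \<alpha>)"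
      using j K by (intro mult_left_mono) (auto simp: field_simps)
    moreover have "?J * 1 \<le> ?J * ?J" using J by (intro mult_left_mono) auto
    ultimately have "?J \<le> K\<^sup>2 * (K - \<alpha>) + ?J\<^sup>2 * (?J - \<alpha>)"
      by (simp add: power2_eq_square) (smt (verit) zero_le_square)
    then show ?thesis by (simp add: eq)
  qed
qed

lemma phase_gap:
  assumes "0 < \<alpha>" and j: "2 * \<alpha> + 2 \<le> real_of_int \<bar>j\<bar>" and k: "k \<noteq> j"
  shows "real_of_int \<bar>j\<bar> \<le> \<bar>phase \<alpha> k - phase \<alpha> j\<bar>"
proof (cases "0 \<le> j")
  case True
  then show ?thesis using phase_gap_pos[OF assms(1), of j k] j k by simp
next
  case False
  then have "real_of_int (- j) \<le> \<bar>phase \<alpha> (- k) - phase \<alpha> (- j)\<bar>"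
    using j k by (intro phase_gap_pos assms(1)) auto
  then show ?thesis using False by (simp add: phase_uminus abs_minus_commute)
qed

lemma mode_power: "mode (int n) x = mode 1 x ^ n"
  by (induction n) (simp_all add: mode_add)

lemma mode_1_inj:
  assumes "mode 1 x = mode 1 y" "\<bar>x - y\<bar> < 1"
  shows "x = y"
proof -
  have "exp (- (\<i> * of_real x)) = exp (- (\<i> * complex_of_real y))"
    using assms(1) by (simp add: mode_def)
  then obtain n :: int where "- (\<i> * of_real x) = - (\<i> * of_real y) + (of_int (2 * n) * of_real pi) * \<i>"
    by (auto simp: exp_eq)
  then have "\<i> * complex_of_real (x - y) = \<i> * of_real (- (2 * pi * of_int n))"
    by (simp add: algebra_simps)
  then have xy: "x - y = - (2 * pi * of_int n)"
    by (simp only: mult_cancel_left of_real_eq_iff) auto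
  have "n = 0"
  proof (rule ccontr)
    assume "n \<noteq> 0"
    then have "1 \<le> \<bar>real_of_int n\<bar>" by (metis of_int_1_le_iff of_int_abs zero_less_abs_iff int_one_le_iff_zero_less)
    then have "2 * pi * 1 \<le> 2 * pi * \<bar>real_of_int n\<bar>" by (intro mult_left_mono) auto
    then have "2 * pi * 1 \<le> \<bar>x - y\<bar>" unfolding xy by (simp only: abs_minus_cancel abs_mult) simp
    then show False using assms(2) pi_ge_two by linarith
  qed
  then show ?thesis using xy by simp
qed

text \<open>A trigonometric polynomial is, up to a power of \<open>e\<^bsup>-ix\<^esup>\<close>, a polynomial in \<open>e\<^bsup>-ix\<^esup>\<close>,
  and a nonzero polynomial has finitely many roots.\<close>

lemma trig_poly_zero_on_interval:
  assumes E: "finite E" and ab: "a < b" and zero: "\<And>x. a < x \<Longrightarrow> x < b \<Longrightarrow> (\<Sum>k\<in>E. c k * mode k x) = 0"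
    and j: "j \<in> E"
  shows "c j = 0"
proof -
  define L where "L = Max (abs ` E)"
  have L: "0 \<le> k + L" if "k \<in> E" for k
  proof -
    have "\<bar>k\<bar> \<le> L" unfolding L_def using E that by (intro Max_ge) auto
    then show ?thesis by simp
  qed
  define p where "p = (\<Sum>k\<in>E. monom (c k) (nat (k + L)))"
  have poly_p: "poly p (mode 1 x) = mode L x * (\<Sum>k\<in>E. c k * mode k x)" for x
  proof -
    have "poly p (mode 1 x) = (\<Sum>k\<in>E. c k * mode (int (nat (k + L))) x)"
      by (simp add: p_def poly_sum poly_monom mode_power del: int_nat_eq)
    also have "\<dots> = (\<Sum>k\<in>E. mode L x * (c k * mode k x))"
      using L by (intro sum.cong) (auto simp: mode_add)
    finally show ?thesis by (simp add: sum_distrib_left)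
  qed
  \<comment> \<open>on an interval of length at most \<open>1 < 2 \<pi>\<close> the map \<open>x \<mapsto> e\<^bsup>-ix\<^esup>\<close> is injective\<close>
  define e where "e = min b (a + 1)"
  have ae: "a < e" using ab by (simp add: e_def)
  have inj: "inj_on (mode 1) {a<..<e}"
    by (rule inj_onI, rule mode_1_inj) (auto simp: e_def)
  have "infinite (mode 1 ` {a<..<e})"
    using finite_imageD[OF _ inj] infinite_Ioo[OF ae] by blast
  moreover have "mode 1 ` {a<..<e} \<subseteq> {z. poly p z = 0}"
    using zero by (auto simp: poly_p e_def)
  ultimately have "p = 0" using poly_roots_finite finite_subset by blast
  then have "0 = coeff p (nat (j + L))" by simp
  also have "\<dots> = (\<Sum>k\<in>E. if k = j then c k else 0)"
    unfolding p_def coeff_sum using L j by (intro sum.cong) (auto simp: nat_eq_iff)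
  also have "\<dots> = c j" using E j by simp
  finally show ?thesis by simp
qed

text \<open>Unique continuation: a trigonometric polynomial \<open>p\<close> annihilated by the adjoint of the control
  operator satisfies \<open>g (p - c) = 0\<close>, so it is constant on the support of \<open>g\<close> and hence constant.\<close>

lemma control_unique_continuation:
  assumes g: "control_profile g" and E: "finite E" and j: "j \<in> E" "j \<noteq> 0"
    and zero: "\<And>m. (\<Sum>k\<in>E. \<psi> k * (fcoef (\<lambda>x. of_real (g x)) (k - m)
        - 2 * of_real pi * fcoef (\<lambda>x. of_real (g x)) (- m) * fcoef (\<lambda>x. of_real (g x)) k)) = 0"
  shows "\<psi> j = 0"
proof -
  let ?g = "\<lambda>x. complex_of_real (g x)"
  have "smooth_periodic g" using g by (simp add: control_profile_def)
  then have sg: "smooth_periodic ?g" by (rule smooth_periodic_of_real)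
  then have cg: "continuous_on {0..2 * pi} ?g"
    using smooth_periodic_continuous_on[OF sg, of "{0..2 * pi}" 0] by simp
  define c where "c = 2 * of_real pi * (\<Sum>k\<in>E. \<psi> k * fcoef ?g k)"
  \<comment> \<open>the coefficients of \<open>p - c\<close>\<close>
  define b where "b = (\<lambda>k. (if k \<in> E then \<psi> k else 0) - (if k = 0 then c else 0))"
  let ?E = "insert 0 E"
  define P where "P = (\<lambda>x. \<Sum>k\<in>?E. b k * mode k x)"
  have "smooth_periodic (\<lambda>x. \<Sum>k\<in>uminus ` ?E. b (- k) * mode (- k) x)"
    using pairing_trig_poly[of "uminus ` ?E" "\<lambda>k. b (- k)"] E by blast
  then have sP: "smooth_periodic P"
    unfolding P_def by (subst (asm) sum.reindex) (auto simp: inj_on_def)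
  have sQ: "smooth_periodic (\<lambda>x. ?g x * P x)" by (intro smooth_periodic_mult sg sP)
  have split: "(\<Sum>k\<in>?E. b k * f k) = (\<Sum>k\<in>E. \<psi> k * f k) - c * f 0" for f :: "int \<Rightarrow> complex"
  proof -
    have "(\<Sum>k\<in>?E. b k * f k) = (\<Sum>k\<in>?E. (if k \<in> E then \<psi> k * f k else 0) - (if k = 0 then c * f 0 else 0))"
      by (intro sum.cong) (auto simp: b_def algebra_simps)
    also have "\<dots> = (\<Sum>k\<in>?E. if k \<in> E then \<psi> k * f k else 0) - c * f 0"
      using E by (simp add: sum_subtractf)
    also have "(\<Sum>k\<in>?E. if k \<in> E then \<psi> k * f k else 0) = (\<Sum>k\<in>E. \<psi> k * f k)"
      using E by (intro sum.mono_neutral_cong_right) auto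
    finally show ?thesis .
  qed
  have Q_coef: "fcoef (\<lambda>x. ?g x * P x) n = 0" for n
  proof -
    have "integral {0..2 * pi} (\<lambda>x. ?g x * P x * mode n x)
        = integral {0..2 * pi} (\<lambda>x. \<Sum>k\<in>?E. b k * (?g x * mode (k + n) x))"
      by (rule integral_cong) (simp add: P_def sum_distrib_left sum_distrib_right mode_add mult_ac)
    also have "\<dots> = (\<Sum>k\<in>?E. integral {0..2 * pi} (\<lambda>x. b k * (?g x * mode (k + n) x)))"
      using E by (intro integral_sum integrable_on_mult_right integrable_mult_mode cg) auto
    finally have "fcoef (\<lambda>x. ?g x * P x) n = (\<Sum>k\<in>?E. b k * fcoef ?g (k + n))"
      by (simp add: fcoef_def sum_divide_distrib)
    also have "\<dots> = (\<Sum>k\<in>E. \<psi> k * fcoef ?g (k + n)) - c * fcoef ?g n"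
      using split[of "\<lambda>k. fcoef ?g (k + n)"] by simp
    also have "\<dots> = (\<Sum>k\<in>E. \<psi> k * (fcoef ?g (k - (- n)) - 2 * of_real pi * fcoef ?g (- (- n)) * fcoef ?g k))"
      by (simp add: c_def algebra_simps sum_subtractf sum_distrib_left sum_distrib_right)
    also have "\<dots> = 0" by (rule zero)
    finally show ?thesis .
  qed
  have Q0: "?g x * P x = 0" for x
  proof (rule has_sum_unique)
    show "((\<lambda>_. 0) has_sum ?g x * P x) (UNIV :: int set)"
      using fourier_inversion[OF sQ, of x] by (simp add: Q_coef)
  qed simp
  obtain x0 x1 where x: "x0 < x1"
    "{x. g x > 0} = (\<Union>k::int. {x0 + 2 * pi * of_int k <..< x1 + 2 * pi * of_int k})"
    using g by (auto simp: control_profile_def)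
  have "P x = 0" if "x0 < x" "x < x1" for x
  proof -
    have "x \<in> (\<Union>k::int. {x0 + 2 * pi * of_int k <..< x1 + 2 * pi * of_int k})"
      using that by (intro UN_I[of 0]) auto
    then have "g x > 0" unfolding x(2)[symmetric] by simp
    then show ?thesis using Q0[of x] by simp
  qed
  then have "b j = 0"
    using E j by (intro trig_poly_zero_on_interval[of ?E x0 x1 b j]) (auto simp: P_def x)
  then show ?thesis using j by (simp add: b_def)
qed

section \<open>The closed loop\<close>

lemma has_sobolev_integral_cong:
  assumes "\<And>x. x \<in> {a..b} \<Longrightarrow> F x = F' x" and "has_sobolev_integral s F I a b"
  shows "has_sobolev_integral s F' I a b"
proof -
  have sums: "(\<Sum>(x, J)\<in>p. measure lborel J *\<^sub>R F' x) = (\<Sum>(x, J)\<in>p. measure lborel J *\<^sub>R F x)"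
    if "p tagged_division_of {a..b}" for p
  proof (intro sum.cong refl, clarify)
    fix x J assume "(x, J) \<in> p"
    then have "x \<in> {a..b}" using tagged_division_ofD(2,3)[OF that] by blast
    then show "measure lborel J *\<^sub>R F' x = measure lborel J *\<^sub>R F x" by (simp add: assms(1))
  qed
  show ?thesis
    unfolding has_sobolev_integral_def
  proof (intro conjI ballI allI impI)
    show "I \<in> sobolev s" using assms(2) by (simp add: has_sobolev_integral_def)
    show "F' x \<in> sobolev s" if "x \<in> {a..b}" for x
      using assms(2) that by (auto simp: has_sobolev_integral_def simp flip: assms(1))
    fix \<epsilon> :: real assume "0 < \<epsilon>"
    then obtain \<delta> where "0 < \<delta>" "\<forall>p. p tagged_division_of {a..b} \<and> (\<lambda>t. ball t \<delta>) fine p \<longrightarrow>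
        sobolev_norm s ((\<Sum>(x, J)\<in>p. measure lborel J *\<^sub>R F x) - I) < \<epsilon>"
      using assms(2) unfolding has_sobolev_integral_def by meson
    then show "\<exists>\<delta>>0. \<forall>p. p tagged_division_of {a..b} \<and> (\<lambda>t. ball t \<delta>) fine p \<longrightarrow>
        sobolev_norm s ((\<Sum>(x, J)\<in>p. measure lborel J *\<^sub>R F' x) - I) < \<epsilon>"
      by (intro exI[of _ \<delta>]) (auto simp: sums)
  qed
qed

text \<open>In the sequence space the mild formulation is a Volterra equation with the ordinary integral of a
  Banach-space-valued continuous function.\<close>

lemma mild_solution_sob_iff:
  assumes s: "0 \<le> s" and L: "bounded_clinear L" and K: "\<And>a. K (sob s a) = sob s (L a)"
    and v: "\<And>t. 0 \<le> t \<Longrightarrow> v t = sob s (w t)"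
  shows "mild_solution s \<alpha> K (sob s a) v \<longleftrightarrow> continuous_on {0..} w \<and>
    (\<forall>t\<ge>0. w t = unitary (phase \<alpha>) t a + integral {0..t} (\<lambda>x. unitary (phase \<alpha>) (t - x) (L (w x))))"
proof -
  have "(\<exists>I. has_sobolev_integral s (\<lambda>x. propagator \<alpha> (t - x) (K (v x))) I 0 t
        \<and> v t = propagator \<alpha> t (sob s a) + I)
      \<longleftrightarrow> w t = unitary (phase \<alpha>) t a + integral {0..t} (\<lambda>x. unitary (phase \<alpha>) (t - x) (L (w x)))"
    if w: "continuous_on {0..} w" and t: "0 \<le> t" for t
  proof -
    let ?F = "\<lambda>x. unitary (phase \<alpha>) (t - x) (L (w x))"
    have "continuous_on {0..t} w" by (rule continuous_on_subset[OF w]) auto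
    then have "continuous_on {0..t} ?F"
      by (intro continuous_on_unitary_curve continuous_intros
          bounded_linear.continuous_on[OF bounded_clinear_linear[OF L]])
    from has_sobolev_integral_sob[OF s t this]
    have int: "has_sobolev_integral s (\<lambda>x. propagator \<alpha> (t - x) (K (v x))) (sob s (integral {0..t} ?F)) 0 t"
      by (rule has_sobolev_integral_cong[rotated]) (simp add: v K propagator_sob s)
    have "(\<exists>I. has_sobolev_integral s (\<lambda>x. propagator \<alpha> (t - x) (K (v x))) I 0 t
          \<and> v t = propagator \<alpha> t (sob s a) + I)
        \<longleftrightarrow> v t = propagator \<alpha> t (sob s a) + sob s (integral {0..t} ?F)"
      using int has_sobolev_integral_unique[OF s _ int] by blast
    also have "\<dots> \<longleftrightarrow> sob s (w t) = sob s (unitary (phase \<alpha>) t a + integral {0..t} ?F)"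
      by (simp add: v t propagator_sob s sob_add)
    also have "\<dots> \<longleftrightarrow> w t = unitary (phase \<alpha>) t a + integral {0..t} ?F"
      by (metis unsob_sob[OF s])
    finally show ?thesis .
  qed
  then show ?thesis
    using sobolev_continuous_sob_iff[of s v w, OF s v] unfolding mild_solution_def by auto
qed

lemma mild_solution_unique:
  assumes s: "0 \<le> s" and L: "bounded_clinear L" and K: "\<And>a. K (sob s a) = sob s (L a)"
    and u: "mild_solution s \<alpha> K (sob s a) u" and v: "mild_solution s \<alpha> K (sob s a) v" and t: "0 \<le> t"
  shows "v t = u t"
proof -
  let ?U = "unitary (phase \<alpha>)"
  have rep: "\<And>x. 0 \<le> x \<Longrightarrow> f x = sob s (unsob s (f x))" if "mild_solution s \<alpha> K (sob s a) f" for f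
    using that by (simp add: mild_solution_def sobolev_continuous_def sob_unsob s)
  define p q where "p = (\<lambda>x. unsob s (u x))" and "q = (\<lambda>x. unsob s (v x))"
  have p: "continuous_on {0..} p"
    "\<And>x. 0 \<le> x \<Longrightarrow> p x = ?U x a + integral {0..x} (\<lambda>y. ?U (x - y) (L (p y)))"
    using u mild_solution_sob_iff[OF s L K rep[OF u]] by (auto simp: p_def)
  have q: "continuous_on {0..} q"
    "\<And>x. 0 \<le> x \<Longrightarrow> q x = ?U x a + integral {0..x} (\<lambda>y. ?U (x - y) (L (q y)))"
    using v mild_solution_sob_iff[OF s L K rep[OF v]] by (auto simp: q_def)
  have U: "bounded_clinear (?U x)" for x
    unfolding unitary_def by (rule bounded_clinear_diag[OF norm_exp_imag])
  have int: "(\<lambda>y. ?U (x - y) (L (f y))) integrable_on {0..x}" if "continuous_on {0..} f" for f x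
    by (intro integrable_continuous_interval continuous_on_unitary_curve continuous_intros
        bounded_linear.continuous_on[OF bounded_clinear_linear[OF L]] continuous_on_subset[OF that]) auto
  have "q t - p t = 0"
  proof (rule volterra_zero[OF L _ _ t])
    show "continuous_on {0..} (\<lambda>x. q x - p x)" by (intro continuous_intros p q)
    fix x :: real assume x: "0 \<le> x"
    have "q x - p x = integral {0..x} (\<lambda>y. ?U (x - y) (L (q y))) - integral {0..x} (\<lambda>y. ?U (x - y) (L (p y)))"
      using p(2)[OF x] q(2)[OF x] by simp
    also have "\<dots> = integral {0..x} (\<lambda>y. ?U (x - y) (L (q y - p y)))"
      by (simp add: integral_diff[OF int[OF q(1)] int[OF p(1)], symmetric]
          bounded_clinear_diff[OF L] bounded_clinear_diff[OF U])
    finally show "q x - p x = integral {0..x} (\<lambda>y. ?U (x - y) (L (q y - p y)))" .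
  qed
  then show ?thesis using rep[OF u t] rep[OF v t] by (simp add: p_def q_def)
qed

text \<open>At high frequencies the coefficients of \<open>g\<close> are small, so the diagonal entries of the control
  operator are close to the mean value \<open>1 / (2 \<pi>)\<close> of \<open>g\<close>; half of it is taken as the lower bound.\<close>

lemma control_spectral:
  assumes g: "control_profile g" and s: "0 \<le> s" and \<alpha>: "0 < \<alpha>" and lam: "0 < lam"
  obtains G N \<gamma> where "spectral_control (phase \<alpha>) G lam N \<gamma>" "\<And>a. sob s (G a) = control_op g (sob s a)"
proof -
  let ?c = "fcoef (\<lambda>x. of_real (g x))"
  have sg: "smooth_periodic g" "integral {0..2 * pi} g = 1" using g by (auto simp: control_profile_def)
  obtain G where G: "bounded_clinear G" "\<And>a. sob s (G a) = control_op g (sob s a)"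
    "\<And>y. coord (G y) 0 = 0"
    "\<And>j k. coord (G (basis j)) k = of_real (weight s k / weight s j) *
      (?c (k - j) - 2 * of_real pi * ?c (- j) * ?c k)"
    using control_on_sequences[OF sg s] by blast
  have "0 < 1 / (4 * pi)" by simp
  then obtain M where M: "\<lceil>2 * \<alpha> + 2\<rceil> \<le> M"
    "\<And>F. finite F \<Longrightarrow> (\<And>j. j \<in> F \<Longrightarrow> M < \<bar>j\<bar>) \<Longrightarrow> (\<Sum>j\<in>F. norm (?c j)) \<le> 1 / (4 * pi)"
    using int_tail_sum_small[OF summable_on_fcoef[OF smooth_periodic_of_real[OF sg(1)]] norm_ge_zero] by blast
  have c_le: "norm (?c j) \<le> 1 / (4 * pi)" if "M < \<bar>j\<bar>" for j
    using M(2)[of "{j}"] that by simp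
  have c0: "?c 0 = 1 / (2 * of_real pi)" by (rule fcoef_0_normalised[OF sg])
  have "spectral_control (phase \<alpha>) G lam M (1 / (4 * pi))"
  proof
    show "bounded_clinear G" "0 < lam" by (rule G, rule lam)
    show "1 \<le> M" using M(1) \<alpha> by linarith
    have M\<alpha>: "2 * \<alpha> + 2 \<le> real_of_int \<bar>j\<bar>" if "M < \<bar>j\<bar>" for j
      using M(1) that by linarith
    show gap: "real_of_int \<bar>j\<bar> \<le> \<bar>phase \<alpha> k - phase \<alpha> j\<bar>" if "M < \<bar>j\<bar>" "k \<noteq> j" for j k
      by (rule phase_gap[OF \<alpha> M\<alpha>]) (use that in auto)
    show "phase \<alpha> 0 = 0" by (simp add: phase_def)
    show "coord (G y) 0 = 0" for y by (rule G)
    show "0 < 1 / (4 * pi)" by simp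
    show "1 / (4 * pi) \<le> norm (coord (G (basis j)) j)" if j: "M < \<bar>j\<bar>" for j
    proof -
      have "norm (?c (- j)) * norm (?c j) \<le> 1 / (4 * pi) * (1 / (4 * pi))"
        using j by (intro mult_mono c_le) auto
      then have "norm (2 * of_real pi * ?c (- j) * ?c j) \<le> 2 * pi * (1 / (4 * pi) * (1 / (4 * pi)))"
        unfolding norm_mult mult.assoc by (simp add: mult_left_mono del: times_divide_eq_left times_divide_eq_right)
      also have "\<dots> \<le> 1 / (4 * pi)"
        using pi_ge_two by (simp add: field_simps)
      finally have "norm (2 * of_real pi * ?c (- j) * ?c j) \<le> 1 / (4 * pi)" .
      moreover have "norm (?c 0) = 1 / (4 * pi) + 1 / (4 * pi)" by (simp add: c0 norm_divide norm_mult)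
      ultimately show ?thesis
        using norm_triangle_ineq2[of "?c 0" "2 * of_real pi * ?c (- j) * ?c j"] by (simp add: G(4))
    qed
    show "\<phi> j = 0" if j: "j \<noteq> 0" and zero: "\<And>y. (\<Sum>k | phase \<alpha> k = phase \<alpha> j. \<phi> k * coord (G y) k) = 0" for j \<phi>
    proof -
      let ?E = "{k. phase \<alpha> k = phase \<alpha> j}"
      have "?E \<subseteq> insert j {- M..M}"
      proof
        fix k assume k: "k \<in> ?E"
        show "k \<in> insert j {- M..M}"
        proof (rule ccontr)
          assume "k \<notin> insert j {- M..M}"
          then have "M < \<bar>k\<bar>" "j \<noteq> k" by auto
          then show False using gap[of k j] k \<open>1 \<le> M\<close> by simp
        qed
      qed
      then have fin: "finite ?E" by (rule finite_subset) simp
      have "\<phi> j * of_real (weight s j) = 0"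
      proof (rule control_unique_continuation[OF g fin _ j, where \<psi> = "\<lambda>k. \<phi> k * of_real (weight s k)"])
        fix m
        have "0 = of_real (weight s m) * (\<Sum>k\<in>?E. \<phi> k * coord (G (basis m)) k)"
          using zero[of "basis m"] by simp
        also have "\<dots> = (\<Sum>k\<in>?E. \<phi> k * of_real (weight s k) * (?c (k - m) - 2 * of_real pi * ?c (- m) * ?c k))"
          unfolding sum_distrib_left by (intro sum.cong refl) (simp add: G(4))
        finally show "(\<Sum>k\<in>?E. \<phi> k * of_real (weight s k) * (?c (k - m) - 2 * of_real pi * ?c (- m) * ?c k)) = 0"
          by simp
      qed simp
      then show ?thesis by simp
    qed
  qed
  then show ?thesis using G(2) that by blast
qed

theorem theorem1p5:
  fixes g :: "real \<Rightarrow> real" and s \<alpha> lam :: real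
  assumes "control_profile g" and "s \<ge> 0" and "\<alpha> > 0" and "lam > 0"
  shows "\<exists>K. sobolev_bounded_linear s K \<and>
      (\<forall>f\<in>sobolev s. K f \<in> {control_op g h |h. h \<in> sobolev s}) \<and>
      (\<exists>M>0. \<forall>u0\<in>sobolev s.
        \<exists>u. mild_solution s \<alpha> K u0 u \<and>
          (\<forall>v. mild_solution s \<alpha> K u0 v \<longrightarrow> (\<forall>t\<ge>0. v t = u t)) \<and>
          (\<forall>t\<ge>0. sobolev_norm s (u t - const_pdist (mean u0))
             \<le> M * exp (- lam * t) * sobolev_norm s (u0 - const_pdist (mean u0))))"
proof -
  note s = assms(2)
  obtain G N \<gamma> where ctrl: "spectral_control (phase \<alpha>) G lam N \<gamma>"
    and G_control: "\<And>a. sob s (G a) = control_op g (sob s a)"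
    using control_spectral[OF assms] by blast
  interpret spectral_control "phase \<alpha>" G lam N \<gamma> by (rule ctrl)
  have cG: "bounded_clinear G" and G0: "\<And>y. coord (G y) 0 = 0"
    using ctrl by (auto simp: spectral_control_def)
  obtain X R Y d where XR: "inverse_pair X R" and Y: "bounded_clinear Y" and X0: "X (basis 0) = basis 0"
    and d0: "d 0 = 0" and d: "\<And>j. j \<noteq> 0 \<Longrightarrow> Re (d j) \<le> - lam"
    and col: "\<And>j k. (\<i> * phase \<alpha> k - d j) * coord (X (basis j)) k = - coord (G (Y (basis j))) k"
    using spectrum_shift by blast
  have X: "bounded_clinear X" and R: "bounded_clinear R" and RX: "\<And>a. R (X a) = a" and XR': "\<And>a. X (R a) = a"
    using XR by (auto simp: inverse_pair_def)
  define L where "L = (\<lambda>a. G (Y (R a)))"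
  have L: "bounded_clinear L"
    unfolding L_def by (intro bounded_clinear_compose[OF cG] bounded_clinear_compose[OF Y R])
  define K where "K = (\<lambda>f. sob s (L (unsob s f)))"
  have K: "K (sob s a) = sob s (L a)" for a by (simp add: K_def unsob_sob s)
  obtain Bl where Bl: "\<And>a. norm (L a) \<le> Bl * norm a" using bounded_clinear_bound[OF L] by blast
  obtain Bx where Bx: "Bx > 0" "\<And>a. norm (X a) \<le> Bx * norm a" using bounded_clinear_bound[OF X] by blast
  obtain Br where Br: "Br > 0" "\<And>a. norm (R a) \<le> Br * norm a" using bounded_clinear_bound[OF R] by blast
  have rep: "\<exists>a. f = sob s a" if "f \<in> sobolev s" for f
    using that by (intro exI[of _ "unsob s f"]) (simp add: sob_unsob s)

  have "sobolev_bounded_linear s K"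
    unfolding sobolev_bounded_linear_def
  proof (intro conjI ballI allI exI[of _ Bl])
    fix f assume "f \<in> sobolev s"
    then obtain a where a: "f = sob s a" using rep by blast
    show "K f \<in> sobolev s" by (simp add: a K sob_in_sobolev s)
    show "sobolev_norm s (K f) \<le> Bl * sobolev_norm s f" using Bl by (simp add: a K sobolev_norm_sob s)
    show "K (scaleC_pdist c f) = scaleC_pdist c (K f)" for c
      by (simp add: a K bounded_clinear_cscale[OF L] s flip: sob_cscale)
    fix h assume "h \<in> sobolev s"
    then obtain b where b: "h = sob s b" using rep by blast
    show "K (f + h) = K f + K h"
      by (simp add: a b K bounded_clinear_add[OF L] s flip: sob_add)
  qed
  moreover have "\<forall>f\<in>sobolev s. K f \<in> {control_op g h |h. h \<in> sobolev s}"
  proof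
    fix f assume "f \<in> sobolev s"
    have "K f = control_op g (sob s (Y (R (unsob s f))))" by (simp add: K_def L_def G_control)
    then show "K f \<in> {control_op g h |h. h \<in> sobolev s}" using sob_in_sobolev[OF s] by blast
  qed
  moreover have "\<exists>M>0. \<forall>u0\<in>sobolev s.
        \<exists>u. mild_solution s \<alpha> K u0 u \<and>
          (\<forall>v. mild_solution s \<alpha> K u0 v \<longrightarrow> (\<forall>t\<ge>0. v t = u t)) \<and>
          (\<forall>t\<ge>0. sobolev_norm s (u t - const_pdist (mean u0))
             \<le> M * exp (- lam * t) * sobolev_norm s (u0 - const_pdist (mean u0)))"
  proof (intro exI[of _ "Bx * Br"] conjI ballI)
    show "0 < Bx * Br" using Bx Br by simp
    fix u0 assume "u0 \<in> sobolev s"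
    then obtain a where a: "u0 = sob s a" using rep by blast
    let ?E = "\<lambda>t. diag (\<lambda>j. exp (of_real t * d j))"
    define w where "w = (\<lambda>t. X (?E t (R a)))"
    define u where "u = (\<lambda>t. sob s (w t))"
    have d_le: "Re (d j) \<le> 0" for j using d[of j] d0 assms(4) by (cases "j = 0") auto
    have E_le: "norm (exp (of_real t * d j)) \<le> 1" if "0 \<le> t" for t j
      using d_le[of j] that by (simp add: norm_exp_eq_Re mult_nonneg_nonpos)
    have "continuous_on {0..} (\<lambda>t. ?E t (R a))"
      by (rule continuous_on_diag) (use E_le in \<open>auto intro!: continuous_intros\<close>)
    then have cw: "continuous_on {0..} w"
      unfolding w_def by (rule bounded_linear.continuous_on[OF bounded_clinear_linear[OF X]])
    have GY: "bounded_clinear (\<lambda>b. G (Y b))" by (rule bounded_clinear_compose[OF cG Y])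
    have "w t = unitary (phase \<alpha>) t a + integral {0..t} (\<lambda>x. unitary (phase \<alpha>) (t - x) (L (w x)))"
      if t: "0 \<le> t" for t
      using conjugated_evolution_mild[OF X GY d_le col t, of "R a"]
      by (simp add: w_def L_def RX XR')
    then have mild: "mild_solution s \<alpha> K u0 u"
      unfolding a using cw by (subst mild_solution_sob_iff[OF s L K, of u w]) (auto simp: u_def)
    have decay: "sobolev_norm s (u t - const_pdist (mean u0))
        \<le> Bx * Br * exp (- lam * t) * sobolev_norm s (u0 - const_pdist (mean u0))" if t: "0 \<le> t" for t
    proof -
      define c where "c = cscale (coord a 0) (basis 0)"
      have const: "const_pdist (mean u0) = sob s c" by (simp add: a c_def const_mean_sob s)
      have E: "bounded_clinear (?E t)" by (rule bounded_clinear_diag[OF E_le[OF t]])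
      have "R (basis 0) = basis 0" using RX[of "basis 0"] X0 by simp
      moreover have "?E t (basis 0) = basis 0" using diag_basis[OF E_le[OF t], where j = 0] d0 by simp
      ultimately have c_fix: "X (?E t (R c)) = c"
        by (simp add: c_def bounded_clinear_cscale[OF R] bounded_clinear_cscale[OF E] bounded_clinear_cscale[OF X] X0)
      \<comment> \<open>the controls have mean zero, so \<open>A X + G Y = X D\<close> forces the row of index \<open>0\<close> of \<open>X\<close> to be
        that of the identity\<close>
      have X_mean: "coord (X b) 0 = coord b 0" for b
      proof -
        have "coord (X (basis j)) 0 = (if j = 0 then 1 else 0)" for j
          using col[where k = 0 and j = j] d[of j] assms(4) by (auto simp: X0 G0 phase_def)
        then have "(\<Sum>\<^sub>\<infinity>j. coord b j * coord (X (basis j)) 0) = (\<Sum>\<^sub>\<infinity>j\<in>{0}. coord b j * coord (X (basis j)) 0)"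
          by (intro infsum_cong_neutral) auto
        moreover have "((\<lambda>j. coord b j * coord (X (basis j)) 0) has_sum coord (X b) 0) UNIV"
          using has_sum_bounded_linear[OF bounded_linear_coord bounded_clinear_has_sum_basis[OF X]] by simp
        ultimately show ?thesis using X0 by (simp add: infsumI)
      qed
      have R0: "coord (R (a - c)) 0 = 0"
        using X_mean[of "R (a - c)"] by (simp add: XR' c_def)
      have "norm (?E t (R (a - c))) \<le> exp (- lam * t) * norm (R (a - c))"
      proof (rule norm_diag_le[OF _ E_le[OF t]])
        fix j assume "coord (R (a - c)) j \<noteq> 0"
        then have "j \<noteq> 0" using R0 by metis
        then show "norm (exp (of_real t * d j)) \<le> exp (- lam * t)"
          using mult_left_mono[OF d t] by (simp add: norm_exp_eq_Re mult.commute)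
      qed simp
      also have "\<dots> \<le> exp (- lam * t) * (Br * norm (a - c))"
        by (intro mult_left_mono Br) simp
      finally have "Bx * norm (?E t (R (a - c))) \<le> Bx * (exp (- lam * t) * (Br * norm (a - c)))"
        using Bx by (intro mult_left_mono) auto
      then have "norm (X (?E t (R (a - c)))) \<le> Bx * Br * exp (- lam * t) * norm (a - c)"
        using order_trans[OF Bx(2)] by (simp add: mult_ac)
      moreover have "w t - c = X (?E t (R (a - c)))"
        by (simp add: w_def bounded_clinear_diff[OF R] bounded_clinear_diff[OF E] bounded_clinear_diff[OF X] c_fix)
      ultimately show ?thesis
        unfolding const unfolding u_def a sob_diff[OF s, symmetric] sobolev_norm_sob[OF s] by simp
    qed
    show "\<exists>u. mild_solution s \<alpha> K u0 u \<and>
          (\<forall>v. mild_solution s \<alpha> K u0 v \<longrightarrow> (\<forall>t\<ge>0. v t = u t)) \<and>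
          (\<forall>t\<ge>0. sobolev_norm s (u t - const_pdist (mean u0))
             \<le> Bx * Br * exp (- lam * t) * sobolev_norm s (u0 - const_pdist (mean u0)))"
      using mild decay mild_solution_unique[OF s L K] unfolding a by blast
  qed
  ultimately show ?thesis by blast
qed

end
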